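(* Let $\lambda \ge 1$ and $c \ge 0$. Let $V:\mathbb{R}^n \to \mathbb{R}$ be a measurable function such that $x \mapsto V(x) + \lambda |x|^2/2$ is convex (i.e. $D^2 V \ge -\lambda \,\mathrm{Id}$), $\sup V - \inf V \le c$, and $d\mu = e^{-V}\, d\gamma$ is a probability measure. Then there exists an $L$-Lipschitz map $T:\mathbb{R}^n\to\mathbb{R}^n$ with $T_\# \gamma = \mu$, where \[ L = 2(2\lambda)^{e^{c}}. \]
   Context: $\gamma$ denotes the standard Gaussian measure on $\mathbb{R}^n$. For a measurable map $T$ and a measure $\nu$, the push-forward is $(T_\#\nu)(A) = \nu(T^{-1}(A))$ for Borel sets $A$. *)

theory Defs
  imports "HOL-Probability.Probability"
begin

definition std_gaussian :: "'a::euclidean_space measure" where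
  "std_gaussian = density lborel
     (\<lambda>x. ennreal ((2 * pi) powr (- real DIM('a) / 2) * exp (- (norm x)\<^sup>2 / 2)))"

end

theory Submission
  imports Defs
begin

text \<open>
  With \<open>f = exp (- V)\<close> and \<open>P\<^sub>t\<close> the Ornstein--Uhlenbeck semigroup, the measures \<open>P\<^sub>t f \<gamma>\<close> interpolate
  between \<open>\<mu>\<close> and \<open>\<gamma>\<close>, and the flow of \<open>\<nabla> log P\<^sub>t f\<close>, run backwards in time, transports \<open>\<gamma>\<close> to \<open>\<mu>\<close>
  (Kim and Milman). Its Lipschitz constant is \<open>exp (\<integral> \<theta>)\<close> for any bound \<open>\<theta>\<close> on the largest eigenvalue
  of the Hessian of \<open>log P\<^sub>t f\<close>. Two bounds are used. For small \<open>t\<close>, semiconvexity and bounded oscillation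
  make \<open>V\<close> Lipschitz with constant \<open>sqrt (2 \<lambda> c)\<close>, and comparing second differences under the integral
  gives \<open>\<theta> = exp (- 2 t) (\<lambda> + 4 \<lambda> c)\<close>. For large \<open>t\<close>, the weight \<open>f\<close> distorts the second moments of
  the Gaussian kernel by at most \<open>exp c\<close>, which gives \<open>\<theta> = (exp c - 1) exp (- 2 t) / (1 - exp (- 2 t))\<close>.
  Switching where \<open>1 - exp (- 2 t) = 1 / (2 \<lambda>)\<close> leaves enough room for the claimed constant.

  Neither the flow nor a change of variables is needed: the composition of \<open>N\<close> Euler steps of length
  \<open>h\<close> satisfies the same Lipschitz bound, and for smooth test functions \<open>\<phi>\<close> each step changes the integral
  by only \<open>O(h\<^sup>3\<^sup>/\<^sup>2)\<close>, because reversibility turns \<open>\<integral> \<phi> (q - P\<^sub>h q) d\<gamma>\<close> into half the integral of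
  \<open>(\<phi> x - \<phi> y) (q x - q y)\<close> over correlated Gaussian pairs. All these maps stay within bounded distance
  of the identity, so a subsequence converges to an exact transport map.
\<close>

section \<open>The standard Gaussian measure\<close>

text \<open>Neither \<open>V\<close> nor \<open>f\<close> is assumed differentiable. Semiconvexity
  therefore enters only through convexity inequalities and second differences, and every derivative
  of \<open>P\<^sub>t f\<close> falls on the Gaussian weight, with constants that are uniform for
  \<open>t \<ge> \<delta>\<close> but degenerate as \<delta> tends to 0. This dictates the order of
  choices: the accuracy fixes a starting time \<delta> and a horizon X, these fix the regularity
  constants, and only then is h chosen; N = X / h step errors of order h^(3/2) add up to order sqrt
  h. The Lipschitz bound does not see those constants. The step at time t is charged to the interval
  from t - h to t, and since both rates decrease in t, the product of the step bounds is at most the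
  exponential of the exact integral of the rate. Up to the switch this integral is at most (1 + 4 c)
  / 4, after it at most (exp c - 1) / 2 times ln (2 \<lambda>), and the sum is to be compared with
  ln 2 + exp c ln (2 \<lambda>).\<close>

lemma space_std_gaussian [simp]: "space std_gaussian = UNIV"
  by (simp add: std_gaussian_def)

lemma sets_std_gaussian [simp, measurable_cong]: "sets std_gaussian = sets borel"
  by (simp add: std_gaussian_def)

text \<open>The product form reduces the total mass to one-dimensional integrals.\<close>

lemma std_gaussian_density_prod:
  fixes x :: "'a::euclidean_space"
  shows "(2 * pi) powr (- real DIM('a) / 2) * exp (- (norm x)\<^sup>2 / 2)
    = (\<Prod>b\<in>Basis. std_normal_density (x \<bullet> b))"
proof -
  have "(\<Prod>b\<in>(Basis::'a set). std_normal_density (x \<bullet> b))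
      = (1 / sqrt (2 * pi)) ^ DIM('a) * exp (\<Sum>b\<in>(Basis::'a set). - (x \<bullet> b)\<^sup>2 / 2)"
    by (simp add: std_normal_density_def prod.distrib exp_sum power_divide prod_dividef)
  also have "(\<Sum>b\<in>(Basis::'a set). - (x \<bullet> b)\<^sup>2 / 2) = - (norm x)\<^sup>2 / 2"
    by (simp add: sum_negf sum_divide_distrib[symmetric] norm_eq_sqrt_inner
        euclidean_inner[of x x] power2_eq_square sum_nonneg)
  also have "(1 / sqrt (2 * pi)) ^ DIM('a) = (2 * pi) powr (- real DIM('a) / 2)"
    by (simp add: powr_half_sqrt[symmetric] powr_minus_divide[symmetric] powr_powr powr_realpow[symmetric])
  finally show ?thesis by simp
qed

lemma prob_space_std_gaussian: "prob_space (std_gaussian :: 'a::euclidean_space measure)"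
proof
  have "emeasure (std_gaussian :: 'a measure) UNIV =
    (\<integral>\<^sup>+x. (\<Prod>b\<in>(Basis::'a set). ennreal (std_normal_density (x \<bullet> b))) \<partial>lborel)"
    by (simp only: std_gaussian_def emeasure_density std_gaussian_density_prod) (simp add: emeasure_density prod_ennreal)
  also have "\<dots> = (\<Prod>b\<in>(Basis::'a set). \<integral>\<^sup>+x. ennreal (std_normal_density x) \<partial>lborel)"
    by (rule nn_integral_lborel_prod) auto
  also have "\<dots> = 1"
    by (simp add: nn_integral_eq_integral integral_std_normal_moment_even[of 0, simplified]
        has_bochner_integral_integral_eq[OF std_normal_moment_even[of 0, simplified]])
  finally show "emeasure std_gaussian (space (std_gaussian :: 'a measure)) = 1" by simp
qed

interpretation std_gaussian: prob_space "std_gaussian :: 'a::euclidean_space measure"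
  by (rule prob_space_std_gaussian)

lemma measure_std_gaussian_UNIV [simp]: "measure std_gaussian UNIV = 1"
  using std_gaussian.prob_space by simp

abbreviation gauss_mean :: "('a::euclidean_space \<Rightarrow> 'b::{banach, second_countable_topology}) \<Rightarrow> 'b"
    (binder "\<E>" 10) where
  "gauss_mean \<equiv> integral\<^sup>L std_gaussian"

text \<open>The Cameron--Martin formula, by completing the square. It trades the translation of a
  merely measurable function for a weight that is smooth in \<open>k\<close>.\<close>

lemma std_gaussian_shift:
  fixes k :: "'a::euclidean_space"
  shows "distr std_gaussian borel (\<lambda>z. z + k)
    = density std_gaussian (\<lambda>z. ennreal (exp (z \<bullet> k - (norm k)\<^sup>2 / 2)))"
proof -
  let ?c = "(2 * pi) powr (- real DIM('a) / 2)"
  let ?g = "\<lambda>x::'a. ennreal (?c * exp (- (norm x)\<^sup>2 / 2))"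
  have "lborel = distr lborel borel (\<lambda>z::'a. k + z)"
    by (simp add: lborel_distr_plus)
  then have "density lborel (\<lambda>z. ?g (z - k)) = density (distr lborel borel (\<lambda>z::'a. k + z)) (\<lambda>z. ?g (z - k))"
    by simp
  also have "\<dots> = distr (density lborel (\<lambda>z. ?g z)) borel (\<lambda>z. z + k)"
    by (subst density_distr) (simp_all add: add.commute[of _ k])
  finally have "distr std_gaussian borel (\<lambda>z. z + k) = density lborel (\<lambda>z. ?g (z - k))"
    by (simp add: std_gaussian_def)
  also have "\<dots> = density lborel (\<lambda>z. ?g z * ennreal (exp (z \<bullet> k - (norm k)\<^sup>2 / 2)))"
  proof (rule density_cong)
    have "?g (z - k) = ?g z * ennreal (exp (z \<bullet> k - (norm k)\<^sup>2 / 2))" for z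
    proof -
      have "- (norm (z - k))\<^sup>2 / 2 = - (norm z)\<^sup>2 / 2 + (z \<bullet> k - (norm k)\<^sup>2 / 2)"
        by (simp add: power2_norm_eq_inner inner_diff inner_commute field_simps)
      then have "exp (- (norm (z - k))\<^sup>2 / 2) = exp (- (norm z)\<^sup>2 / 2) * exp (z \<bullet> k - (norm k)\<^sup>2 / 2)"
        by (simp only: exp_add)
      then show ?thesis
        by (subst ennreal_mult'[symmetric]) (simp_all only: exp_ge_zero mult.assoc mult_nonneg_nonneg powr_ge_zero)
    qed
    then show "AE z in lborel. ?g (z - k) = ?g z * ennreal (exp (z \<bullet> k - (norm k)\<^sup>2 / 2))"
      by simp
  qed simp_all
  also have "\<dots> = density std_gaussian (\<lambda>z. ennreal (exp (z \<bullet> k - (norm k)\<^sup>2 / 2)))"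
    unfolding std_gaussian_def by (subst density_density_eq) simp_all
  finally show ?thesis .
qed

lemma integral_std_gaussian_shift:
  fixes \<psi> :: "'a::euclidean_space \<Rightarrow> 'b::{banach, second_countable_topology}"
  assumes [measurable]: "\<psi> \<in> borel_measurable borel"
  shows "(\<E> z. \<psi> (z + k))
    = (\<E> z. exp (z \<bullet> k - (norm k)\<^sup>2 / 2) *\<^sub>R \<psi> z)"
proof -
  have "(\<E> z. \<psi> (z + k)) = integral\<^sup>L (distr std_gaussian borel (\<lambda>z. z + k)) \<psi>"
    by (subst integral_distr) simp_all
  then show ?thesis
    unfolding std_gaussian_shift by (simp add: integral_density)
qed

lemma integrable_exp_inner_std_gaussian:
  "integrable std_gaussian (\<lambda>z::'a::euclidean_space. exp (z \<bullet> k))"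
proof -
  have "integrable (distr std_gaussian borel (\<lambda>z::'a. z + k)) (\<lambda>_. 1::real)"
    by (simp add: integrable_distr_eq)
  then have "integrable std_gaussian (\<lambda>z::'a. exp (z \<bullet> k - (norm k)\<^sup>2 / 2))"
    unfolding std_gaussian_shift by (simp add: integrable_density)
  then have "integrable std_gaussian (\<lambda>z::'a. exp ((norm k)\<^sup>2 / 2) * exp (z \<bullet> k - (norm k)\<^sup>2 / 2))"
    by (rule integrable_mult_right)
  then show ?thesis by (simp add: exp_add[symmetric])
qed

text \<open>The norm is at most \<open>DIM('a)\<close> times the largest absolute coordinate, so a
  finite sum of exponentials of linear functionals dominates.\<close>

lemma integrable_exp_norm_std_gaussian:
  "integrable std_gaussian (\<lambda>z::'a::euclidean_space. exp (r * norm z))"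
proof (rule Bochner_Integration.integrable_bound)
  let ?s = "\<bar>r\<bar> * real DIM('a)"
  show "integrable std_gaussian
      (\<lambda>z::'a. \<Sum>b\<in>Basis. exp (z \<bullet> (?s *\<^sub>R b)) + exp (z \<bullet> (- ?s *\<^sub>R b)))"
    by (intro Bochner_Integration.integrable_sum Bochner_Integration.integrable_add
        integrable_exp_inner_std_gaussian)
  show "AE z::'a in std_gaussian. norm (exp (r * norm z)) \<le>
      norm (\<Sum>b\<in>Basis. exp (z \<bullet> (?s *\<^sub>R b)) + exp (z \<bullet> (- ?s *\<^sub>R b)))"
  proof (rule AE_I2)
    fix z :: 'a
    define m where "m = Max ((\<lambda>b. \<bar>z \<bullet> b\<bar>) ` Basis)"
    have "m \<in> (\<lambda>b. \<bar>z \<bullet> b\<bar>) ` Basis" unfolding m_def by (rule Max_in) auto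
    then obtain b where b: "b \<in> Basis" "m = \<bar>z \<bullet> b\<bar>" by auto
    have "norm z \<le> (\<Sum>b\<in>Basis. \<bar>z \<bullet> b\<bar>)" by (rule norm_le_l1)
    also have "\<dots> \<le> (\<Sum>b\<in>(Basis::'a set). m)" by (rule sum_mono) (simp add: m_def)
    finally have "norm z \<le> real DIM('a) * \<bar>z \<bullet> b\<bar>" by (simp add: b)
    then have "\<bar>r\<bar> * norm z \<le> \<bar>r\<bar> * (real DIM('a) * \<bar>z \<bullet> b\<bar>)" by (intro mult_left_mono) auto
    moreover have "r * norm z \<le> \<bar>r\<bar> * norm z" by (intro mult_right_mono) auto
    ultimately have "exp (r * norm z) \<le> exp (?s * \<bar>z \<bullet> b\<bar>)" by (simp add: mult.assoc)
    also have "\<dots> \<le> exp (z \<bullet> (?s *\<^sub>R b)) + exp (z \<bullet> (- ?s *\<^sub>R b))"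
      by (cases "z \<bullet> b \<ge> 0") (simp_all add: add_increasing add_increasing2)
    also have "\<dots> \<le> (\<Sum>b\<in>Basis. exp (z \<bullet> (?s *\<^sub>R b)) + exp (z \<bullet> (- ?s *\<^sub>R b)))"
      using b by (intro member_le_sum) auto
    finally show "norm (exp (r * norm z)) \<le>
      norm (\<Sum>b\<in>Basis. exp (z \<bullet> (?s *\<^sub>R b)) + exp (z \<bullet> (- ?s *\<^sub>R b)))" by simp
  qed
qed simp

text \<open>The density of \<open>(x, a x + sqrt (1 - a\<^sup>2) z)\<close> for independent standard Gaussian \<open>x\<close> and \<open>z\<close>. Its symmetry
  is the reversibility of the Ornstein--Uhlenbeck semigroup.\<close>

definition ou_joint_density :: "real \<Rightarrow> 'a::euclidean_space \<Rightarrow> 'a \<Rightarrow> real" where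
  "ou_joint_density a x y = ((2 * pi) powr (- real DIM('a) / 2))\<^sup>2 / sqrt (1 - a\<^sup>2) ^ DIM('a) *
     exp (- ((norm x)\<^sup>2 + (norm y)\<^sup>2 - 2 * a * (x \<bullet> y)) / (2 * (1 - a\<^sup>2)))"

lemma ou_joint_density_commute: "ou_joint_density a x y = ou_joint_density a y x"
  by (simp add: ou_joint_density_def inner_commute add.commute)

text \<open>For fixed \<open>x\<close> substitute \<open>y = a *\<^sub>R x + b *\<^sub>R z\<close>:
  the Jacobian and the two Gaussian densities combine to the joint density.\<close>

lemma nn_integral_ou_pair:
  fixes \<Phi> :: "'a::euclidean_space \<times> 'a \<Rightarrow> ennreal"
  assumes [measurable]: "\<Phi> \<in> borel_measurable (borel \<Otimes>\<^sub>M borel)"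
    and ab: "b > 0" "a\<^sup>2 + b\<^sup>2 = 1"
  shows "(\<integral>\<^sup>+x. \<integral>\<^sup>+z. \<Phi> (x, a *\<^sub>R x + b *\<^sub>R z) \<partial>std_gaussian \<partial>std_gaussian)
    = (\<integral>\<^sup>+x. \<integral>\<^sup>+y. \<Phi> (x, y) * ennreal (ou_joint_density a x y) \<partial>lborel \<partial>lborel)"
proof -
  let ?c = "(2 * pi) powr (- real DIM('a) / 2)"
  let ?g = "\<lambda>x::'a. ?c * exp (- (norm x)\<^sup>2 / 2)"
  have b2: "1 - a\<^sup>2 = b\<^sup>2" and sb: "sqrt (1 - a\<^sup>2) = b" using ab by (auto simp: real_sqrt_eq_iff intro!: real_sqrt_unique)
  have key: "?g x * ?g z * (1 / b ^ DIM('a)) = ou_joint_density a x (a *\<^sub>R x + b *\<^sub>R z)" for x z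
  proof -
    have "((norm x)\<^sup>2 + (norm (a *\<^sub>R x + b *\<^sub>R z))\<^sup>2 - 2 * a * (x \<bullet> (a *\<^sub>R x + b *\<^sub>R z)))
        = (1 - a\<^sup>2) * (norm x)\<^sup>2 + b\<^sup>2 * (norm z)\<^sup>2"
      by (simp only: power2_norm_eq_inner) (simp add: inner_add inner_commute algebra_simps power2_eq_square)
    then have "- ((norm x)\<^sup>2 + (norm (a *\<^sub>R x + b *\<^sub>R z))\<^sup>2 - 2 * a * (x \<bullet> (a *\<^sub>R x + b *\<^sub>R z))) / (2 * (1 - a\<^sup>2))
      = - (norm x)\<^sup>2 / 2 + - (norm z)\<^sup>2 / 2"
      using ab by (simp add: b2 field_simps)
    then have e: "exp (- ((norm x)\<^sup>2 + (norm (a *\<^sub>R x + b *\<^sub>R z))\<^sup>2 - 2 * a * (x \<bullet> (a *\<^sub>R x + b *\<^sub>R z))) / (2 * (1 - a\<^sup>2)))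
      = exp (- (norm x)\<^sup>2 / 2) * exp (- (norm z)\<^sup>2 / 2)"
      by (simp only: exp_add)
    show ?thesis
      unfolding ou_joint_density_def sb e by (simp add: power2_eq_square)
  qed
  have "(\<integral>\<^sup>+x. \<integral>\<^sup>+z. \<Phi> (x, a *\<^sub>R x + b *\<^sub>R z) \<partial>std_gaussian \<partial>std_gaussian)
    = (\<integral>\<^sup>+x. ?g x * (\<integral>\<^sup>+z. ?g z * \<Phi> (x, a *\<^sub>R x + b *\<^sub>R z) \<partial>lborel) \<partial>lborel)"
    unfolding std_gaussian_def by (simp add: nn_integral_density)
  also have "\<dots> = (\<integral>\<^sup>+x. \<integral>\<^sup>+z. ?g x * (?g z * \<Phi> (x, a *\<^sub>R x + b *\<^sub>R z)) \<partial>lborel \<partial>lborel)"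
    by (intro nn_integral_cong nn_integral_cmult[symmetric]) measurable
  also have "\<dots> = (\<integral>\<^sup>+x. \<integral>\<^sup>+y. \<Phi> (x, y) * ennreal (ou_joint_density a x y) \<partial>lborel \<partial>lborel)"
  proof (rule nn_integral_cong)
    fix x :: 'a
    have [measurable]: "(\<lambda>y. ou_joint_density a x y) \<in> borel_measurable borel"
      unfolding ou_joint_density_def by measurable
    have "(\<integral>\<^sup>+y. \<Phi> (x, y) * ennreal (ou_joint_density a x y) \<partial>lborel)
      = (\<integral>\<^sup>+y. \<Phi> (x, y) * ennreal (ou_joint_density a x y) 
          \<partial>density (distr lborel borel (\<lambda>z. a *\<^sub>R x + b *\<^sub>R z)) (\<lambda>_. \<bar>b\<bar>^DIM('a)))"
      using lborel_affine[of b "a *\<^sub>R x"] ab by simp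
    also have "\<dots> = (\<integral>\<^sup>+z. b^DIM('a) * (\<Phi> (x, a *\<^sub>R x + b *\<^sub>R z) * ennreal (ou_joint_density a x (a *\<^sub>R x + b *\<^sub>R z))) \<partial>lborel)"
      using ab by (simp add: nn_integral_density nn_integral_distr)
    also have "\<dots> = (\<integral>\<^sup>+z. ?g x * (?g z * \<Phi> (x, a *\<^sub>R x + b *\<^sub>R z)) \<partial>lborel)"
    proof (rule nn_integral_cong)
      fix z :: 'a
      have "ennreal (b^DIM('a)) * ennreal (ou_joint_density a x (a *\<^sub>R x + b *\<^sub>R z)) = ennreal (?g x) * ennreal (?g z)"
        using ab by (simp add: key[symmetric] ennreal_mult'[symmetric])
      then have "(ennreal (b^DIM('a)) * ennreal (ou_joint_density a x (a *\<^sub>R x + b *\<^sub>R z))) * \<Phi> (x, a *\<^sub>R x + b *\<^sub>R z)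
        = ennreal (?g x) * ennreal (?g z) * \<Phi> (x, a *\<^sub>R x + b *\<^sub>R z)" by (simp only:)
      then show "b^DIM('a) * (\<Phi> (x, a *\<^sub>R x + b *\<^sub>R z) * ennreal (ou_joint_density a x (a *\<^sub>R x + b *\<^sub>R z)))
        = ?g x * (?g z * \<Phi> (x, a *\<^sub>R x + b *\<^sub>R z))"
        by (simp only: mult_ac)
    qed
    finally show "(\<integral>\<^sup>+z. ?g x * (?g z * \<Phi> (x, a *\<^sub>R x + b *\<^sub>R z)) \<partial>lborel)
      = (\<integral>\<^sup>+y. \<Phi> (x, y) * ennreal (ou_joint_density a x y) \<partial>lborel)" by simp
  qed
  finally show ?thesis .
qed

text \<open>Tonelli together with the symmetry of \<open>ou_joint_density\<close>.\<close>

lemma nn_integral_ou_exchange: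
  fixes \<Phi> :: "'a::euclidean_space \<times> 'a \<Rightarrow> ennreal"
  assumes [measurable]: "\<Phi> \<in> borel_measurable (borel \<Otimes>\<^sub>M borel)"
    and ab: "b > 0" "a\<^sup>2 + b\<^sup>2 = 1"
  shows "(\<integral>\<^sup>+x. \<integral>\<^sup>+z. \<Phi> (x, a *\<^sub>R x + b *\<^sub>R z) \<partial>std_gaussian \<partial>std_gaussian)
    = (\<integral>\<^sup>+x. \<integral>\<^sup>+z. \<Phi> (a *\<^sub>R x + b *\<^sub>R z, x) \<partial>std_gaussian \<partial>std_gaussian)"
proof -
  have [measurable]: "(\<lambda>p. ou_joint_density a (fst p) (snd p)) \<in> borel_measurable (borel \<Otimes>\<^sub>M borel)"
    unfolding ou_joint_density_def by measurable
  have "(\<integral>\<^sup>+x. \<integral>\<^sup>+z. \<Phi> (x, a *\<^sub>R x + b *\<^sub>R z) \<partial>std_gaussian \<partial>std_gaussian)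
    = (\<integral>\<^sup>+x. \<integral>\<^sup>+y. \<Phi> (x, y) * ennreal (ou_joint_density a x y) \<partial>lborel \<partial>lborel)"
    using ab by (rule nn_integral_ou_pair[OF assms(1)])
  also have "\<dots> = (\<integral>\<^sup>+y. \<integral>\<^sup>+x. \<Phi> (x, y) * ennreal (ou_joint_density a x y) \<partial>lborel \<partial>lborel)"
  proof -
    have [measurable]: "(\<lambda>p. \<Phi> p * ennreal (ou_joint_density a (fst p) (snd p))) \<in> borel_measurable (lborel \<Otimes>\<^sub>M lborel)"
      by (simp cong: measurable_cong_sets sets_pair_measure_cong)
    show ?thesis
      using lborel_pair.Fubini'[of "\<lambda>x y. \<Phi> (x, y) * ennreal (ou_joint_density a x y)"]
      by (simp add: split_beta')
  qed
  also have "\<dots> = (\<integral>\<^sup>+y. \<integral>\<^sup>+x. (\<Phi> \<circ> prod.swap) (y, x) * ennreal (ou_joint_density a y x) \<partial>lborel \<partial>lborel)"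
    by (simp add: ou_joint_density_commute)
  also have "\<dots> = (\<integral>\<^sup>+x. \<integral>\<^sup>+z. (\<Phi> \<circ> prod.swap) (x, a *\<^sub>R x + b *\<^sub>R z) \<partial>std_gaussian \<partial>std_gaussian)"
    using ab by (intro nn_integral_ou_pair[symmetric]) (simp_all add: comp_def prod.swap_def)
  finally show ?thesis by simp
qed

lemma integral_ou_exchange:
  fixes \<Phi> :: "'a::euclidean_space \<times> 'a \<Rightarrow> real"
  assumes [measurable]: "\<Phi> \<in> borel_measurable (borel \<Otimes>\<^sub>M borel)"
    and bd: "\<And>p. \<bar>\<Phi> p\<bar> \<le> B"
    and ab: "b > 0" "a\<^sup>2 + b\<^sup>2 = 1"
  shows "(\<E> x. \<E> z. \<Phi> (x, a *\<^sub>R x + b *\<^sub>R z))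
    = (\<E> x. \<E> z. \<Phi> (a *\<^sub>R x + b *\<^sub>R z, x))"
proof -
  \<comment> \<open>Adding \<open>B\<close> makes the integrand nonnegative, so the identity for
    nonnegative functions applies; the shift cancels because the Gaussian has mass one. The map
    \<open>h\<close> below lets both orders of the pair be treated at once.\<close>
  define \<Psi> where "\<Psi> p = \<Phi> p + B" for p
  have [measurable]: "\<Psi> \<in> borel_measurable (borel \<Otimes>\<^sub>M borel)" unfolding \<Psi>_def by measurable
  have nn: "\<Psi> p \<ge> 0" and le: "\<Psi> p \<le> 2 * B" for p using bd[of p] by (auto simp: \<Psi>_def abs_le_iff)
  have e: "ennreal (\<E> x. \<E> z. \<Psi> (h x z))
      = (\<integral>\<^sup>+x. \<integral>\<^sup>+z. ennreal (\<Psi> (h x z)) \<partial>std_gaussian \<partial>std_gaussian)"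
    and e2: "(\<E> x. \<E> z. \<Psi> (h x z)) = (\<E> x. \<E> z. \<Phi> (h x z)) + B"
    if [measurable]: "(\<lambda>p. h (fst p) (snd p)) \<in> (borel \<Otimes>\<^sub>M borel) \<rightarrow>\<^sub>M (borel \<Otimes>\<^sub>M borel)"
    for h :: "'a \<Rightarrow> 'a \<Rightarrow> 'a \<times> 'a"
  proof -
    have m1[measurable]: "(\<lambda>z. h x z) \<in> borel \<rightarrow>\<^sub>M (borel \<Otimes>\<^sub>M borel)" for x
      using measurable_compose[OF measurable_Pair1'[of x borel borel] that] by simp
    have i1: "integrable std_gaussian (\<lambda>z. \<Psi> (h x z))" for x
      by (rule std_gaussian.integrable_const_bound[where B="2*B"]) (use nn le in auto)
    have i1': "integrable std_gaussian (\<lambda>z. \<Phi> (h x z))" for x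
      by (rule std_gaussian.integrable_const_bound[where B="B"]) (use bd in auto)
    have m2: "(\<lambda>x. \<E> z. \<Phi> (h x z)) \<in> borel_measurable borel"
      by (rule std_gaussian.borel_measurable_lebesgue_integral) (simp add: split_beta' cong: measurable_cong_sets sets_pair_measure_cong)
    have m3: "(\<lambda>x. \<E> z. \<Psi> (h x z)) \<in> borel_measurable borel"
      by (rule std_gaussian.borel_measurable_lebesgue_integral) (simp add: split_beta' cong: measurable_cong_sets sets_pair_measure_cong)
    have bd2: "\<bar>\<E> z. \<Phi> (h x z)\<bar> \<le> B" for x
    proof -
      have "\<bar>\<E> z. \<Phi> (h x z)\<bar> \<le> (\<E> z. \<bar>\<Phi> (h x z)\<bar>)" by (rule integral_abs_bound)
      also have "\<dots> \<le> integral\<^sup>L (std_gaussian :: 'a measure) (\<lambda>z. B)"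
        using i1' by (intro integral_mono) (auto simp: bd)
      finally show ?thesis by simp
    qed
    have i2: "integrable std_gaussian (\<lambda>x. \<E> z. \<Phi> (h x z))"
      by (rule std_gaussian.integrable_const_bound[where B="B"]) (use bd2 m2 in auto)
    have s: "(\<E> z. \<Psi> (h x z)) = (\<E> z. \<Phi> (h x z)) + B" for x
      unfolding \<Psi>_def using i1' by simp
    show "(\<E> x. \<E> z. \<Psi> (h x z)) = (\<E> x. \<E> z. \<Phi> (h x z)) + B"
      unfolding s using i2 by simp
    have i3: "integrable std_gaussian (\<lambda>x. \<E> z. \<Psi> (h x z))"
      unfolding s using i2 by simp
    show "ennreal (\<E> x. \<E> z. \<Psi> (h x z))
      = (\<integral>\<^sup>+x. \<integral>\<^sup>+z. ennreal (\<Psi> (h x z)) \<partial>std_gaussian \<partial>std_gaussian)"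
      using i1 i3 nn by (simp add: nn_integral_eq_integral integral_nonneg)
  qed
  have "(\<integral>\<^sup>+x. \<integral>\<^sup>+z. ennreal (\<Psi> (x, a *\<^sub>R x + b *\<^sub>R z)) \<partial>std_gaussian \<partial>std_gaussian)
      = (\<integral>\<^sup>+x. \<integral>\<^sup>+z. ennreal (\<Psi> (a *\<^sub>R x + b *\<^sub>R z, x)) \<partial>std_gaussian \<partial>std_gaussian)"
    by (rule nn_integral_ou_exchange) (use ab in auto)
  then have "ennreal (\<E> x. \<E> z. \<Psi> (x, a *\<^sub>R x + b *\<^sub>R z))
    = ennreal (\<E> x. \<E> z. \<Psi> (a *\<^sub>R x + b *\<^sub>R z, x))"
    by (subst (1 2) e) simp_all
  then have "(\<E> x. \<E> z. \<Psi> (x, a *\<^sub>R x + b *\<^sub>R z))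
    = (\<E> x. \<E> z. \<Psi> (a *\<^sub>R x + b *\<^sub>R z, x))"
    by (subst (asm) ennreal_inj) (auto intro!: integral_nonneg simp: nn)
  then show ?thesis by (subst (asm) (1 2) e2) simp_all
qed

section \<open>Taylor expansion of Gaussian averages\<close>

lemma abs_exp_minus_one_le: "\<bar>exp x - 1\<bar> \<le> \<bar>x\<bar> * exp \<bar>x\<bar>" for x :: real
proof (cases "x \<ge> 0")
  case True
  have "(1 - exp (- x)) * exp x \<le> x * exp x"
    using exp_ge_add_one_self[of "-x"] by (intro mult_right_mono) auto
  then have "exp x - 1 \<le> x * exp x" by (simp add: left_diff_distrib exp_minus)
  then show ?thesis using True by simp
next
  case False
  have "\<bar>exp x - 1\<bar> \<le> \<bar>x\<bar>" using False exp_ge_add_one_self[of x] exp_le_one_iff[of x] by linarith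
  also have "\<dots> \<le> \<bar>x\<bar> * exp \<bar>x\<bar>" using mult_left_mono[of 1 "exp \<bar>x\<bar>" "\<bar>x\<bar>"] by simp
  finally show ?thesis .
qed

lemma abs_exp_minus_linear_le: "\<bar>exp x - 1 - x\<bar> \<le> x\<^sup>2 * exp \<bar>x\<bar>" for x :: real
proof -
  have "(1 - exp (- x)) * exp x \<le> x * exp x"
    using exp_ge_add_one_self[of "-x"] by (intro mult_right_mono) auto
  then have "exp x - 1 \<le> x * exp x" by (simp add: left_diff_distrib exp_minus)
  then have "exp x - 1 - x \<le> x * (exp x - 1)" by (simp add: right_diff_distrib)
  also have "\<dots> \<le> \<bar>x\<bar> * \<bar>exp x - 1\<bar>" by (metis abs_ge_self abs_mult)
  also have "\<dots> \<le> \<bar>x\<bar> * (\<bar>x\<bar> * exp \<bar>x\<bar>)" by (intro mult_left_mono abs_exp_minus_one_le) auto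
  also have "\<dots> = x\<^sup>2 * exp \<bar>x\<bar>" by (simp add: power2_eq_square mult.assoc[symmetric])
  finally show ?thesis using exp_ge_add_one_self[of x] by linarith
qed

text \<open>One majorant for all moments and Taylor remainders: with \<open>w = norm z + 1\<close>
  each of them is at most a combination of terms \<open>w ^ n * exp w ^ m\<close> with
  \<open>n + m \<le> 4\<close>, whose coefficients sum to at most 3.\<close>

definition gauss_dom :: "'a::euclidean_space \<Rightarrow> real" where
  "gauss_dom z = 3 * exp (4 * (norm z + 1))"

lemma gauss_dom_bounds:
  fixes z :: "'a::euclidean_space"
  shows "1 \<le> gauss_dom z" "norm z \<le> gauss_dom z" "norm ((z \<bullet> k) *\<^sub>R z - k) \<le> norm k * gauss_dom z"
    "norm k \<le> 1 \<Longrightarrow> \<bar>exp (z \<bullet> k - (norm k)\<^sup>2 / 2) - 1 - z \<bullet> k\<bar> \<le> (norm k)\<^sup>2 * gauss_dom z"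
    "norm k \<le> 1 \<Longrightarrow> norm (exp (z \<bullet> k - (norm k)\<^sup>2 / 2) *\<^sub>R (z - k) - z - ((z \<bullet> k) *\<^sub>R z - k))
      \<le> (norm k)\<^sup>2 * gauss_dom z"
    "(norm z)^2 \<le> gauss_dom z" "(norm z)^3 \<le> gauss_dom z" 
proof -
  define w where "w = norm z + 1"
  define e where "e = exp w"
  have w1: "1 \<le> w" and zw: "norm z \<le> w" by (auto simp: w_def)
  have we: "w \<le> e" using exp_ge_add_one_self[of w] unfolding e_def by linarith
  have e1: "1 \<le> e" using w1 we by simp
  have D: "gauss_dom z = 3 * e^4" by (simp add: gauss_dom_def e_def w_def exp_of_nat_mult[symmetric])
  have e4: "e^n \<le> e^4" if "n \<le> 4" for n using e1 that by (rule power_increasing[rotated])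
  have wn: "w^n * e^m \<le> e^4" if "n + m \<le> 4" for n m
  proof -
    have "w^n * e^m \<le> e^n * e^m" using we w1 e1 by (intro mult_right_mono power_mono) auto
    also have "\<dots> \<le> e^4" using e4[OF that] by (simp add: power_add)
    finally show ?thesis .
  qed
  show "1 \<le> gauss_dom z" using e4[of 0] by (simp add: D)
  show "norm z \<le> gauss_dom z" using wn[of 1 0] zw e4[of 0] by (simp add: D)
  have zn: "norm z ^ n \<le> w ^ n" for n by (intro power_mono zw) auto
  show "(norm z)^2 \<le> gauss_dom z" using wn[of 2 0] zn[of 2] e4[of 0] by (simp add: D)
  show "(norm z)^3 \<le> gauss_dom z" using wn[of 3 0] zn[of 3] e4[of 0] by (simp add: D)
  have "norm ((z \<bullet> k) *\<^sub>R z - k) \<le> norm ((z \<bullet> k) *\<^sub>R z) + norm k" by (rule norm_triangle_ineq4)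
  also have "norm ((z \<bullet> k) *\<^sub>R z) \<le> (norm z * norm k) * norm z"
    by (simp add: Cauchy_Schwarz_ineq2 mult_right_mono)
  also have "(norm z * norm k) * norm z + norm k = norm k * ((norm z)^2 + 1)"
    by (simp add: algebra_simps power2_eq_square)
  also have "\<dots> \<le> norm k * gauss_dom z"
    using wn[of 2 0] zn[of 2] e4[of 0] by (intro mult_left_mono) (auto simp: D)
  finally show "norm ((z \<bullet> k) *\<^sub>R z - k) \<le> norm k * gauss_dom z" by simp
  assume k1: "norm k \<le> 1"
  \<comment> \<open>The exponent of the shifted density. For \<open>norm k \<le> 1\<close> it is at
    most \<open>norm k * w\<close> in absolute value, so each order of expansion gains a factor
    \<open>norm k\<close> while the exponential stays below \<open>e\<close>.\<close>
  define x where "x = z \<bullet> k - (norm k)\<^sup>2 / 2"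
  have kk: "(norm k)\<^sup>2 \<le> norm k" using k1 by (simp add: power2_eq_square mult_left_le)
  have "\<bar>x\<bar> \<le> \<bar>z \<bullet> k\<bar> + (norm k)\<^sup>2 / 2" unfolding x_def using zero_le_power2[of "norm k"] by arith
  also have "\<dots> \<le> norm z * norm k + norm k" using kk Cauchy_Schwarz_ineq2[of z k] by (smt (verit) field_sum_of_halves norm_ge_zero zero_le_power2)
  finally have xk: "\<bar>x\<bar> \<le> norm k * w" by (simp add: w_def algebra_simps)
  also have "\<dots> \<le> w" using k1 w1 by (simp add: mult_left_le_one_le)
  finally have ex: "exp \<bar>x\<bar> \<le> e" by (simp add: e_def)
  have E1: "\<bar>exp x - 1\<bar> \<le> norm k * w * e"
    using abs_exp_minus_one_le[of x] mult_mono[OF xk ex] w1 by (simp add: mult_nonneg_nonneg)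
  have "x\<^sup>2 * exp \<bar>x\<bar> \<le> (norm k * w)\<^sup>2 * e"
    using xk ex w1 by (intro mult_mono) (auto simp: abs_le_square_iff[symmetric])
  then have "\<bar>exp x - 1 - x\<bar> \<le> (norm k)\<^sup>2 * w^2 * e" using abs_exp_minus_linear_le[of x] by (simp add: power_mult_distrib)
  moreover have "exp x - 1 - z \<bullet> k = (exp x - 1 - x) - (norm k)\<^sup>2 / 2" by (simp add: x_def)
  ultimately have "\<bar>exp x - 1 - z \<bullet> k\<bar> \<le> (norm k)\<^sup>2 * w^2 * e + (norm k)\<^sup>2 / 2" using zero_le_power2[of "norm k"] by arith
  then have E2: "\<bar>exp x - 1 - z \<bullet> k\<bar> \<le> (norm k)\<^sup>2 * (w^2 * e + 1/2)" by (simp add: algebra_simps)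
  also have "\<dots> \<le> (norm k)\<^sup>2 * gauss_dom z" using wn[of 2 1] e4[of 0] by (intro mult_left_mono) (auto simp: D)
  finally show "\<bar>exp (z \<bullet> k - (norm k)\<^sup>2 / 2) - 1 - z \<bullet> k\<bar> \<le> (norm k)\<^sup>2 * gauss_dom z" by (simp add: x_def)
  \<comment> \<open>The coefficient of \<open>z\<close> is already of second order in
    \<open>k\<close>; the other one is of first order and is multiplied by \<open>k\<close>.\<close>
  have "exp x *\<^sub>R (z - k) - z - ((z \<bullet> k) *\<^sub>R z - k) = (exp x - 1 - z \<bullet> k) *\<^sub>R z - (exp x - 1) *\<^sub>R k"
    by (simp add: algebra_simps)
  then have "norm (exp x *\<^sub>R (z - k) - z - ((z \<bullet> k) *\<^sub>R z - k)) \<le> \<bar>exp x - 1 - z \<bullet> k\<bar> * norm z + \<bar>exp x - 1\<bar> * norm k"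
    using norm_triangle_ineq4[of "(exp x - 1 - z \<bullet> k) *\<^sub>R z" "(exp x - 1) *\<^sub>R k"] by simp
  also have "\<dots> \<le> ((norm k)\<^sup>2 * (w^2 * e + 1/2)) * w + (norm k * w * e) * norm k"
    using E1 E2 zw w1 e1 by (intro add_mono mult_mono) auto
  also have "\<dots> = (norm k)\<^sup>2 * (w^3 * e^1 + (1/2) * (w^1 * e^0) + w^1 * e^1)"
    by (simp add: algebra_simps power2_eq_square power3_eq_cube)
  also have "\<dots> \<le> (norm k)\<^sup>2 * gauss_dom z" using wn[of 3 1] wn[of 1 0] wn[of 1 1] e4[of 0] unfolding D by (intro mult_left_mono) auto
  finally show "norm (exp (z \<bullet> k - (norm k)\<^sup>2 / 2) *\<^sub>R (z - k) - z - ((z \<bullet> k) *\<^sub>R z - k))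
      \<le> (norm k)\<^sup>2 * gauss_dom z" by (simp add: x_def)
qed

lemma gauss_dom_measurable [measurable]: "gauss_dom \<in> borel_measurable borel"
  unfolding gauss_dom_def[abs_def] by measurable

lemma integrable_gauss_dom: "integrable std_gaussian (gauss_dom :: 'a::euclidean_space \<Rightarrow> real)"
proof -
  have "integrable std_gaussian (\<lambda>z::'a. (3 * exp 4) * exp (4 * norm z))"
    by (intro integrable_mult_right integrable_exp_norm_std_gaussian)
  then show ?thesis by (simp add: gauss_dom_def[abs_def] distrib_left exp_add mult_ac)
qed

text \<open>A constant of the dimension alone, hence indexed by the type.\<close>

definition gauss_dom_int :: "'a::euclidean_space itself \<Rightarrow> real" where
  "gauss_dom_int _ = integral\<^sup>L std_gaussian (gauss_dom :: 'a \<Rightarrow> real)"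

lemma gauss_dom_int_ge1: "1 \<le> gauss_dom_int TYPE('a::euclidean_space)"
proof -
  have "integral\<^sup>L (std_gaussian :: 'a measure) (\<lambda>_. 1) \<le> integral\<^sup>L std_gaussian (gauss_dom :: 'a \<Rightarrow> real)"
    by (intro integral_mono integrable_gauss_dom) (auto simp: gauss_dom_bounds)
  then show ?thesis by (simp add: gauss_dom_int_def)
qed

lemma integral_dominated_gauss:
  fixes h :: "'a::euclidean_space \<Rightarrow> 'b::{banach, second_countable_topology}"
  assumes [measurable]: "h \<in> borel_measurable borel" and h: "\<And>z. norm (h z) \<le> c * gauss_dom z"
  shows "integrable std_gaussian h" "norm (\<E> z. h z) \<le> c * gauss_dom_int TYPE('a)"
proof -
  have i: "integrable std_gaussian (\<lambda>z::'a. c * gauss_dom z)"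
    by (intro integrable_mult_right integrable_gauss_dom)
  show i2: "integrable std_gaussian h"
    by (rule Bochner_Integration.integrable_bound[OF i]) (use h in \<open>auto intro: order_trans[OF _ abs_ge_self]\<close>)
  have "norm (\<E> z. h z) \<le> (\<E> z. norm (h z))" by (rule integral_norm_bound)
  also have "\<dots> \<le> integral\<^sup>L std_gaussian (\<lambda>z::'a. c * gauss_dom z)"
    using i i2 h by (intro integral_mono) auto
  finally show "norm (\<E> z. h z) \<le> c * gauss_dom_int TYPE('a)"
    by (simp add: gauss_dom_int_def)
qed

section \<open>Gaussian smoothing of bounded measurable functions\<close>

definition gsmooth :: "('a::euclidean_space \<Rightarrow> real) \<Rightarrow> 'a \<Rightarrow> real" where
  "gsmooth F u = (\<E> z. F (u + z))"

text \<open>Here and in \<open>gsmooth_hess\<close> the derivatives of \<open>gsmooth F\<close> have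
  been moved onto the Gaussian, which produces the first two Hermite polynomials; no regularity of
  \<open>F\<close> is involved.\<close>

definition gsmooth_grad :: "('a::euclidean_space \<Rightarrow> real) \<Rightarrow> 'a \<Rightarrow> 'a" where
  "gsmooth_grad F u = (\<E> z. F (u + z) *\<^sub>R z)"

definition gsmooth_hess :: "('a::euclidean_space \<Rightarrow> real) \<Rightarrow> 'a \<Rightarrow> 'a \<Rightarrow> 'a" where
  "gsmooth_hess F u k = (\<E> z. F (u + z) *\<^sub>R ((z \<bullet> k) *\<^sub>R z - k))"

lemma bounded_scaleR_le:
  fixes v :: "'b::real_normed_vector"
  shows "\<bar>r::real\<bar> \<le> B \<Longrightarrow> norm v \<le> c * d \<Longrightarrow> norm (r *\<^sub>R v) \<le> (B * c) * d"
  using mult_mono[of "\<bar>r\<bar>" B "norm v" "c * d"] by (simp add: mult.assoc)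

context
  fixes F :: "'a::euclidean_space \<Rightarrow> real" and B :: real
  assumes F_measurable [measurable]: "F \<in> borel_measurable borel" and F_bound: "\<And>w. \<bar>F w\<bar> \<le> B"
begin

lemma gsmooth_dominated:
  fixes h :: "'a \<Rightarrow> 'b::{banach, second_countable_topology}"
  assumes [measurable]: "h \<in> borel_measurable borel" and h: "\<And>z. norm (h z) \<le> c * gauss_dom z"
  shows "integrable std_gaussian (\<lambda>z. F (u + z) *\<^sub>R h z)"
    "norm (\<E> z. F (u + z) *\<^sub>R h z) \<le> B * c * gauss_dom_int TYPE('a)"
proof -
  have "norm (F (u + z) *\<^sub>R h z) \<le> (B * c) * gauss_dom z" for z
    using F_bound h by (intro bounded_scaleR_le)
  then show "integrable std_gaussian (\<lambda>z. F (u + z) *\<^sub>R h z)"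
    "norm (\<E> z. F (u + z) *\<^sub>R h z) \<le> B * c * gauss_dom_int TYPE('a)"
    using integral_dominated_gauss[of "\<lambda>z. F (u + z) *\<^sub>R h z" "B * c"] by auto
qed

lemma B_nonneg: "0 \<le> B"
  using F_bound[of 0] by simp

lemma gsmooth_bounds:
  "\<bar>gsmooth F u\<bar> \<le> B"
  "norm (gsmooth_grad F u) \<le> B * gauss_dom_int TYPE('a)"
  "norm (gsmooth_hess F u k) \<le> B * gauss_dom_int TYPE('a) * norm k"
proof -
  have "integrable std_gaussian (\<lambda>z. F (u + z))"
    by (rule std_gaussian.integrable_const_bound[where B=B]) (use F_bound in auto)
  then have "norm (\<E> z. F (u + z)) \<le> integral\<^sup>L (std_gaussian::'a measure) (\<lambda>_. B)"
    by (intro order_trans[OF integral_norm_bound] integral_mono) (use F_bound in auto)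
  then show "\<bar>gsmooth F u\<bar> \<le> B" by (simp add: gsmooth_def)
  show "norm (gsmooth_grad F u) \<le> B * gauss_dom_int TYPE('a)"
    unfolding gsmooth_grad_def using gsmooth_dominated(2)[of "\<lambda>z. z" 1 u] by (simp add: gauss_dom_bounds)
  show "norm (gsmooth_hess F u k) \<le> B * gauss_dom_int TYPE('a) * norm k"
    unfolding gsmooth_hess_def using gsmooth_dominated(2)[of "\<lambda>z. (z \<bullet> k) *\<^sub>R z - k" "norm k" u]
    gauss_dom_bounds(3)[of _ k] by (simp add: mult.assoc mult.commute[of _ "norm k"])
qed

lemma gsmooth_hess_inner:
  "gsmooth_hess F u k \<bullet> l = (\<E> z. F (u + z) * ((z \<bullet> k) * (z \<bullet> l) - k \<bullet> l))"
proof -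
  have "integrable std_gaussian (\<lambda>z. F (u + z) *\<^sub>R ((z \<bullet> k) *\<^sub>R z - k))"
    by (rule gsmooth_dominated(1)[where c="norm k"]) (auto simp: gauss_dom_bounds)
  then show ?thesis unfolding gsmooth_hess_def
    by (subst integral_inner_left[symmetric]) (auto simp: inner_diff_left)
qed

lemma gsmooth_hess_sym: "gsmooth_hess F u k \<bullet> l = gsmooth_hess F u l \<bullet> k"
  unfolding gsmooth_hess_inner by (simp add: inner_commute mult.commute)

lemma linear_gsmooth_hess: "linear (gsmooth_hess F u)"
proof (rule linearI)
  have i: "integrable std_gaussian (\<lambda>z. F (u + z) *\<^sub>R ((z \<bullet> k) *\<^sub>R z - k))" for k
    by (rule gsmooth_dominated(1)[where c="norm k"]) (auto simp: gauss_dom_bounds)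
  show "gsmooth_hess F u (k + l) = gsmooth_hess F u k + gsmooth_hess F u l" for k l
    unfolding gsmooth_hess_def Bochner_Integration.integral_add[OF i i, symmetric]
    by (rule arg_cong[where f="integral\<^sup>L _"]) (auto simp: fun_eq_iff inner_add_right algebra_simps)
  show "gsmooth_hess F u (r *\<^sub>R k) = r *\<^sub>R gsmooth_hess F u k" for r k
    unfolding gsmooth_hess_def integral_scaleR_right[symmetric]
    by (rule arg_cong[where f="integral\<^sup>L _"]) (auto simp: fun_eq_iff algebra_simps)
qed

text \<open>For \<open>norm k \<le> 1\<close> the Cameron--Martin formula puts the increment into
  the weight, and expanding the weight to first order leaves a remainder quadratic in
  \<open>k\<close>. For larger \<open>k\<close> the three terms are estimated separately, each by a
  multiple of \<open>(norm k)\<^sup>2\<close>; this is the factor 3.\<close>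

lemma gsmooth_taylor:
  "\<bar>gsmooth F (u + k) - gsmooth F u - gsmooth_grad F u \<bullet> k\<bar> \<le> 3 * B * gauss_dom_int TYPE('a) * (norm k)\<^sup>2"
proof (cases "norm k \<le> 1")
  case True
  let ?E = "\<lambda>z. exp (z \<bullet> k - (norm k)\<^sup>2 / 2)"
  have "gsmooth F (u + k) = (\<E> z. ?E z *\<^sub>R F (u + z))"
    unfolding gsmooth_def using integral_std_gaussian_shift[of "\<lambda>z. F (u + z)" k] by (simp add: ac_simps)
  also have "\<dots> = (\<E> z. F (u + z) *\<^sub>R ?E z)" by (simp add: mult.commute)
  finally have 1: "gsmooth F (u + k) = (\<E> z. F (u + z) *\<^sub>R ?E z)" .
  have iz: "integrable std_gaussian (\<lambda>z. F (u + z) *\<^sub>R z)"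
    using gsmooth_dominated(1)[of "\<lambda>z. z" 1 u] by (simp add: gauss_dom_bounds)
  have i1: "integrable std_gaussian (\<lambda>z. F (u + z) *\<^sub>R (1::real))"
    using gsmooth_dominated(1)[of "\<lambda>z. 1::real" 1 u] by (simp add: gauss_dom_bounds)
  have i2: "integrable std_gaussian (\<lambda>z. F (u + z) *\<^sub>R (z \<bullet> k))"
    using integrable_inner_left[OF iz, of k] by simp
  have i3: "integrable std_gaussian (\<lambda>z. F (u + z) *\<^sub>R (?E z - 1 - z \<bullet> k))"
    by (rule gsmooth_dominated(1)[where c="(norm k)\<^sup>2"]) (use gauss_dom_bounds(4)[OF True] in auto)
  have "(\<E> z. F (u + z) *\<^sub>R ?E z) = 
      (\<E> z. F (u + z) *\<^sub>R (?E z - 1 - z \<bullet> k) + F (u + z) *\<^sub>R 1 + F (u + z) *\<^sub>R (z \<bullet> k))"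
    by (rule arg_cong[where f="integral\<^sup>L _"]) (auto simp: fun_eq_iff algebra_simps)
  also have "\<dots> = (\<E> z. F (u + z) *\<^sub>R (?E z - 1 - z \<bullet> k)) + gsmooth F u
     + (\<E> z. F (u + z) *\<^sub>R (z \<bullet> k))"
    using i1 i2 i3 by (simp add: gsmooth_def)
  also have "(\<E> z. F (u + z) *\<^sub>R (z \<bullet> k)) = gsmooth_grad F u \<bullet> k"
    unfolding gsmooth_grad_def using iz by (subst integral_inner_left[symmetric]) auto
  finally have "gsmooth F (u + k) - gsmooth F u - gsmooth_grad F u \<bullet> k
      = (\<E> z. F (u + z) *\<^sub>R (?E z - 1 - z \<bullet> k))" using 1 by simp
  then have "\<bar>gsmooth F (u + k) - gsmooth F u - gsmooth_grad F u \<bullet> k\<bar> \<le> B * (norm k)\<^sup>2 * gauss_dom_int TYPE('a)"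
    using gsmooth_dominated(2)[of "\<lambda>z. ?E z - 1 - z \<bullet> k" "(norm k)\<^sup>2" u] gauss_dom_bounds(4)[OF True] by simp
  also have "\<dots> \<le> 3 * B * gauss_dom_int TYPE('a) * (norm k)\<^sup>2"
    using B_nonneg gauss_dom_int_ge1[where 'a='a] by (simp add: mult_ac mult_left_mono)
  finally show ?thesis .
next
  case False
  let ?K = "B * gauss_dom_int TYPE('a)"
  have B: "0 \<le> B" "B \<le> ?K" using B_nonneg gauss_dom_int_ge1[where 'a='a] by (auto simp: mult_le_cancel_left1)
  have k: "norm k \<le> (norm k)\<^sup>2" "1 \<le> (norm k)\<^sup>2" using False by (auto simp: power2_eq_square mult_le_cancel_left1 intro: mult_ge1_I)
  have "\<bar>gsmooth_grad F u \<bullet> k\<bar> \<le> ?K * norm k"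
    by (rule order_trans[OF Cauchy_Schwarz_ineq2]) (simp add: mult_right_mono gsmooth_bounds)
  then have "\<bar>gsmooth F (u + k) - gsmooth F u - gsmooth_grad F u \<bullet> k\<bar> \<le> ?K * 1 + ?K * 1 + ?K * norm k"
    using gsmooth_bounds(1)[of "u + k"] gsmooth_bounds(1)[of u] B by linarith
  also have "\<dots> \<le> ?K * (norm k)\<^sup>2 + ?K * (norm k)\<^sup>2 + ?K * (norm k)\<^sup>2"
    using B k by (intro add_mono mult_left_mono) auto
  finally show ?thesis by simp
qed

text \<open>The case split of \<open>gsmooth_taylor\<close> again. The shift also turns the factor
  \<open>z\<close> into \<open>z - k\<close>, which is where the \<open>- k\<close> in
  \<open>gsmooth_hess\<close> comes from.\<close>

lemma gsmooth_grad_taylor: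
  "norm (gsmooth_grad F (u + k) - gsmooth_grad F u - gsmooth_hess F u k) \<le> 3 * B * gauss_dom_int TYPE('a) * (norm k)\<^sup>2"
proof (cases "norm k \<le> 1")
  case True
  let ?E = "\<lambda>z. exp (z \<bullet> k - (norm k)\<^sup>2 / 2)"
  have "gsmooth_grad F (u + k) = (\<E> z. ?E z *\<^sub>R (F (u + z) *\<^sub>R (z - k)))"
    unfolding gsmooth_grad_def using integral_std_gaussian_shift[of "\<lambda>z. F (u + z) *\<^sub>R (z - k)" k] by (simp add: ac_simps)
  also have "\<dots> = (\<E> z. F (u + z) *\<^sub>R (?E z *\<^sub>R (z - k)))" by (simp add: mult.commute)
  finally have 1: "gsmooth_grad F (u + k) = (\<E> z. F (u + z) *\<^sub>R (?E z *\<^sub>R (z - k)))" .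
  let ?R = "\<lambda>z. ?E z *\<^sub>R (z - k) - z - ((z \<bullet> k) *\<^sub>R z - k)"
  have iz: "integrable std_gaussian (\<lambda>z. F (u + z) *\<^sub>R z)"
    using gsmooth_dominated(1)[of "\<lambda>z. z" 1 u] by (simp add: gauss_dom_bounds)
  have i2: "integrable std_gaussian (\<lambda>z. F (u + z) *\<^sub>R ((z \<bullet> k) *\<^sub>R z - k))"
    by (rule gsmooth_dominated(1)[where c="norm k"]) (auto simp: gauss_dom_bounds)
  have i3: "integrable std_gaussian (\<lambda>z. F (u + z) *\<^sub>R ?R z)"
    by (rule gsmooth_dominated(1)[where c="(norm k)\<^sup>2"]) (use gauss_dom_bounds(5)[OF True] in auto)
  have "(\<E> z. F (u + z) *\<^sub>R (?E z *\<^sub>R (z - k))) = 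
      (\<E> z. F (u + z) *\<^sub>R ?R z + F (u + z) *\<^sub>R z + F (u + z) *\<^sub>R ((z \<bullet> k) *\<^sub>R z - k))"
    by (rule arg_cong[where f="integral\<^sup>L _"]) (auto simp: fun_eq_iff scaleR_right_diff_distrib)
  also have "\<dots> = (\<E> z. F (u + z) *\<^sub>R ?R z) + gsmooth_grad F u + gsmooth_hess F u k"
    using iz i2 i3 by (simp add: gsmooth_grad_def gsmooth_hess_def)
  finally have "gsmooth_grad F (u + k) - gsmooth_grad F u - gsmooth_hess F u k
      = (\<E> z. F (u + z) *\<^sub>R ?R z)" using 1 by simp
  then have "norm (gsmooth_grad F (u + k) - gsmooth_grad F u - gsmooth_hess F u k) \<le> B * (norm k)\<^sup>2 * gauss_dom_int TYPE('a)"
    using gsmooth_dominated(2)[of ?R "(norm k)\<^sup>2" u] gauss_dom_bounds(5)[OF True] by simp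
  also have "\<dots> \<le> 3 * B * gauss_dom_int TYPE('a) * (norm k)\<^sup>2"
    using B_nonneg gauss_dom_int_ge1[where 'a='a] by (simp add: mult_ac mult_left_mono)
  finally show ?thesis .
next
  case False
  let ?K = "B * gauss_dom_int TYPE('a)"
  have B: "0 \<le> ?K" using B_nonneg gauss_dom_int_ge1[where 'a='a] by simp
  have k: "norm k \<le> (norm k)\<^sup>2" "1 \<le> (norm k)\<^sup>2" using False by (auto simp: power2_eq_square mult_le_cancel_left1 intro: mult_ge1_I)
  have "norm (gsmooth_grad F (u + k) - gsmooth_grad F u - gsmooth_hess F u k) \<le> ?K * 1 + ?K * 1 + ?K * norm k"
    using gsmooth_bounds(2)[of "u + k"] gsmooth_bounds(2)[of u] gsmooth_bounds(3)[of u k] 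
      norm_triangle_ineq4[of "gsmooth_grad F (u + k) - gsmooth_grad F u" "gsmooth_hess F u k"]
      norm_triangle_ineq4[of "gsmooth_grad F (u + k)" "gsmooth_grad F u"] by linarith
  also have "\<dots> \<le> ?K * (norm k)\<^sup>2 + ?K * (norm k)\<^sup>2 + ?K * (norm k)\<^sup>2"
    using B k by (intro add_mono mult_left_mono) auto
  finally show ?thesis by simp
qed

lemma gsmooth_measurable: "gsmooth F \<in> borel_measurable borel"
  unfolding gsmooth_def[abs_def] by (rule std_gaussian.borel_measurable_lebesgue_integral) measurable

lemma gsmooth_grad_measurable: "gsmooth_grad F \<in> borel_measurable borel"
  unfolding gsmooth_grad_def[abs_def] by (rule std_gaussian.borel_measurable_lebesgue_integral) measurable

lemma gsmooth_hess_measurable: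
  assumes [measurable]: "w \<in> borel_measurable borel"  "w' \<in> borel_measurable borel"
  shows "(\<lambda>x. gsmooth_hess F (w' x) (w x)) \<in> borel_measurable borel"
  unfolding gsmooth_hess_def[abs_def] by (rule std_gaussian.borel_measurable_lebesgue_integral) measurable

end

section \<open>First and second moments of the Gaussian\<close>

lemma nonpos_if_le_mult_pos:
  fixes a C :: real
  assumes "\<And>s. 0 < s \<Longrightarrow> a \<le> C * s"
  shows "a \<le> 0"
proof (rule field_le_epsilon)
  fix e :: real assume e: "0 < e"
  have "a \<le> C * (e / (\<bar>C\<bar> + 1))" using e by (intro assms) auto
  also have "\<dots> \<le> (\<bar>C\<bar> + 1) * (e / (\<bar>C\<bar> + 1))" using e by (intro mult_right_mono) auto
  finally show "a \<le> 0 + e" by simp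
qed

text \<open>Both moments come from the Taylor expansions above for the constant function \<open>1\<close>, whose average does
  not depend on the base point.\<close>

lemma std_gaussian_mean: "(\<E> z. z) = (0 :: 'a::euclidean_space)"
proof -
  let ?F = "\<lambda>_::'a. 1::real"
  let ?g = "gsmooth_grad ?F 0"
  have *: "\<bar>?g \<bullet> (s *\<^sub>R ?g)\<bar> \<le> 3 * 1 * gauss_dom_int TYPE('a) * (norm (s *\<^sub>R ?g))\<^sup>2" for s
    using gsmooth_taylor[of ?F 1 0 "s *\<^sub>R ?g"] by (simp add: gsmooth_def)
  then have "s * (?g \<bullet> ?g) \<le> s * ((3 * gauss_dom_int TYPE('a) * (norm ?g)\<^sup>2) * s)" if "s > 0" for s
    using *[of s] that by (simp add: power_mult_distrib power2_eq_square abs_mult mult_ac)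
  then have "?g \<bullet> ?g \<le> (3 * gauss_dom_int TYPE('a) * (norm ?g)\<^sup>2) * s" if "s > 0" for s
    using that by (meson mult_le_cancel_left_pos)
  then have "?g \<bullet> ?g \<le> 0" by (rule nonpos_if_le_mult_pos)
  then have "?g = 0" by (metis inner_ge_zero inner_eq_zero_iff order_antisym)
  then show ?thesis by (simp add: gsmooth_grad_def)
qed

lemma std_gaussian_second_moment:
  "(\<E> z. (z \<bullet> k) * (z \<bullet> l)) = k \<bullet> l" for k l :: "'a::euclidean_space"
proof -
  let ?F = "\<lambda>_::'a. 1::real"
  let ?H = "gsmooth_hess ?F 0"
  interpret H: linear ?H by (rule linear_gsmooth_hess[where B=1]) auto
  have *: "norm (?H (s *\<^sub>R k)) \<le> 3 * 1 * gauss_dom_int TYPE('a) * (norm (s *\<^sub>R k))\<^sup>2" for s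
    using gsmooth_grad_taylor[of ?F 1 0 "s *\<^sub>R k"] by (simp add: gsmooth_grad_def)
  then have "s * norm (?H k) \<le> s * ((3 * gauss_dom_int TYPE('a) * (norm k)\<^sup>2) * s)" if "s > 0" for s
    using *[of s] that by (simp add: H.scaleR power_mult_distrib power2_eq_square abs_mult mult_ac)
  then have "norm (?H k) \<le> (3 * gauss_dom_int TYPE('a) * (norm k)\<^sup>2) * s" if "s > 0" for s
    using that by (meson mult_le_cancel_left_pos)
  then have "norm (?H k) \<le> 0" by (rule nonpos_if_le_mult_pos)
  then have "0 = ?H k \<bullet> l" by simp
  also have "\<dots> = (\<E> z. (z \<bullet> k) * (z \<bullet> l) - k \<bullet> l)"
    by (subst gsmooth_hess_inner[where B=1]) auto
  also have "\<dots> = (\<E> z. (z \<bullet> k) * (z \<bullet> l)) - k \<bullet> l"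
  proof -
    have "integrable std_gaussian (\<lambda>z. (z \<bullet> k) * (z \<bullet> l))"
    proof (rule integral_dominated_gauss(1))
      fix z :: 'a
      have "\<bar>(z \<bullet> k) * (z \<bullet> l)\<bar> \<le> (norm z * norm k) * (norm z * norm l)"
        unfolding abs_mult by (intro mult_mono Cauchy_Schwarz_ineq2) auto
      also have "\<dots> = (norm k * norm l) * (norm z)^2" by (simp add: power2_eq_square)
      also have "\<dots> \<le> (norm k * norm l) * gauss_dom z" by (intro mult_left_mono gauss_dom_bounds) auto
      finally show "norm ((z \<bullet> k) * (z \<bullet> l)) \<le> (norm k * norm l) * gauss_dom z" by simp
    qed simp
    then show ?thesis by simp
  qed
  finally show ?thesis by simp
qed

section \<open>The Ornstein--Uhlenbeck semigroup over a short time\<close>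

text \<open>Bounded gradient and quadratic Taylor remainder, with explicit constants: these have to
  be followed through many Euler steps and to be uniform in time. The function \<open>g\<close>
  plays the role of the gradient.\<close>

definition has_quadratic_remainder ::
  "('a::euclidean_space \<Rightarrow> real) \<Rightarrow> ('a \<Rightarrow> 'a) \<Rightarrow> real \<Rightarrow> real \<Rightarrow> bool" where
  "has_quadratic_remainder \<phi> g L M \<longleftrightarrow>
     \<phi> \<in> borel_measurable borel \<and> g \<in> borel_measurable borel \<and> 0 \<le> L \<and> 0 \<le> M \<and>
     (\<forall>x. norm (g x) \<le> L) \<and> (\<forall>x y. \<bar>\<phi> y - \<phi> x\<bar> \<le> L * norm (y - x)) \<and>
     (\<forall>x y. \<bar>\<phi> y - \<phi> x - g x \<bullet> (y - x)\<bar> \<le> M * (norm (y - x))\<^sup>2)"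

lemma has_quadratic_remainderD:
  assumes "has_quadratic_remainder \<phi> g L M"
  shows "\<phi> \<in> borel_measurable borel" "g \<in> borel_measurable borel" "0 \<le> L" "0 \<le> M"
    "norm (g x) \<le> L" "\<bar>\<phi> y - \<phi> x\<bar> \<le> L * norm (y - x)"
    "\<bar>\<phi> y - \<phi> x - g x \<bullet> (y - x)\<bar> \<le> M * (norm (y - x))\<^sup>2"
  using assms by (auto simp: has_quadratic_remainder_def)

text \<open>Since \<open>a\<^sup>2 \<le> a\<close>, the drift \<open>1 - a\<close> is at most
  \<open>b\<^sup>2\<close>, hence at most \<open>b\<close>: displacement is governed by the noise
  scale.\<close>

lemma norm_affine_diff_le:
  fixes x z :: "'a::real_normed_vector"
  assumes "0 \<le> a" "a \<le> 1" "0 \<le> b" "a\<^sup>2 + b\<^sup>2 = 1"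
  shows "norm (a *\<^sub>R x + b *\<^sub>R z - x) \<le> b * (norm x + norm z)" "1 - a \<le> b\<^sup>2" "b \<le> 1" "1 - a \<le> b"
proof -
  have a2: "a\<^sup>2 \<le> a" using assms by (simp add: power2_eq_square mult_left_le_one_le)
  then show "1 - a \<le> b\<^sup>2" using assms by simp
  have "b\<^sup>2 \<le> 1\<^sup>2" using assms by simp (metis assms(4) le_add_same_cancel2 zero_le_power2)
  then show b1: "b \<le> 1" by (rule power2_le_imp_le) simp
  have "b\<^sup>2 \<le> b" using b1 assms by (simp add: power2_eq_square mult_left_le_one_le)
  then show ab: "1 - a \<le> b" using a2 assms by simp
  have "a *\<^sub>R x + b *\<^sub>R z - x = b *\<^sub>R z - (1 - a) *\<^sub>R x" by (simp add: algebra_simps)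
  then have "norm (a *\<^sub>R x + b *\<^sub>R z - x) \<le> b * norm z + (1 - a) * norm x"
    using norm_triangle_ineq4[of "b *\<^sub>R z" "(1 - a) *\<^sub>R x"] assms by (simp only: norm_scaleR)
  also have "\<dots> \<le> b * norm z + b * norm x" using ab by (intro add_left_mono mult_right_mono) auto
  finally show "norm (a *\<^sub>R x + b *\<^sub>R z - x) \<le> b * (norm x + norm z)" by (simp add: algebra_simps)
qed

lemma abs_mult_le_of_le_one: "\<bar>r\<bar> \<le> 1 \<Longrightarrow> \<bar>s\<bar> \<le> S \<Longrightarrow> \<bar>r * s\<bar> \<le> S" for r s S :: real
  using mult_mono[of "\<bar>r\<bar>" 1 "\<bar>s\<bar>" S] by (simp add: abs_mult)

lemma cube_add_le: "(s + t)^3 \<le> 4 * (s^3 + t^3)" if "0 \<le> s" "0 \<le> t" for s t :: real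
proof -
  have "0 \<le> 3 * (s + t) * (s - t)\<^sup>2" using that by simp
  also have "\<dots> = 4 * (s^3 + t^3) - (s + t)^3" by (simp add: algebra_simps power2_eq_square power3_eq_cube)
  finally show ?thesis by simp
qed

lemma abs_integral_bound_gauss:
  fixes h :: "'a::euclidean_space \<Rightarrow> real"
  assumes [measurable]: "h \<in> borel_measurable borel" and h: "\<And>z. \<bar>h z\<bar> \<le> c * gauss_dom z + d"
  shows "integrable std_gaussian h" "\<bar>\<E> z. h z\<bar> \<le> c * gauss_dom_int TYPE('a) + d"
proof -
  have i: "integrable std_gaussian (\<lambda>z::'a. c * gauss_dom z + d)"
    by (intro Bochner_Integration.integrable_add integrable_mult_right integrable_gauss_dom) simp
  show i2: "integrable std_gaussian h"
    by (rule Bochner_Integration.integrable_bound[OF i]) (use h in \<open>auto intro: order_trans[OF _ abs_ge_self]\<close>)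
  have "\<bar>\<E> z. h z\<bar> \<le> (\<E> z. \<bar>h z\<bar>)" by (rule integral_abs_bound)
  also have "\<dots> \<le> integral\<^sup>L std_gaussian (\<lambda>z::'a. c * gauss_dom z + d)"
    using i i2 h by (intro integral_mono) auto
  also have "\<dots> = c * gauss_dom_int TYPE('a) + d"
    by (simp add: gauss_dom_int_def integrable_gauss_dom)
  finally show "\<bar>\<E> z. h z\<bar> \<le> c * gauss_dom_int TYPE('a) + d" .
qed

lemma measurable_integral_affine:
  fixes f :: "'a::euclidean_space \<Rightarrow> 'a \<Rightarrow> real"
  assumes "(\<lambda>p. f (fst p) (snd p)) \<in> borel_measurable (borel \<Otimes>\<^sub>M borel)"
  shows "(\<lambda>x. \<E> z. f x z) \<in> borel_measurable borel"
  by (rule std_gaussian.borel_measurable_lebesgue_integral)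
    (use assms in \<open>simp add: split_beta' cong: measurable_cong_sets sets_pair_measure_cong\<close>)

lemma integrable_iterated_bounded:
  fixes f :: "'a::euclidean_space \<Rightarrow> 'a \<Rightarrow> real"
  assumes m [measurable]: "(\<lambda>p. f (fst p) (snd p)) \<in> borel_measurable (borel \<Otimes>\<^sub>M borel)"
    and bd: "\<And>x z. \<bar>f x z\<bar> \<le> S"
  shows "integrable std_gaussian (f x)" "\<bar>\<E> z. f x z\<bar> \<le> S"
    "integrable std_gaussian (\<lambda>x. \<E> z. f x z)"
proof -
  have fm: "f x \<in> borel_measurable borel" for x
    using measurable_compose[OF measurable_Pair1'[of x borel borel] m] by simp
  show "integrable std_gaussian (f x)"
    by (rule abs_integral_bound_gauss(1)[where c=0 and d=S]) (use bd fm in auto)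
  have b: "\<bar>\<E> z. f x z\<bar> \<le> S" for x
    using abs_integral_bound_gauss(2)[of "f x" 0 S] bd fm by simp
  then show "\<bar>\<E> z. f x z\<bar> \<le> S" .
  show "integrable std_gaussian (\<lambda>x. \<E> z. f x z)"
    by (rule abs_integral_bound_gauss(1)[where c=0 and d=S]) (use b measurable_integral_affine[OF m] in auto)
qed

text \<open>Mehler's formula.\<close>

definition ou_op :: "real \<Rightarrow> ('a::euclidean_space \<Rightarrow> real) \<Rightarrow> 'a \<Rightarrow> real" where
  "ou_op t q x = (\<E> z. q (exp (- t) *\<^sub>R x + sqrt (1 - exp (- 2 * t)) *\<^sub>R z))"

lemma ou_op_measurable [measurable]:
  assumes [measurable]: "q \<in> borel_measurable borel"
  shows "ou_op t q \<in> borel_measurable borel"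
  unfolding ou_op_def[abs_def] by (rule measurable_integral_affine) measurable

lemma ou_op_bounds:
  fixes q :: "'a::euclidean_space \<Rightarrow> real"
  assumes [measurable]: "q \<in> borel_measurable borel" and q: "\<And>x. m \<le> q x" "\<And>x. q x \<le> B"
  shows "m \<le> ou_op t q x" "ou_op t q x \<le> B"
proof -
  have "\<bar>q w\<bar> \<le> \<bar>m\<bar> + \<bar>B\<bar>" for w using q(1)[of w] q(2)[of w] by arith
  then have i: "integrable std_gaussian (\<lambda>z. q (exp (- t) *\<^sub>R x + sqrt (1 - exp (- 2 * t)) *\<^sub>R z))"
    by (intro std_gaussian.integrable_const_bound[where B="\<bar>m\<bar> + \<bar>B\<bar>"]) auto
  have "integral\<^sup>L (std_gaussian :: 'a measure) (\<lambda>_. m) \<le> ou_op t q x"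
    unfolding ou_op_def using i q by (intro integral_mono) auto
  then show "m \<le> ou_op t q x" by simp
  have "ou_op t q x \<le> integral\<^sup>L (std_gaussian :: 'a measure) (\<lambda>_. B)"
    unfolding ou_op_def using i q by (intro integral_mono) auto
  then show "ou_op t q x \<le> B" by simp
qed

lemma ou_coefficients:
  fixes t :: real
  assumes "0 < t"
  shows "0 \<le> exp (- t)" "exp (- t) \<le> 1" "0 < sqrt (1 - exp (- 2 * t))" "sqrt (1 - exp (- 2 * t)) \<le> 1"
    "(exp (- t))\<^sup>2 + (sqrt (1 - exp (- 2 * t)))\<^sup>2 = 1"
  using assms by (auto simp: exp_double[symmetric])

text \<open>Symmetrised by reversibility, the left side is an average of a product of two
  increments. First-order expansion of each factor then suffices: the error is cubic in the
  displacement, thus of order \<open>b ^ 3\<close>, and the leading term is \<open>b\<^sup>2\<close>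
  times the Dirichlet form.\<close>

lemma dirichlet_form_approx:
  fixes \<phi> q :: "'a::euclidean_space \<Rightarrow> real"
  assumes \<phi>: "has_quadratic_remainder \<phi> g L M" and q: "has_quadratic_remainder q G L' M'"
    and bd: "\<And>x. \<bar>\<phi> x\<bar> \<le> 1" "\<And>x. \<bar>q x\<bar> \<le> B"
    and h: "0 < h"
  defines "b \<equiv> sqrt (1 - exp (- 2 * h))"
  shows "\<bar>2 * ((\<E> x. \<phi> x * q x) - (\<E> x. \<phi> x * ou_op h q x))
      - b\<^sup>2 * (\<E> x. g x \<bullet> G x)\<bar>
    \<le> b^3 * gauss_dom_int TYPE('a) * (8 * (L * M' + M * L') + L * L')"
proof -
  define a where "a = exp (- h)"
  let ?K = "gauss_dom_int TYPE('a)"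
  note [measurable] = has_quadratic_remainderD(1,2)[OF \<phi>] has_quadratic_remainderD(1,2)[OF q]
  have L: "0 \<le> L" "0 \<le> M" "0 \<le> L'" "0 \<le> M'"
    using has_quadratic_remainderD(3,4)[OF \<phi>] has_quadratic_remainderD(3,4)[OF q] by auto
  note a = ou_coefficients(1,2)[OF h, folded a_def] and b = ou_coefficients(3,5)[OF h, folded a_def b_def]
  note ab_facts = norm_affine_diff_le[OF a less_imp_le[OF b(1)] b(2)]
  define y where "y x z = a *\<^sub>R x + b *\<^sub>R z" for x z :: 'a
  have [measurable]: "(\<lambda>p. y (fst p) (snd p)) \<in> borel \<Otimes>\<^sub>M borel \<rightarrow>\<^sub>M borel" "\<And>x. y x \<in> borel \<rightarrow>\<^sub>M borel"
    unfolding y_def[abs_def] by measurable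
  have yd: "norm (y x z - x) \<le> b * (norm x + norm z)" for x z
    unfolding y_def by (rule ab_facts(1))
  have ou: "ou_op h q x = (\<E> z. q (y x z))" for x
    by (simp add: ou_op_def y_def a_def b_def)
  have qq: "\<bar>q x - q y\<bar> \<le> 2 * B" for x y using bd(2)[of x] bd(2)[of y] by linarith
  have pq: "\<bar>\<phi> x * q y\<bar> \<le> B" "\<bar>\<phi> x * (q w - q y)\<bar> \<le> 2 * B" for x y w by (intro abs_mult_le_of_le_one bd qq)+
  have iq: "integrable std_gaussian (\<lambda>z. q (y x z))" for x
    by (rule abs_integral_bound_gauss[where c=0 and d=B]) (use bd in auto)
  have oub: "\<bar>ou_op h q x\<bar> \<le> B" for x
    unfolding ou using abs_integral_bound_gauss(2)[of "\<lambda>z. q (y x z)" 0 B] bd by simp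
  define D where "D = (\<E> x. \<phi> x * q x) - (\<E> x. \<phi> x * ou_op h q x)"
  have D1: "D = (\<E> x. \<E> z. \<phi> x * (q x - q (y x z)))"
  proof -
    have "integrable std_gaussian (\<lambda>x. \<phi> x * q x)" "integrable std_gaussian (\<lambda>x. \<phi> x * ou_op h q x)"
      by (rule abs_integral_bound_gauss[where c=0 and d=B]; use pq abs_mult_le_of_le_one[OF bd(1) oub] in simp)+
    then have "D = (\<E> x. \<phi> x * q x - \<phi> x * ou_op h q x)" by (simp add: D_def)
    also have "\<dots> = (\<E> x. \<E> z. \<phi> x * (q x - q (y x z)))"
      using iq by (intro Bochner_Integration.integral_cong) (auto simp: ou right_diff_distrib)
    finally show ?thesis .
  qed
  \<comment> \<open>The same quantity with \<open>x\<close> and \<open>y x z\<close> interchanged.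
    The sum of \<open>D1\<close> and \<open>D2\<close> is the average of the product of
    increments.\<close>
  have D2: "D = (\<E> x. \<E> z. \<phi> (y x z) * (q (y x z) - q x))"
    using integral_ou_exchange[of "\<lambda>p. \<phi> (fst p) * (q (fst p) - q (snd p))" "2 * B" b a] b pq(2) 
    by (simp add: D1 y_def)
  define S where "S x = (\<E> z. (\<phi> (y x z) - \<phi> x) * (q (y x z) - q x))" for x
  have twoD: "2 * D = (\<E> x. S x)"
  proof -
    have i1: "integrable std_gaussian (\<lambda>z. \<phi> x * (q x - q (y x z)))" 
      "integrable std_gaussian (\<lambda>z. \<phi> (y x z) * (q (y x z) - q x))" for x
      by (rule abs_integral_bound_gauss[where c=0 and d="2 * B"]; use pq in simp)+
    have i2: "integrable std_gaussian (\<lambda>x. \<E> z. \<phi> x * (q x - q (y x z)))" 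
      "integrable std_gaussian (\<lambda>x. \<E> z. \<phi> (y x z) * (q (y x z) - q x))" 
      by (rule integrable_iterated_bounded(3)[where S="2 * B"], measurable, rule pq)+
    have "2 * D = (\<E> x. (\<E> z. \<phi> x * (q x - q (y x z))) + (\<E> z. \<phi> (y x z) * (q (y x z) - q x)))"
      using i2 D1 D2 by simp
    also have "\<dots> = (\<E> x. S x)"
      unfolding S_def using i1 
      by (intro Bochner_Integration.integral_cong refl, subst Bochner_Integration.integral_add[symmetric]) (auto simp: algebra_simps)
    finally show ?thesis .
  qed
  \<comment> \<open>The leading part of \<open>S\<close>, with both increments replaced by their
    linear parts.\<close>
  define J where "J x = (\<E> z. (g x \<bullet> (y x z - x)) * (G x \<bullet> (y x z - x)))" for x
  let ?R = "L * M' + M * L'"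
  have z3: "norm (y x z - x)^3 \<le> b^3 * (4 * (gauss_dom x + gauss_dom z))" for x z
  proof -
    have "norm (y x z - x)^3 \<le> (b * (norm x + norm z))^3" by (intro power_mono yd) auto
    also have "\<dots> \<le> b^3 * (4 * ((norm x)^3 + (norm z)^3))"
      unfolding power_mult_distrib using b by (intro mult_left_mono cube_add_le) auto
    also have "\<dots> \<le> b^3 * (4 * (gauss_dom x + gauss_dom z))"
      using b by (intro mult_left_mono add_mono gauss_dom_bounds) auto
    finally show ?thesis .
  qed
  have dq: "\<bar>(\<phi> y' - \<phi> x) * (q y' - q x) - (g x \<bullet> (y' - x)) * (G x \<bullet> (y' - x))\<bar> \<le> ?R * norm (y' - x)^3" for x y'
  proof -
    define n where "n = norm (y' - x)"
    have "(\<phi> y' - \<phi> x) * (q y' - q x) - (g x \<bullet> (y' - x)) * (G x \<bullet> (y' - x))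
      = (\<phi> y' - \<phi> x) * (q y' - q x - G x \<bullet> (y' - x)) + (\<phi> y' - \<phi> x - g x \<bullet> (y' - x)) * (G x \<bullet> (y' - x))"
      by (simp add: algebra_simps)
    also have "\<bar>\<dots>\<bar> \<le> \<bar>(\<phi> y' - \<phi> x) * (q y' - q x - G x \<bullet> (y' - x))\<bar> + \<bar>(\<phi> y' - \<phi> x - g x \<bullet> (y' - x)) * (G x \<bullet> (y' - x))\<bar>"
      by (rule abs_triangle_ineq)
    also have "\<dots> \<le> (L * n) * (M' * n\<^sup>2) + (M * n\<^sup>2) * (L' * n)"
      unfolding abs_mult n_def using L has_quadratic_remainderD(5-7)[OF \<phi>] has_quadratic_remainderD(5-7)[OF q]
      by (intro add_mono mult_mono order_trans[OF Cauchy_Schwarz_ineq2]) (auto intro: mult_right_mono)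
    also have "\<dots> = ?R * n^3" by (simp add: algebra_simps power2_eq_square power3_eq_cube)
    finally show ?thesis by (simp add: n_def)
  qed
  have prod_bd: "\<bar>(g x \<bullet> u) * (G x \<bullet> w)\<bar> \<le> (L * L') * (norm u * norm w)" for x u w
  proof -
    have "\<bar>(g x \<bullet> u) * (G x \<bullet> w)\<bar> \<le> (L * norm u) * (L' * norm w)"
      unfolding abs_mult using L has_quadratic_remainderD(5)[OF \<phi>] has_quadratic_remainderD(5)[OF q]
      by (intro mult_mono order_trans[OF Cauchy_Schwarz_ineq2]) (auto intro: mult_right_mono)
    then show ?thesis by (simp add: mult_ac)
  qed
  have n2: "norm (y x z - x) * norm (y x z - x) \<le> 2 * gauss_dom x + 2 * gauss_dom z" for x z
  proof -
    have b1: "b \<le> 1" by (rule ab_facts(3))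
    have "norm (y x z - x) \<le> norm x + norm z" using yd[of x z] b b1
      by (meson add_nonneg_nonneg mult_left_le_one_le norm_ge_zero order_less_imp_le order_trans)
    then have "norm (y x z - x) * norm (y x z - x) \<le> (norm x + norm z) * (norm x + norm z)" by (intro mult_mono) auto
    also have "\<dots> \<le> 2 * (norm x)\<^sup>2 + 2 * (norm z)\<^sup>2"
      using zero_le_power2[of "norm x - norm z"] by (simp add: power2_eq_square algebra_simps)
    also have "\<dots> \<le> 2 * gauss_dom x + 2 * gauss_dom z" by (intro add_mono mult_left_mono gauss_dom_bounds) auto
    finally show ?thesis .
  qed
  have SJ: "\<bar>S x - J x\<bar> \<le> ?R * b^3 * 4 * (gauss_dom x + ?K)" for x
  proof -
    have iS: "integrable std_gaussian (\<lambda>z. (\<phi> (y x z) - \<phi> x) * (q (y x z) - q x))"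
    proof (rule abs_integral_bound_gauss[where c=0 and d="4 * B"])
      show "\<bar>(\<phi> (y x z) - \<phi> x) * (q (y x z) - q x)\<bar> \<le> 0 * gauss_dom z + 4 * B" for z
        using pq(2)[of "y x z" "y x z" x] pq(2)[of x "y x z" x] by (simp add: left_diff_distrib abs_le_iff)
    qed simp
    have iJ: "integrable std_gaussian (\<lambda>z. (g x \<bullet> (y x z - x)) * (G x \<bullet> (y x z - x)))"
    proof (rule abs_integral_bound_gauss[where c="L * L' * 2" and d="L * L' * (2 * gauss_dom x)"])
      show "\<bar>(g x \<bullet> (y x z - x)) * (G x \<bullet> (y x z - x))\<bar> \<le> (L * L' * 2) * gauss_dom z + L * L' * (2 * gauss_dom x)" for z
        using prod_bd[of x "y x z - x" "y x z - x"] mult_left_mono[OF n2[of x z], of "L * L'"] L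
        by (simp add: algebra_simps)
    qed simp
    have "S x - J x = (\<E> z. (\<phi> (y x z) - \<phi> x) * (q (y x z) - q x) - (g x \<bullet> (y x z - x)) * (G x \<bullet> (y x z - x)))"
      unfolding S_def J_def using iS iJ by simp
    also have "\<bar>\<dots>\<bar> \<le> (?R * b^3 * 4) * ?K + ?R * b^3 * 4 * gauss_dom x"
    proof (rule abs_integral_bound_gauss)
      fix z
      show "\<bar>(\<phi> (y x z) - \<phi> x) * (q (y x z) - q x) - (g x \<bullet> (y x z - x)) * (G x \<bullet> (y x z - x))\<bar>
        \<le> (?R * b^3 * 4) * gauss_dom z + ?R * b^3 * 4 * gauss_dom x"
        using dq[of "y x z" x] mult_left_mono[OF z3[of x z], of ?R] L by (simp add: algebra_simps)
    qed simp
    finally show ?thesis by (simp add: algebra_simps)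
  qed
  \<comment> \<open>The displacement is \<open>b *\<^sub>R z - (1 - a) *\<^sub>R x\<close>. Mixed
    terms are linear in \<open>z\<close> and have mean zero; the term quadratic in \<open>z\<close>
    is evaluated by the second moment.\<close>
  have Jx: "J x = (1 - a)\<^sup>2 * ((g x \<bullet> x) * (G x \<bullet> x)) + b\<^sup>2 * (g x \<bullet> G x)" for x
  proof -
    have il: "integrable std_gaussian (\<lambda>z. z \<bullet> w)" for w :: 'a
      by (rule integral_dominated_gauss(1)[where c="norm w"])
        (auto simp: mult.commute[of "norm w"] intro!: order_trans[OF Cauchy_Schwarz_ineq2] mult_right_mono gauss_dom_bounds)
    have il0: "(\<E> z. z \<bullet> w) = 0" for w :: 'a
    proof -
      have "integrable std_gaussian (\<lambda>z::'a. z)"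
        by (rule integral_dominated_gauss(1)[where c=1]) (simp_all add: gauss_dom_bounds)
      then have "(\<E> z. z \<bullet> w) = (\<E> z. z) \<bullet> w"
        by (intro integral_inner_left)
      then show ?thesis by (simp only: std_gaussian_mean inner_zero_left)
    qed
    have iq: "integrable std_gaussian (\<lambda>z. (z \<bullet> g x) * (z \<bullet> G x))"
    proof (rule integral_dominated_gauss(1)[where c="L * L'"])
      show "norm ((z \<bullet> g x) * (z \<bullet> G x)) \<le> (L * L') * gauss_dom z" for z
        using prod_bd[of x z z] mult_left_mono[OF gauss_dom_bounds(6)[of z], of "L * L'"] L
        by (simp add: inner_commute power2_eq_square)
    qed simp
    have "J x = (\<E> z. (1 - a)\<^sup>2 * ((g x \<bullet> x) * (G x \<bullet> x)) + z \<bullet> ((- (1 - a) * b * (g x \<bullet> x)) *\<^sub>R G x)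
        + z \<bullet> ((- (1 - a) * b * (G x \<bullet> x)) *\<^sub>R g x) + b\<^sup>2 * ((z \<bullet> g x) * (z \<bullet> G x)))"
      unfolding J_def y_def by (intro Bochner_Integration.integral_cong refl)
        (simp add: inner_add_right inner_diff_right inner_commute power2_eq_square algebra_simps)
    also have "\<dots> = (1 - a)\<^sup>2 * ((g x \<bullet> x) * (G x \<bullet> x)) + b\<^sup>2 * (g x \<bullet> G x)"
    proof -
      have iq': "integrable std_gaussian (\<lambda>z. b\<^sup>2 * ((z \<bullet> g x) * (z \<bullet> G x)))" using iq by (rule integrable_mult_right)
      have "(\<E> z. b\<^sup>2 * ((z \<bullet> g x) * (z \<bullet> G x))) = b\<^sup>2 * (g x \<bullet> G x)"
        by (simp only: integral_mult_right_zero std_gaussian_second_moment)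
      then show ?thesis
        by (simp only: Bochner_Integration.integral_add il iq' Bochner_Integration.integrable_add std_gaussian.integrable_const il0)
          simp
    qed
    finally show ?thesis .
  qed
  have Sb: "\<bar>S x - b\<^sup>2 * (g x \<bullet> G x)\<bar> \<le> (b^3 * (4 * ?R + L * L')) * gauss_dom x + b^3 * 4 * ?R * ?K" for x
  proof -
    \<comment> \<open>The drift enters squared and is therefore only of order
      \<open>b ^ 4\<close>.\<close>
    have "(1 - a)\<^sup>2 \<le> (b\<^sup>2)\<^sup>2" using ab_facts(2) a by (intro power_mono) auto
    also have "\<dots> \<le> b^3" using ab_facts(3) b(1) 
      by (simp add: power_mult[symmetric]) (intro power_decreasing; simp)
    finally have "(1 - a)\<^sup>2 * \<bar>(g x \<bullet> x) * (G x \<bullet> x)\<bar> \<le> b^3 * (L * L' * gauss_dom x)"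
      using prod_bd[of x x x] mult_left_mono[OF gauss_dom_bounds(6)[of x], of "L * L'"] L b
      by (intro mult_mono) (auto simp: power2_eq_square)
    then have "\<bar>J x - b\<^sup>2 * (g x \<bullet> G x)\<bar> \<le> b^3 * (L * L' * gauss_dom x)"
      by (simp add: Jx abs_mult)
    then have "\<bar>S x - b\<^sup>2 * (g x \<bullet> G x)\<bar> \<le> b^3 * (L * L' * gauss_dom x) + ?R * b^3 * 4 * (gauss_dom x + ?K)"
      using SJ[of x] by linarith
    then show ?thesis by (simp add: algebra_simps)
  qed
  have [measurable]: "S \<in> borel_measurable borel"
    unfolding S_def[abs_def] by (rule measurable_integral_affine) measurable
  have iS: "integrable std_gaussian S"
  proof (rule abs_integral_bound_gauss[where c=0 and d="4 * B"])
    have "\<bar>(\<phi> (y x z) - \<phi> x) * (q (y x z) - q x)\<bar> \<le> 0 * gauss_dom z + 4 * B" for x z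
      using pq(2)[of "y x z" "y x z" x] pq(2)[of x "y x z" x] by (simp add: left_diff_distrib abs_le_iff)
    then have "\<bar>S x\<bar> \<le> 0 * ?K + 4 * B" for x unfolding S_def by (intro abs_integral_bound_gauss(2)) auto
    then show "\<bar>S x\<bar> \<le> 0 * gauss_dom x + 4 * B" for x by simp
  qed simp
  have ig: "integrable std_gaussian (\<lambda>x. b\<^sup>2 * (g x \<bullet> G x))"
  proof (intro integrable_mult_right abs_integral_bound_gauss(1)[where c=0 and d="L * L'"])
    fix x show "\<bar>g x \<bullet> G x\<bar> \<le> 0 * gauss_dom x + L * L'"
      using L has_quadratic_remainderD(5)[OF \<phi>] has_quadratic_remainderD(5)[OF q]
      by (simp, intro order_trans[OF Cauchy_Schwarz_ineq2] mult_mono) auto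
  qed simp
  have "2 * D - b\<^sup>2 * (\<E> x. g x \<bullet> G x) = (\<E> x. S x - b\<^sup>2 * (g x \<bullet> G x))"
    using iS ig by (simp add: twoD)
  also have "\<bar>\<dots>\<bar> \<le> (b^3 * (4 * ?R + L * L')) * ?K + b^3 * 4 * ?R * ?K"
    by (rule abs_integral_bound_gauss[OF _ Sb]) simp
  also have "\<dots> = b^3 * ?K * (8 * ?R + L * L')" by (simp add: algebra_simps)
  finally show ?thesis by (simp add: D_def)
qed

section \<open>One Euler step against a test function\<close>

lemma abs_ou_op_diff_le:
  fixes q :: "'a::euclidean_space \<Rightarrow> real"
  assumes [measurable]: "q \<in> borel_measurable borel" and lip: "\<And>x y. \<bar>q y - q x\<bar> \<le> K * norm (y - x)"
    and bd: "\<And>x. \<bar>q x\<bar> \<le> B" and K: "0 \<le> K" and h: "0 < h"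
  shows "\<bar>ou_op h q x - q x\<bar> \<le> K * sqrt (1 - exp (- 2 * h)) * (gauss_dom x + gauss_dom_int TYPE('a))"
proof -
  define a where "a = exp (- h)"
  define b where "b = sqrt (1 - exp (- 2 * h))"
  note ab = ou_coefficients[OF h, folded a_def b_def]
  have iq: "integrable std_gaussian (\<lambda>z. q (a *\<^sub>R x + b *\<^sub>R z))"
    by (rule abs_integral_bound_gauss[where c=0 and d=B]) (use bd in auto)
  have "ou_op h q x - q x = (\<E> z. q (a *\<^sub>R x + b *\<^sub>R z) - q x)"
    using iq by (simp add: ou_op_def a_def b_def)
  also have "\<bar>\<dots>\<bar> \<le> (K * b) * gauss_dom_int TYPE('a) + K * b * gauss_dom x"
  proof (rule abs_integral_bound_gauss)
    fix z
    have "\<bar>q (a *\<^sub>R x + b *\<^sub>R z) - q x\<bar> \<le> K * norm (a *\<^sub>R x + b *\<^sub>R z - x)" by (rule lip)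
    also have "\<dots> \<le> K * (b * (norm x + norm z))"
      using K by (intro mult_left_mono norm_affine_diff_le(1)[OF ab(1,2) less_imp_le[OF ab(3)] ab(5)])
    also have "\<dots> \<le> K * (b * (gauss_dom x + gauss_dom z))"
      using ab K by (intro mult_left_mono add_mono gauss_dom_bounds) auto
    finally show "\<bar>q (a *\<^sub>R x + b *\<^sub>R z) - q x\<bar> \<le> (K * b) * gauss_dom z + K * b * gauss_dom x" by (simp add: algebra_simps)
  qed simp
  finally show ?thesis by (simp add: algebra_simps b_def)
qed

text \<open>Built from the data of \<open>q\<close> and the dimension alone. In
  \<open>euler_step_estimate\<close> the test function enters only through the factor
  \<open>L + M\<close>, so the same constant serves every step.\<close>

definition step_const :: "real \<Rightarrow> real \<Rightarrow> real \<Rightarrow> real \<Rightarrow> real \<Rightarrow> real" where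
  "step_const K m B L' M' = K * (12 * (M' + L') + 2 * L') + L' + (L' / m)\<^sup>2 * B + 4 * K * L'\<^sup>2 / m"

text \<open>Write \<open>v = G / q\<close>. Moving the argument of \<phi> by
  \<open>h *\<^sub>R v\<close> raises the integral by \<open>h\<close> times the integral of
  \<open>g \<bullet> G\<close>, because \<open>q *\<^sub>R v = G\<close>; replacing \<open>q\<close>
  by \<open>ou_op h q\<close> lowers it by the same amount, by \<open>dirichlet_form_approx\<close>.
  The leading terms cancel.\<close>

lemma euler_step_estimate:
  fixes \<phi> q :: "'a::euclidean_space \<Rightarrow> real"
  assumes \<phi>: "has_quadratic_remainder \<phi> g L M" and q: "has_quadratic_remainder q G L' M'"
    and \<phi>1: "\<And>x. \<bar>\<phi> x\<bar> \<le> 1" and m: "0 < m" and qm: "\<And>x. m \<le> q x" and qB: "\<And>x. q x \<le> B"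
    and h: "0 < h" "h \<le> 1"
  shows "\<bar>(\<E> x. \<phi> (x + h *\<^sub>R ((1 / q x) *\<^sub>R G x)) * ou_op h q x) - (\<E> x. \<phi> x * q x)\<bar>
    \<le> step_const (gauss_dom_int TYPE('a)) m B L' M' * (L + M) * (h * sqrt h)"
proof -
  let ?K = "gauss_dom_int TYPE('a)"
  define b where "b = sqrt (1 - exp (- 2 * h))"
  define r where "r = h * sqrt h"
  define v where "v x = (1 / q x) *\<^sub>R G x" for x
  define I where "I = (\<E> x. g x \<bullet> G x)"
  let ?P = "ou_op h q"
  note \<phi>D = has_quadratic_remainderD[OF \<phi>] and qD = has_quadratic_remainderD[OF q]
  note [measurable] = \<phi>D(1,2) qD(1,2)
  have [measurable]: "v \<in> borel_measurable borel" unfolding v_def[abs_def] by measurable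
  have K1: "1 \<le> ?K" by (rule gauss_dom_int_ge1)
  have qabs: "\<bar>q x\<bar> \<le> B" for x using qm[of x] qB[of x] m by linarith
  have B: "0 \<le> B" "m \<le> B" using qm[of 0] qB[of 0] m by linarith+
  have P: "m \<le> ?P x" "?P x \<le> B" for x using ou_op_bounds[OF qD(1) qm qB] by auto
  have Pabs: "\<bar>?P x\<bar> \<le> B" for x using P[of x] m by linarith
  have b2: "b\<^sup>2 = 1 - exp (- 2 * h)"
  proof -
    have "exp (- 2 * h) \<le> 1" using h by simp
    then show ?thesis unfolding b_def by (intro real_sqrt_pow2) linarith
  qed
  have bh: "b\<^sup>2 \<le> 2 * h" using exp_ge_add_one_self[of "- 2 * h"] by (simp add: b2)
  have b0: "0 \<le> b" using h by (simp add: b_def)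
  have bh2: "2 * h - b\<^sup>2 \<le> 2 * h\<^sup>2"
  proof -
    \<comment> \<open>This follows from the quadratic lower bound for \<open>exp (2 * h)\<close>,
      because the two quadratics multiply to \<open>1 + 4 * h ^ 4\<close>.\<close>
    have "exp (- (2 * h)) \<le> 1 - (2 * h) + (2 * h)\<^sup>2 / 2"
    proof -
      have "1 + 2 * h + (2 * h)\<^sup>2 / 2 \<le> exp (2 * h)" using exp_lower_Taylor_quadratic[of "2 * h"] h by simp
      then have "(1 - (2 * h) + (2 * h)\<^sup>2 / 2) * (1 + 2 * h + (2 * h)\<^sup>2 / 2) \<le> (1 - (2 * h) + (2 * h)\<^sup>2 / 2) * exp (2 * h)"
        using zero_le_power2[of "2 * h - 1"] by (intro mult_left_mono) (auto simp: power2_eq_square algebra_simps)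
      moreover have "(1 - (2 * h) + (2 * h)\<^sup>2 / 2) * (1 + 2 * h + (2 * h)\<^sup>2 / 2) = 1 + 4 * (h^2)^2"
        by (simp add: power2_eq_square algebra_simps)
      ultimately have "1 \<le> (1 - (2 * h) + (2 * h)\<^sup>2 / 2) * exp (2 * h)"
        using zero_le_power2[of "h\<^sup>2"] by linarith
      then show ?thesis by (simp add: exp_minus field_simps)
    qed
    then show ?thesis by (simp add: b2 power_mult_distrib)
  qed
  \<comment> \<open>The number 3/2 is a rational bound for sqrt 2.\<close>
  have bs: "b \<le> 3 / 2 * sqrt h"
  proof (rule power2_le_imp_le)
    show "b\<^sup>2 \<le> (3 / 2 * sqrt h)\<^sup>2" using bh h by (simp add: power_mult_distrib power_divide)
  qed (use h in simp)
  have b3: "b^3 \<le> 3 * r"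
  proof -
    have "b^3 = b\<^sup>2 * b" by (simp add: power3_eq_cube power2_eq_square)
    also have "\<dots> \<le> (2 * h) * (3 / 2 * sqrt h)" using bh bs b0 h by (intro mult_mono) auto
    finally show ?thesis by (simp add: r_def)
  qed
  have hr: "h\<^sup>2 \<le> r"
  proof -
    have "h \<le> sqrt h" using h by (simp add: real_le_rsqrt power2_eq_square mult_left_le)
    then show ?thesis using h by (simp add: r_def power2_eq_square)
  qed
  have r0: "0 \<le> r" using h by (simp add: r_def)
  have gG: "\<bar>g x \<bullet> G x\<bar> \<le> L * L'" for x
    using \<phi>D(3,5) qD(5) by (intro order_trans[OF Cauchy_Schwarz_ineq2] mult_mono) auto
  have ig: "integrable std_gaussian (\<lambda>x. g x \<bullet> G x)"
    by (rule abs_integral_bound_gauss[where c=0 and d="L * L'"]) (use gG in auto)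
  have I: "\<bar>I\<bar> \<le> L * L'" unfolding I_def using abs_integral_bound_gauss(2)[of "\<lambda>x. g x \<bullet> G x" 0 "L * L'"] gG by simp
  define D where "D = (\<E> x. \<phi> x * q x) - (\<E> x. \<phi> x * ?P x)"
  have 1: "\<bar>D - h * I\<bar> \<le> r * (3 / 2 * ?K * (8 * (L * M' + M * L') + L * L') + L * L')"
  proof -
    have "\<bar>2 * D - b\<^sup>2 * I\<bar> \<le> b^3 * ?K * (8 * (L * M' + M * L') + L * L')"
      unfolding D_def I_def b_def by (rule dirichlet_form_approx[OF \<phi> q \<phi>1 qabs h(1)])
    also have "\<dots> \<le> (3 * r) * ?K * (8 * (L * M' + M * L') + L * L')"
      using b3 K1 \<phi>D(3,4) qD(3,4) by (intro mult_right_mono) auto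
    finally have a1: "\<bar>2 * D - b\<^sup>2 * I\<bar> \<le> (3 * r) * ?K * (8 * (L * M' + M * L') + L * L')" .
    have "\<bar>(2 * h - b\<^sup>2) * I\<bar> \<le> (2 * h\<^sup>2) * (L * L')"
      unfolding abs_mult using bh bh2 I by (intro mult_mono) auto
    also have "\<dots> \<le> (2 * r) * (L * L')" using hr \<phi>D(3) qD(3) by (intro mult_right_mono) auto
    finally have a2: "\<bar>(2 * h - b\<^sup>2) * I\<bar> \<le> (2 * r) * (L * L')" .
    have "2 * (D - h * I) = (2 * D - b\<^sup>2 * I) - (2 * h - b\<^sup>2) * I" by (simp add: algebra_simps)
    then have "2 * \<bar>D - h * I\<bar> \<le> (3 * r) * ?K * (8 * (L * M' + M * L') + L * L') + (2 * r) * (L * L')"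
      using a1 a2 by linarith
    then show ?thesis by (simp add: algebra_simps)
  qed
  define X where "X = (\<E> x. \<phi> (x + h *\<^sub>R v x) * ?P x)"
  have nv: "norm (v x) \<le> L' / m" for x
  proof -
    have "norm (v x) = norm (G x) / q x" using qm[of x] m by (simp add: v_def)
    also have "\<dots> \<le> L' / m" using qD(3,5) qm[of x] m by (intro frac_le) auto
    finally show ?thesis .
  qed
  have ip: "integrable std_gaussian (\<lambda>x. \<phi> x * ?P x)" "integrable std_gaussian (\<lambda>x. \<phi> (x + h *\<^sub>R v x) * ?P x)"
    by (rule abs_integral_bound_gauss[where c=0 and d=B]; use abs_mult_le_of_le_one[OF \<phi>1 Pabs] in simp)+
  have 2: "\<bar>X - (\<E> x. \<phi> x * ?P x) - h * I\<bar>
    \<le> r * (M * ((L' / m)\<^sup>2 * B) + L * (4 * ?K * L'\<^sup>2 / m))"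
  proof -
    define c where "c = h * (L * (L' / m) * (L' * b))"
    have "X - (\<E> x. \<phi> x * ?P x) - h * I
      = (\<E> x. \<phi> (x + h *\<^sub>R v x) * ?P x - \<phi> x * ?P x - h * (g x \<bullet> G x))"
      unfolding X_def I_def using ip ig by simp
    also have "\<bar>\<dots>\<bar> \<le> c * ?K + (h\<^sup>2 * (M * (L' / m)\<^sup>2 * B) + c * ?K)"
    proof (rule abs_integral_bound_gauss(2))
      fix x
      have qx: "q x > 0" using qm[of x] m by linarith
      \<comment> \<open>A Taylor remainder of \<phi>, plus the linear term with \<open>q\<close>
        replaced by \<open>ou_op h q\<close>; with \<open>q\<close> itself the linear term would be
        exactly \<open>h * (g x \<bullet> G x)\<close>.\<close>
      have e: "\<phi> (x + h *\<^sub>R v x) * ?P x - \<phi> x * ?P x - h * (g x \<bullet> G x)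
        = (\<phi> (x + h *\<^sub>R v x) - \<phi> x - g x \<bullet> (x + h *\<^sub>R v x - x)) * ?P x + h * ((g x \<bullet> v x) * (?P x - q x))"
        using qx by (simp add: v_def field_simps)
      have "\<bar>\<phi> (x + h *\<^sub>R v x) - \<phi> x - g x \<bullet> (x + h *\<^sub>R v x - x)\<bar> \<le> M * (norm (x + h *\<^sub>R v x - x))\<^sup>2"
        by (rule \<phi>D(7))
      also have "\<dots> \<le> M * (h * (L' / m))\<^sup>2"
        using mult_left_mono[OF nv[of x], of h] h \<phi>D(4) by (intro mult_left_mono power_mono) auto
      finally have "\<bar>\<phi> (x + h *\<^sub>R v x) - \<phi> x - g x \<bullet> (x + h *\<^sub>R v x - x)\<bar> * \<bar>?P x\<bar> \<le> (M * (h * (L' / m))\<^sup>2) * B"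
        using Pabs[of x] \<phi>D(4) by (intro mult_mono) auto
      then have u1: "\<bar>(\<phi> (x + h *\<^sub>R v x) - \<phi> x - g x \<bullet> (x + h *\<^sub>R v x - x)) * ?P x\<bar> \<le> h\<^sup>2 * (M * (L' / m)\<^sup>2 * B)"
        by (simp add: abs_mult power_mult_distrib power_divide mult_ac)
      have "\<bar>g x \<bullet> v x\<bar> \<le> L * (L' / m)"
        using \<phi>D(3,5) nv[of x] by (intro order_trans[OF Cauchy_Schwarz_ineq2] mult_mono) auto
      then have "\<bar>g x \<bullet> v x\<bar> * \<bar>?P x - q x\<bar> \<le> (L * (L' / m)) * (L' * b * (gauss_dom x + ?K))"
        using abs_ou_op_diff_le[OF qD(1,6) qabs qD(3) h(1), of x] \<phi>D(3) qD(3) m by (intro mult_mono) (auto simp: b_def)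
      from mult_left_mono[OF this less_imp_le[OF h(1)]]
      have "\<bar>h * ((g x \<bullet> v x) * (?P x - q x))\<bar> \<le> h * ((L * (L' / m)) * (L' * b * (gauss_dom x + ?K)))"
        using h(1) by (simp only: abs_mult abs_of_pos)
      also have "\<dots> = c * gauss_dom x + c * ?K" by (simp add: c_def algebra_simps)
      finally have u2: "\<bar>h * ((g x \<bullet> v x) * (?P x - q x))\<bar> \<le> c * gauss_dom x + c * ?K" .
      show "\<bar>\<phi> (x + h *\<^sub>R v x) * ?P x - \<phi> x * ?P x - h * (g x \<bullet> G x)\<bar>
        \<le> c * gauss_dom x + (h\<^sup>2 * (M * (L' / m)\<^sup>2 * B) + c * ?K)"
        unfolding e using u1 u2 by linarith
    qed measurable
    also have "\<dots> = h\<^sup>2 * (M * (L' / m)\<^sup>2 * B) + (2 * ?K) * c" by simp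
    also have "\<dots> \<le> r * (M * (L' / m)\<^sup>2 * B) + (2 * ?K) * (r * (2 * (L * (L' / m) * L')))"
    proof (intro add_mono mult_right_mono mult_left_mono hr)
      have "b \<le> 2 * sqrt h" using bs real_sqrt_ge_zero[of h] h by linarith
      then have "c \<le> h * (L * (L' / m) * (L' * (2 * sqrt h)))"
        unfolding c_def using h m \<phi>D(3) qD(3) by (intro mult_left_mono) auto
      then show "c \<le> r * (2 * (L * (L' / m) * L'))" by (simp add: r_def mult_ac)
    qed (use B K1 \<phi>D(3,4) m in auto)
    also have "\<dots> = r * (M * ((L' / m)\<^sup>2 * B) + L * (4 * ?K * L'\<^sup>2 / m))"
      by (simp add: algebra_simps power2_eq_square)
    finally show ?thesis .
  qed
  have "X - (\<E> x. \<phi> x * q x) = (X - (\<E> x. \<phi> x * ?P x) - h * I) - (D - h * I)"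
    by (simp add: D_def)
  then have "\<bar>X - (\<E> x. \<phi> x * q x)\<bar> \<le>
    r * (M * ((L' / m)\<^sup>2 * B) + L * (4 * ?K * L'\<^sup>2 / m)) + r * (3 / 2 * ?K * (8 * (L * M' + M * L') + L * L') + L * L')"
    using 1 2 by linarith
  also have "\<dots> = r * ((M * ((L' / m)\<^sup>2 * B) + L * (4 * ?K * L'\<^sup>2 / m)) + (3 / 2 * ?K * (8 * (L * M' + M * L') + L * L') + L * L'))"
    by (simp add: algebra_simps)
  also have "\<dots> \<le> r * (step_const ?K m B L' M' * (L + M))"
  proof (rule mult_left_mono[OF _ r0])
    have n: "0 \<le> ?K" "0 \<le> L" "0 \<le> M" "0 \<le> L'" "0 \<le> M'" "0 \<le> (L' / m)\<^sup>2 * B" "0 \<le> ?K * L'\<^sup>2 / m"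
      using K1 \<phi>D(3,4) qD(3,4) B m by auto
    have "step_const ?K m B L' M' * (L + M) - ((M * ((L' / m)\<^sup>2 * B) + L * (4 * ?K * L'\<^sup>2 / m)) + (3 / 2 * ?K * (8 * (L * M' + M * L') + L * L') + L * L'))
      = 12 * (?K * (L * L')) + 12 * (?K * (M * M')) + 2 * (?K * (M * L')) + 1 / 2 * (?K * (L * L')) + L' * M + L * ((L' / m)\<^sup>2 * B) + 4 * (M * (?K * L'\<^sup>2 / m))"
      by (simp add: step_const_def algebra_simps add_divide_distrib)
    moreover have "\<dots> \<ge> 0" by (intro add_nonneg_nonneg mult_nonneg_nonneg n) auto
    ultimately show "(M * ((L' / m)\<^sup>2 * B) + L * (4 * ?K * L'\<^sup>2 / m)) + (3 / 2 * ?K * (8 * (L * M' + M * L') + L * L') + L * L')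
      \<le> step_const ?K m B L' M' * (L + M)" by linarith
  qed
  finally show ?thesis by (simp add: X_def v_def r_def mult_ac)
qed

section \<open>Euler steps along a velocity field\<close>

text \<open>\<open>A x\<close> is the derivative of \<open>v\<close> at \<open>x\<close>; it is symmetric since \<open>v\<close> will be a gradient.\<close>

definition smooth_velocity :: "('a::euclidean_space \<Rightarrow> 'a) \<Rightarrow> ('a \<Rightarrow> 'a \<Rightarrow> 'a) \<Rightarrow> real \<Rightarrow> bool" where
  "smooth_velocity v A C \<longleftrightarrow> v \<in> borel_measurable borel \<and>
     (\<forall>w. w \<in> borel_measurable borel \<longrightarrow> (\<lambda>x. A x (w x)) \<in> borel_measurable borel) \<and>
     (\<forall>x. linear (A x)) \<and> (\<forall>x k l. A x k \<bullet> l = A x l \<bullet> k) \<and> 0 \<le> C \<and>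
     (\<forall>x k. norm (A x k) \<le> C * norm k) \<and>
     (\<forall>x y. norm (v y - v x - A x (y - x)) \<le> C * (norm (y - x))\<^sup>2)"

lemma smooth_velocityD:
  assumes "smooth_velocity v A C"
  shows "v \<in> borel_measurable borel"
    "w \<in> borel_measurable borel \<Longrightarrow> (\<lambda>x. A x (w x)) \<in> borel_measurable borel"
    "linear (A x)" "A x k \<bullet> l = A x l \<bullet> k" "0 \<le> C" "norm (A x k) \<le> C * norm k"
    "norm (v y - v x - A x (y - x)) \<le> C * (norm (y - x))\<^sup>2"
  using assms by (auto simp: smooth_velocity_def)

section \<open>Lipschitz constant and regularity after one step\<close>

lemma has_derivative_of_quadratic_remainder:
  fixes F :: "'a::real_normed_vector \<Rightarrow> 'b::real_normed_vector"
  assumes A: "bounded_linear A" and T: "\<And>y. norm (F y - F x - A (y - x)) \<le> C * (norm (y - x))\<^sup>2"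
  shows "(F has_derivative A) (at x)"
proof (rule has_derivativeI[OF A])
  show "((\<lambda>y. ((F y - F x) - A (y - x)) /\<^sub>R norm (y - x)) \<longlongrightarrow> 0) (at x)"
  proof (rule Lim_null_comparison)
    have "norm (((F y - F x) - A (y - x)) /\<^sub>R norm (y - x)) \<le> C * norm (y - x)" for y
    proof (cases "y = x")
      case False
      then show ?thesis using T[of y] by (simp add: divide_simps power2_eq_square mult_ac)
    qed simp
    then show "\<forall>\<^sub>F y in at x. norm (((F y - F x) - A (y - x)) /\<^sub>R norm (y - x)) \<le> C * norm (y - x)" by simp
    show "((\<lambda>y. C * norm (y - x)) \<longlongrightarrow> 0) (at x)"
      by (rule tendsto_eq_intros refl | simp)+
  qed
qed

lemma smooth_velocity_has_derivative:
  assumes v: "smooth_velocity v A C"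
  shows "(v has_derivative A x) (at x)"
  using smooth_velocityD(3,7)[OF v]
  by (intro has_derivative_of_quadratic_remainder) (auto simp: linear_conv_bounded_linear)

text \<open>The operator norm of a positive semidefinite map is its largest eigenvalue. Instead of
  diagonalising, evaluate the form at \<open>u - (1 / m) *\<^sub>R S u\<close>, where it is at most
  \<open>m * (norm u)\<^sup>2 - (norm (S u))\<^sup>2 / m\<close>.\<close>

lemma psd_norm_le:
  fixes S :: "'a::real_inner \<Rightarrow> 'a"
  assumes S: "linear S" and sym: "\<And>k l. S k \<bullet> l = S l \<bullet> k"
    and pos: "\<And>u. 0 \<le> S u \<bullet> u" and le: "\<And>u. S u \<bullet> u \<le> m * (norm u)\<^sup>2" and m: "0 < m"
  shows "norm (S u) \<le> m * norm u"
proof -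
  interpret S: linear S by fact
  let ?w = "S u"
  have "0 \<le> S (u - (1 / m) *\<^sub>R ?w) \<bullet> (u - (1 / m) *\<^sub>R ?w)" by (rule pos)
  also have "\<dots> = S u \<bullet> u - (1 / m) * (S u \<bullet> ?w) - (1 / m) * (S ?w \<bullet> u) + (1 / m)\<^sup>2 * (S ?w \<bullet> ?w)"
    by (simp add: S.diff S.scale inner_diff_left inner_diff_right power2_eq_square algebra_simps)
  also have "S ?w \<bullet> u = S u \<bullet> ?w" by (rule sym)
  also have "S u \<bullet> u - (1 / m) * (S u \<bullet> ?w) - (1 / m) * (S u \<bullet> ?w) + (1 / m)\<^sup>2 * (S ?w \<bullet> ?w)
    \<le> m * (norm u)\<^sup>2 - (1 / m) * (S u \<bullet> ?w) - (1 / m) * (S u \<bullet> ?w) + (1 / m)\<^sup>2 * (m * (norm ?w)\<^sup>2)"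
    using le[of u] mult_left_mono[OF le[of ?w], of "(1 / m)\<^sup>2"] by simp
  also have "\<dots> = m * (norm u)\<^sup>2 - (1 / m) * (norm ?w)\<^sup>2"
    using m by (simp add: power2_norm_eq_inner[symmetric] power2_eq_square[of m] power_divide field_simps)
  finally have "(norm ?w)\<^sup>2 \<le> (m * norm u)\<^sup>2"
    using m by (simp add: field_simps power2_eq_square)
  then show ?thesis by (rule power2_le_imp_le) (use m in simp)
qed

text \<open>The condition \<open>h * C \<le> 1\<close> makes the derivative, identity plus
  \<open>h\<close> times \<open>A x\<close>, positive semidefinite. Its norm is then controlled by
  the upper bound \<theta> on the form alone, however negative the other eigenvalues of
  \<open>A x\<close> are.\<close>

lemma euler_step_lipschitz:
  assumes v: "smooth_velocity v A C" and h: "0 \<le> h" "h * C \<le> 1" and t: "0 \<le> \<theta>"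
    and A: "\<And>x u. A x u \<bullet> u \<le> \<theta> * (norm u)\<^sup>2"
  shows "norm ((y + h *\<^sub>R v y) - (x + h *\<^sub>R v x)) \<le> (1 + h * \<theta>) * norm (y - x)"
proof (rule differentiable_bound[where S=UNIV and f'="\<lambda>x k. k + h *\<^sub>R A x k"])
  fix x
  show "((\<lambda>x. x + h *\<^sub>R v x) has_derivative (\<lambda>k. k + h *\<^sub>R A x k)) (at x within UNIV)"
    by (intro derivative_intros smooth_velocity_has_derivative[OF v])
  interpret A: linear "A x" by (rule smooth_velocityD[OF v])
  show "onorm (\<lambda>k. k + h *\<^sub>R A x k) \<le> 1 + h * \<theta>"
  proof (rule onorm_le)
    fix k
    show "norm (k + h *\<^sub>R A x k) \<le> (1 + h * \<theta>) * norm k"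
    proof (rule psd_norm_le[where S="\<lambda>k. k + h *\<^sub>R A x k"])
      show "linear (\<lambda>k. k + h *\<^sub>R A x k)" by (rule linearI) (auto simp: A.add A.scale algebra_simps)
      show "(k + h *\<^sub>R A x k) \<bullet> l = (l + h *\<^sub>R A x l) \<bullet> k" for k l
        using smooth_velocityD(4)[OF v, of x k l] by (simp add: inner_add_left inner_commute[of k l])
      fix u
      have "\<bar>A x u \<bullet> u\<bar> \<le> (C * norm u) * norm u"
        by (rule order_trans[OF Cauchy_Schwarz_ineq2]) (intro mult_right_mono smooth_velocityD(6)[OF v] norm_ge_zero)
      then have "h * \<bar>A x u \<bullet> u\<bar> \<le> h * (C * (norm u)\<^sup>2)" using h by (intro mult_left_mono) (auto simp: power2_eq_square)
      also have "\<dots> \<le> (norm u)\<^sup>2" using mult_right_mono[OF h(2), of "(norm u)\<^sup>2"] by (simp add: mult_ac)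
      finally have "\<bar>h * (A x u \<bullet> u)\<bar> \<le> (norm u)\<^sup>2" using h by (simp add: abs_mult)
      then show "0 \<le> (u + h *\<^sub>R A x u) \<bullet> u" by (simp add: inner_add_left power2_norm_eq_inner abs_le_iff)
      show "(u + h *\<^sub>R A x u) \<bullet> u \<le> (1 + h * \<theta>) * (norm u)\<^sup>2"
        using mult_left_mono[OF A[of x u] h(1)] by (simp add: inner_add_left power2_norm_eq_inner algebra_simps)
    qed (use h t in \<open>simp add: add_pos_nonneg\<close>)
  qed
qed auto

text \<open>The chain rule with constants. The gradient of the composition involves the transposed
  derivative of the step; symmetry of \<open>A x\<close> allows it to be written with
  \<open>A x\<close>.\<close>

lemma has_quadratic_remainder_euler_step:
  assumes \<phi>: "has_quadratic_remainder \<phi> g L M" and v: "smooth_velocity v A C"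
    and h: "0 \<le> h" "h * C \<le> 1"
  shows "has_quadratic_remainder (\<lambda>x. \<phi> (x + h *\<^sub>R v x))
     (\<lambda>x. g (x + h *\<^sub>R v x) + h *\<^sub>R A x (g (x + h *\<^sub>R v x)))
     (L * (1 + h * C)) (M * (1 + h * C)\<^sup>2 + L * (h * C))"
  unfolding has_quadratic_remainder_def
proof (intro conjI allI)
  note \<phi>D = has_quadratic_remainderD[OF \<phi>] and vD = smooth_velocityD[OF v]
  note [measurable] = \<phi>D(1,2) vD(1,2)
  let ?T = "\<lambda>x. x + h *\<^sub>R v x"
  have hC: "0 \<le> h * C" using h vD(5) by simp
  have lip: "norm (?T y - ?T x) \<le> (1 + h * C) * norm (y - x)" for x y
  proof (rule euler_step_lipschitz[OF v h vD(5)])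
    fix x u
    have "A x u \<bullet> u \<le> (C * norm u) * norm u"
      by (rule order_trans[OF norm_cauchy_schwarz]) (intro mult_right_mono vD(6) norm_ge_zero)
    then show "A x u \<bullet> u \<le> C * (norm u)\<^sup>2" by (simp add: power2_eq_square)
  qed
  show "(\<lambda>x. \<phi> (?T x)) \<in> borel_measurable borel" by measurable
  show "(\<lambda>x. g (?T x) + h *\<^sub>R A x (g (?T x))) \<in> borel_measurable borel" by measurable
  show "0 \<le> L * (1 + h * C)" "0 \<le> M * (1 + h * C)\<^sup>2 + L * (h * C)" using hC \<phi>D(3,4) by auto
  fix x
  have "norm (g (?T x) + h *\<^sub>R A x (g (?T x))) \<le> norm (g (?T x)) + h * norm (A x (g (?T x)))"
    using norm_triangle_ineq[of "g (?T x)" "h *\<^sub>R A x (g (?T x))"] h by simp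
  also have "\<dots> \<le> L + h * (C * L)"
    using \<phi>D(5)[of "?T x"] vD(6)[of x "g (?T x)"] mult_left_mono[OF \<phi>D(5)[of "?T x"] vD(5)] h
    by (intro add_mono mult_left_mono) auto
  finally show "norm (g (?T x) + h *\<^sub>R A x (g (?T x))) \<le> L * (1 + h * C)" by (simp add: algebra_simps)
  fix y
  have "\<bar>\<phi> (?T y) - \<phi> (?T x)\<bar> \<le> L * norm (?T y - ?T x)" by (rule \<phi>D(6))
  also have "\<dots> \<le> L * ((1 + h * C) * norm (y - x))" using \<phi>D(3) by (intro mult_left_mono lip)
  finally show "\<bar>\<phi> (?T y) - \<phi> (?T x)\<bar> \<le> L * (1 + h * C) * norm (y - x)" by (simp add: mult_ac)
  define k where "k = y - x"
  have e: "\<phi> (?T y) - \<phi> (?T x) - (g (?T x) + h *\<^sub>R A x (g (?T x))) \<bullet> k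
    = (\<phi> (?T y) - \<phi> (?T x) - g (?T x) \<bullet> (?T y - ?T x)) + h * (g (?T x) \<bullet> (v y - v x - A x k))"
    using vD(4)[of x "g (?T x)" k] by (simp add: k_def inner_commute inner_add_left inner_diff_left inner_diff_right algebra_simps)
  have "\<bar>\<phi> (?T y) - \<phi> (?T x) - g (?T x) \<bullet> (?T y - ?T x)\<bar> \<le> M * (norm (?T y - ?T x))\<^sup>2" by (rule \<phi>D(7))
  also have "\<dots> \<le> M * ((1 + h * C) * norm k)\<^sup>2" using \<phi>D(4) lip by (intro mult_left_mono power_mono) (auto simp: k_def)
  finally have 1: "\<bar>\<phi> (?T y) - \<phi> (?T x) - g (?T x) \<bullet> (?T y - ?T x)\<bar> \<le> M * (1 + h * C)\<^sup>2 * (norm k)\<^sup>2" by (simp add: power_mult_distrib)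
  have "\<bar>g (?T x) \<bullet> (v y - v x - A x k)\<bar> \<le> L * (C * (norm k)\<^sup>2)"
    unfolding k_def by (intro order_trans[OF Cauchy_Schwarz_ineq2] mult_mono \<phi>D(5) vD(7) \<phi>D(3) norm_ge_zero)
  then have "\<bar>h * (g (?T x) \<bullet> (v y - v x - A x k))\<bar> \<le> h * (L * (C * (norm k)\<^sup>2))" using h by (simp add: abs_mult mult_left_mono)
  then have "\<bar>\<phi> (?T y) - \<phi> (?T x) - (g (?T x) + h *\<^sub>R A x (g (?T x))) \<bullet> k\<bar> \<le> M * (1 + h * C)\<^sup>2 * (norm k)\<^sup>2 + h * (L * (C * (norm k)\<^sup>2))"
    unfolding e using 1 by linarith
  then show "\<bar>\<phi> (?T y) - \<phi> (?T x) - (g (?T x) + h *\<^sub>R A x (g (?T x))) \<bullet> (y - x)\<bar>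
    \<le> (M * (1 + h * C)\<^sup>2 + L * (h * C)) * (norm (y - x))\<^sup>2" by (simp add: k_def algebra_simps)
qed

section \<open>Regularity of logarithmic gradients\<close>

lemma smooth_velocity_log_gradient:
  fixes q :: "'a::euclidean_space \<Rightarrow> real"
  assumes q: "has_quadratic_remainder q G L M" and m: "0 < m" and qm: "\<And>x. m \<le> q x"
    and H: "\<And>x. linear (H x)" "\<And>x k l. H x k \<bullet> l = H x l \<bullet> k" "\<And>x k. norm (H x k) \<le> L2 * norm k"
      "\<And>x y. norm (G y - G x - H x (y - x)) \<le> M2 * (norm (y - x))\<^sup>2"
      "\<And>w. w \<in> borel_measurable borel \<Longrightarrow> (\<lambda>x. H x (w x)) \<in> borel_measurable borel"
    and C: "(L2 + L\<^sup>2 / m) / m \<le> C" "(M2 + L * M / m + (L2 + L\<^sup>2 / m) * L / m) / m \<le> C"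
    and pos: "0 \<le> L2" "0 \<le> M2"
  shows "smooth_velocity (\<lambda>x. (1 / q x) *\<^sub>R G x)
     (\<lambda>x k. (1 / q x) *\<^sub>R (H x k - (G x \<bullet> k) *\<^sub>R ((1 / q x) *\<^sub>R G x))) C"
proof -
  note qD = has_quadratic_remainderD[OF q]
  note [measurable] = qD(1,2) H(5)
  define v where "v x = (1 / q x) *\<^sub>R G x" for x
  define E where "E x k = H x k - (G x \<bullet> k) *\<^sub>R v x" for x k
  have q0: "0 < q x" for x using qm[of x] m by linarith
  have [measurable]: "v \<in> borel_measurable borel" unfolding v_def[abs_def] by measurable
  have nv: "norm (v x) \<le> L / m" for x
  proof -
    have "norm (v x) = norm (G x) / q x" using q0[of x] by (simp add: v_def)
    also have "\<dots> \<le> L / m" using qD(3,5) qm[of x] m by (intro frac_le) auto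
    finally show ?thesis .
  qed
  have nGk: "\<bar>G x \<bullet> k\<bar> \<le> L * norm k" for x k
    by (intro order_trans[OF Cauchy_Schwarz_ineq2] mult_right_mono qD(5)) auto
  have nE: "norm (E x k) \<le> (L2 + L\<^sup>2 / m) * norm k" for x k
  proof -
    have "norm (E x k) \<le> norm (H x k) + \<bar>G x \<bullet> k\<bar> * norm (v x)"
      unfolding E_def using norm_triangle_ineq4[of "H x k" "(G x \<bullet> k) *\<^sub>R v x"] by simp
    also have "\<dots> \<le> L2 * norm k + (L * norm k) * (L / m)"
      using H(3)[of x k] nv[of x] nGk[of x k] qD(3) by (intro add_mono mult_mono) auto
    finally show ?thesis by (simp add: algebra_simps power2_eq_square)
  qed
  have div: "norm ((1 / q x) *\<^sub>R w) \<le> s / m" if "norm w \<le> s" for x s and w :: 'a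
  proof -
    have "norm ((1 / q x) *\<^sub>R w) = norm w / q x" using q0[of x] by simp
    also have "\<dots> \<le> s / m" using that qm[of x] m order_trans[OF norm_ge_zero that] by (intro frac_le) auto
    finally show ?thesis .
  qed
  show ?thesis
    unfolding smooth_velocity_def v_def[symmetric] E_def[symmetric]
  proof (intro conjI allI impI)
    show "v \<in> borel_measurable borel" by measurable
    show "(\<lambda>x. (1 / q x) *\<^sub>R E x (w x)) \<in> borel_measurable borel" if [measurable]: "w \<in> borel_measurable borel" for w
      unfolding E_def by measurable
    show "linear (\<lambda>k. (1 / q x) *\<^sub>R E x k)" for x
    proof -
      interpret linear "H x" by (rule H)
      show ?thesis by (rule linearI) (auto simp: E_def add scale inner_add_right algebra_simps)
    qed
    show "(1 / q x) *\<^sub>R E x k \<bullet> l = (1 / q x) *\<^sub>R E x l \<bullet> k" for x k l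
      using H(2)[of x k l] by (simp add: E_def v_def inner_diff_left mult_ac)
    have "0 \<le> (L2 + L\<^sup>2 / m) / m" using pos m by simp
    then show "0 \<le> C" using C(1) by linarith
    show "norm ((1 / q x) *\<^sub>R E x k) \<le> C * norm k" for x k
      using div[OF nE[of x k], of x] mult_right_mono[OF C(1), of "norm k"] by simp
    fix x y :: 'a
    define k where "k = y - x"
    \<comment> \<open>This is \<open>q y\<close> times the Taylor remainder of \<open>v\<close>,
      grouped so that every term is visibly quadratic: the remainder of \<open>G\<close>, the
      remainder of \<open>q\<close>, and a product of two first-order terms.\<close>
    define w where "w = (G y - G x - H x k) - (q y - q x - G x \<bullet> k) *\<^sub>R v x + ((q x - q y) / q x) *\<^sub>R E x k"
    have "v y - v x - (1 / q x) *\<^sub>R E x k = (1 / q y) *\<^sub>R w"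
    proof -
      have gx: "G x = q x *\<^sub>R v x" and gy: "G y = q y *\<^sub>R v y" using q0[of x] q0[of y] by (auto simp: v_def)
      have "w = G y - q y *\<^sub>R v x + (G x \<bullet> k) *\<^sub>R v x - H x k + ((q x - q y) / q x) *\<^sub>R E x k"
        by (simp add: w_def gx algebra_simps)
      also have "\<dots> = q y *\<^sub>R (v y - v x) - E x k + ((q x - q y) / q x) *\<^sub>R E x k"
        by (simp add: gy E_def algebra_simps)
      also have "\<dots> = q y *\<^sub>R (v y - v x - (1 / q x) *\<^sub>R E x k)"
        using q0[of x] by (simp add: diff_divide_distrib algebra_simps)
      finally show ?thesis using q0[of y] by simp
    qed
    moreover have "norm w \<le> (M2 + L * M / m + (L2 + L\<^sup>2 / m) * L / m) * (norm k)\<^sup>2"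
    proof -
      have "norm w \<le> norm (G y - G x - H x k) + norm ((q y - q x - G x \<bullet> k) *\<^sub>R v x) + norm (((q x - q y) / q x) *\<^sub>R E x k)"
        unfolding w_def by (intro order_trans[OF norm_triangle_ineq] add_right_mono norm_triangle_ineq4)
      also have "\<dots> \<le> M2 * (norm k)\<^sup>2 + (M * (norm k)\<^sup>2) * (L / m) + (L * norm k / m) * ((L2 + L\<^sup>2 / m) * norm k)"
      proof (intro add_mono)
        show "norm (G y - G x - H x k) \<le> M2 * (norm k)\<^sup>2" using H(4) by (simp add: k_def)
        show "norm ((q y - q x - G x \<bullet> k) *\<^sub>R v x) \<le> (M * (norm k)\<^sup>2) * (L / m)"
          unfolding norm_scaleR real_norm_def k_def using nv qD(4) by (intro mult_mono qD(7)) auto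
        have "\<bar>(q x - q y) / q x\<bar> \<le> L * norm k / m"
          using qD(6)[of y x] q0[of x] qm[of x] m qD(3)
          by (simp add: k_def abs_minus_commute) (intro frac_le; simp)
        then show "norm (((q x - q y) / q x) *\<^sub>R E x k) \<le> (L * norm k / m) * ((L2 + L\<^sup>2 / m) * norm k)"
          unfolding norm_scaleR real_norm_def using nE m qD(3) by (intro mult_mono) auto
      qed
      also have "\<dots> = (M2 + L * M / m + (L2 + L\<^sup>2 / m) * L / m) * (norm k)\<^sup>2"
        using m by (simp add: power2_eq_square field_simps)
      finally show ?thesis .
    qed
    ultimately have "norm (v y - v x - (1 / q x) *\<^sub>R E x k) \<le> (M2 + L * M / m + (L2 + L\<^sup>2 / m) * L / m) * (norm k)\<^sup>2 / m"
      using div by metis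
    also have "\<dots> \<le> C * (norm k)\<^sup>2" using mult_right_mono[OF C(2), of "(norm k)\<^sup>2"] by simp
    finally show "norm (v y - v x - (1 / q x) *\<^sub>R E x (y - x)) \<le> C * (norm (y - x))\<^sup>2" by (simp add: k_def)
  qed
qed

text \<open>The quadratic remainder makes \<open>g\<close> the derivative of \<phi>, so the
  Lipschitz clause comes from the mean value inequality.\<close>

lemma has_quadratic_remainderI:
  assumes [measurable]: "\<phi> \<in> borel_measurable borel" "g \<in> borel_measurable borel"
    and L: "\<And>x. norm (g x) \<le> L" and M: "0 \<le> M"
    and T: "\<And>x y. \<bar>\<phi> y - \<phi> x - g x \<bullet> (y - x)\<bar> \<le> M * (norm (y - x))\<^sup>2"
  shows "has_quadratic_remainder \<phi> g L M"
  unfolding has_quadratic_remainder_def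
proof (intro conjI allI assms)
  show L0: "0 \<le> L" using order_trans[OF norm_ge_zero L] .
  fix x y
  have d: "(\<phi> has_derivative (\<lambda>k. g x \<bullet> k)) (at x)" for x
    by (rule has_derivative_of_quadratic_remainder[OF bounded_linear_inner_right]) (use T in simp)
  have "norm (\<phi> y - \<phi> x) \<le> L * norm (y - x)"
  proof (rule differentiable_bound[where S=UNIV and f'="\<lambda>x k. g x \<bullet> k"])
    show "onorm (\<lambda>k. g x \<bullet> k) \<le> L" for x
    proof (rule onorm_le)
      show "norm (g x \<bullet> k) \<le> L * norm k" for k
        using Cauchy_Schwarz_ineq2[of "g x" k] mult_right_mono[OF L[of x], of "norm k"] by simp
    qed
  qed (use d in \<open>auto intro: has_derivative_at_withinI\<close>)
  then show "\<bar>\<phi> y - \<phi> x\<bar> \<le> L * norm (y - x)" by simp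
qed

lemma has_quadratic_remainder_has_derivative:
  assumes "has_quadratic_remainder \<phi> g L M"
  shows "(\<phi> has_derivative (\<lambda>k. g x \<bullet> k)) (at x)"
  by (rule has_derivative_of_quadratic_remainder[OF bounded_linear_inner_right])
    (use has_quadratic_remainderD(7)[OF assms] in simp)

text \<open>The constants involve only an upper bound \<open>R\<close> of the dilation \<rho>, so
  that one choice serves a whole range of times.\<close>

lemma has_quadratic_remainder_gsmooth:
  fixes F :: "'a::euclidean_space \<Rightarrow> real"
  assumes [measurable]: "F \<in> borel_measurable borel" and B: "\<And>w. \<bar>F w\<bar> \<le> B" and \<rho>: "0 \<le> \<rho>" "\<rho> \<le> R"
  shows "has_quadratic_remainder (\<lambda>x. gsmooth F (\<rho> *\<^sub>R x)) (\<lambda>x. \<rho> *\<^sub>R gsmooth_grad F (\<rho> *\<^sub>R x))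
    (R * B * gauss_dom_int TYPE('a)) (3 * R\<^sup>2 * B * gauss_dom_int TYPE('a))"
proof (rule has_quadratic_remainderI)
  note [measurable] = gsmooth_measurable[OF assms(1) B] gsmooth_grad_measurable[OF assms(1) B]
  let ?K = "gauss_dom_int TYPE('a)"
  have K: "1 \<le> ?K" by (rule gauss_dom_int_ge1)
  have B0: "0 \<le> B" using B[of 0] by linarith
  show "(\<lambda>x. gsmooth F (\<rho> *\<^sub>R x)) \<in> borel_measurable borel" 
    "(\<lambda>x. \<rho> *\<^sub>R gsmooth_grad F (\<rho> *\<^sub>R x)) \<in> borel_measurable borel" by measurable
  show "0 \<le> 3 * R\<^sup>2 * B * ?K" using B0 K by simp
  fix x y
  have "norm (\<rho> *\<^sub>R gsmooth_grad F (\<rho> *\<^sub>R x)) \<le> R * (B * ?K)"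
    unfolding norm_scaleR using \<rho> gsmooth_bounds(2)[OF assms(1) B, of "\<rho> *\<^sub>R x"] by (intro mult_mono) auto
  then show "norm (\<rho> *\<^sub>R gsmooth_grad F (\<rho> *\<^sub>R x)) \<le> R * B * ?K" by simp
  have "\<bar>gsmooth F (\<rho> *\<^sub>R x + \<rho> *\<^sub>R (y - x)) - gsmooth F (\<rho> *\<^sub>R x) - gsmooth_grad F (\<rho> *\<^sub>R x) \<bullet> (\<rho> *\<^sub>R (y - x))\<bar>
    \<le> 3 * B * ?K * (norm (\<rho> *\<^sub>R (y - x)))\<^sup>2"
    by (rule gsmooth_taylor[OF assms(1) B])
  also have "\<dots> = 3 * B * ?K * (\<rho>\<^sup>2 * (norm (y - x))\<^sup>2)" using \<rho> by (simp add: power_mult_distrib)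
  also have "\<dots> \<le> 3 * B * ?K * (R\<^sup>2 * (norm (y - x))\<^sup>2)"
    using \<rho> B0 K by (intro mult_left_mono mult_right_mono power_mono) auto
  finally show "\<bar>gsmooth F (\<rho> *\<^sub>R y) - gsmooth F (\<rho> *\<^sub>R x) - \<rho> *\<^sub>R gsmooth_grad F (\<rho> *\<^sub>R x) \<bullet> (y - x)\<bar>
    \<le> 3 * R\<^sup>2 * B * ?K * (norm (y - x))\<^sup>2"
    by (simp add: scaleR_add_right[symmetric] mult_ac)
qed

section \<open>Logarithmic gradients along the Ornstein--Uhlenbeck flow\<close>

text \<open>Substituting \<open>exp (- t) x + sqrt (1 - exp (- 2 t)) z = sqrt (1 - exp (- 2 t)) (ou_ratio t x + z)\<close> turns
  \<^const>\<open>ou_op\<close> into \<^const>\<open>gsmooth\<close>.\<close>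

definition ou_ratio :: "real \<Rightarrow> real" where
  "ou_ratio t = exp (- t) / sqrt (1 - exp (- 2 * t))"

definition ou_dilate :: "real \<Rightarrow> ('a::euclidean_space \<Rightarrow> real) \<Rightarrow> 'a \<Rightarrow> real" where
  "ou_dilate t f w = f (sqrt (1 - exp (- 2 * t)) *\<^sub>R w)"

definition ou_grad :: "real \<Rightarrow> ('a::euclidean_space \<Rightarrow> real) \<Rightarrow> 'a \<Rightarrow> 'a" where
  "ou_grad t f x = ou_ratio t *\<^sub>R gsmooth_grad (ou_dilate t f) (ou_ratio t *\<^sub>R x)"

definition ou_hess :: "real \<Rightarrow> ('a::euclidean_space \<Rightarrow> real) \<Rightarrow> 'a \<Rightarrow> 'a \<Rightarrow> 'a" where
  "ou_hess t f x k = (ou_ratio t)\<^sup>2 *\<^sub>R gsmooth_hess (ou_dilate t f) (ou_ratio t *\<^sub>R x) k"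

lemma ou_noise_pos: "0 < t \<Longrightarrow> 0 < sqrt (1 - exp (- 2 * t))" for t :: real
  by simp

lemma ou_ratio_pos: "0 < t \<Longrightarrow> 0 < ou_ratio t"
  unfolding ou_ratio_def by (simp add: ou_noise_pos)

lemma ou_ratio_antimono:
  assumes "0 < s" "s \<le> t" shows "ou_ratio t \<le> ou_ratio s"
  unfolding ou_ratio_def using assms by (intro frac_le ou_noise_pos) auto

lemma ou_op_eq_gsmooth:
  assumes "0 < t" shows "ou_op t f x = gsmooth (ou_dilate t f) (ou_ratio t *\<^sub>R x)"
  using ou_noise_pos[OF assms]
  by (simp add: ou_op_def gsmooth_def ou_dilate_def ou_ratio_def scaleR_add_right)

definition ou_velocity :: "real \<Rightarrow> ('a::euclidean_space \<Rightarrow> real) \<Rightarrow> 'a \<Rightarrow> 'a" where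
  "ou_velocity t f x = (1 / ou_op t f x) *\<^sub>R ou_grad t f x"

definition ou_velocity_deriv :: "real \<Rightarrow> ('a::euclidean_space \<Rightarrow> real) \<Rightarrow> 'a \<Rightarrow> 'a \<Rightarrow> 'a" where
  "ou_velocity_deriv t f x k = (1 / ou_op t f x) *\<^sub>R (ou_hess t f x k - (ou_grad t f x \<bullet> k) *\<^sub>R ou_velocity t f x)"

lemma ou_dilate_measurable [measurable]:
  assumes [measurable]: "f \<in> borel_measurable borel"
  shows "ou_dilate t f \<in> borel_measurable borel"
  unfolding ou_dilate_def[abs_def] by measurable

text \<open>Since \<open>ou_ratio\<close> decreases in time, the constants computed at \<delta> hold
  at all later times.\<close>

lemma ou_regularity:
  fixes f :: "'a::euclidean_space \<Rightarrow> real"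
  assumes [measurable]: "f \<in> borel_measurable borel" and m: "0 < m" and fm: "\<And>w. m \<le> f w" and fB: "\<And>w. f w \<le> B"
    and \<delta>: "0 < \<delta>"
  shows "\<exists>L M C. \<forall>t\<ge>\<delta>. has_quadratic_remainder (ou_op t f) (ou_grad t f) L M \<and>
    smooth_velocity (ou_velocity t f) (ou_velocity_deriv t f) C"
proof -
  let ?K = "gauss_dom_int TYPE('a)" and ?R = "ou_ratio \<delta>"
  define L where "L = ?R * B * ?K"
  define M where "M = 3 * ?R\<^sup>2 * B * ?K"
  define L2 where "L2 = ?R\<^sup>2 * B * ?K"
  define M2 where "M2 = 3 * ?R^3 * B * ?K"
  define C where "C = max ((L2 + L\<^sup>2 / m) / m) ((M2 + L * M / m + (L2 + L\<^sup>2 / m) * L / m) / m)"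
  have "has_quadratic_remainder (ou_op t f) (ou_grad t f) L M \<and>
    smooth_velocity (ou_velocity t f) (ou_velocity_deriv t f) C" if t: "\<delta> \<le> t" for t
  proof
    have t0: "0 < t" using t \<delta> by simp
    let ?F = "ou_dilate t f"
    let ?\<rho> = "ou_ratio t"
    have mF [measurable]: "?F \<in> borel_measurable borel" by measurable
    have FB: "\<bar>?F w\<bar> \<le> B" for w
      using fm[of "sqrt (1 - exp (- 2 * t)) *\<^sub>R w"] fB[of "sqrt (1 - exp (- 2 * t)) *\<^sub>R w"] m
      by (simp add: ou_dilate_def)
    have B0: "0 \<le> B" using FB[of 0] by linarith
    have K: "1 \<le> ?K" by (rule gauss_dom_int_ge1)
    have \<rho>: "0 \<le> ?\<rho>" "?\<rho> \<le> ?R" using ou_ratio_pos[OF t0] ou_ratio_antimono[OF \<delta> t] by auto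
    have R: "0 \<le> ?R" using \<rho> by simp
    show q: "has_quadratic_remainder (ou_op t f) (ou_grad t f) L M"
      unfolding L_def M_def ou_op_eq_gsmooth[OF t0, abs_def] ou_grad_def[abs_def]
      by (rule has_quadratic_remainder_gsmooth) (use FB \<rho> in auto)
    show "smooth_velocity (ou_velocity t f) (ou_velocity_deriv t f) C"
      unfolding ou_velocity_def[abs_def] ou_velocity_deriv_def[abs_def]
    proof (rule smooth_velocity_log_gradient[OF q m])
      show "m \<le> ou_op t f x" for x by (rule ou_op_bounds[OF assms(1) fm fB])
      interpret H: linear "gsmooth_hess ?F u" for u by (rule linear_gsmooth_hess[OF mF FB])
      show "linear (ou_hess t f x)" for x
        by (rule linearI) (auto simp: ou_hess_def H.add H.scale algebra_simps)
      show "ou_hess t f x k \<bullet> l = ou_hess t f x l \<bullet> k" for x k l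
        using gsmooth_hess_sym[OF mF FB, of "?\<rho> *\<^sub>R x" k l] by (simp add: ou_hess_def)
      show "norm (ou_hess t f x k) \<le> L2 * norm k" for x k
      proof -
        have "norm (ou_hess t f x k) \<le> ?R\<^sup>2 * (B * ?K * norm k)"
          unfolding ou_hess_def norm_scaleR using \<rho> gsmooth_bounds(3)[OF mF FB, of "?\<rho> *\<^sub>R x" k]
          by (intro mult_mono) (auto intro: power_mono)
        then show ?thesis by (simp add: L2_def mult_ac)
      qed
      show "norm (ou_grad t f y - ou_grad t f x - ou_hess t f x (y - x)) \<le> M2 * (norm (y - x))\<^sup>2" for x y
      proof -
        define k where "k = y - x"
        have y: "y = x + k" by (simp add: k_def)
        have "ou_grad t f y - ou_grad t f x - ou_hess t f x k
          = ?\<rho> *\<^sub>R (gsmooth_grad ?F (?\<rho> *\<^sub>R x + ?\<rho> *\<^sub>R k) - gsmooth_grad ?F (?\<rho> *\<^sub>R x) - gsmooth_hess ?F (?\<rho> *\<^sub>R x) (?\<rho> *\<^sub>R k))"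
          by (simp add: ou_grad_def ou_hess_def H.scale power2_eq_square scaleR_diff_right scaleR_add_right y)
        also have "norm \<dots> \<le> ?\<rho> * (3 * B * ?K * (norm (?\<rho> *\<^sub>R k))\<^sup>2)"
          unfolding norm_scaleR using \<rho> gsmooth_grad_taylor[OF mF FB, of "?\<rho> *\<^sub>R x" "?\<rho> *\<^sub>R k"]
          by (intro mult_mono) auto
        also have "\<dots> = ?\<rho>^3 * (3 * B * ?K * (norm k)\<^sup>2)"
          by (simp add: power_mult_distrib power3_eq_cube power2_eq_square)
        also have "\<dots> \<le> ?R^3 * (3 * B * ?K * (norm k)\<^sup>2)"
          using \<rho> B0 K by (intro mult_right_mono power_mono) auto
        finally show ?thesis by (simp add: M2_def k_def mult_ac)
      qed
      show "(\<lambda>x. ou_hess t f x (w x)) \<in> borel_measurable borel" if [measurable]: "w \<in> borel_measurable borel" for w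
        unfolding ou_hess_def by (intro borel_measurable_scaleR gsmooth_hess_measurable[OF mF FB]) measurable
      show "0 \<le> L2" "0 \<le> M2" using B0 K R by (auto simp: L2_def M2_def)
    qed (auto simp: C_def)
  qed
  then show ?thesis by blast
qed

lemma ou_op_semigroup:
  fixes f :: "'a::euclidean_space \<Rightarrow> real"
  assumes [measurable]: "f \<in> borel_measurable borel" and fB: "\<And>w. \<bar>f w\<bar> \<le> B" and t: "0 < t" "0 < h"
  shows "ou_op h (ou_op t f) = ou_op (t + h) f"
proof
  fix x :: 'a
  define c where "c = sqrt (1 - exp (- 2 * (t + h)))"
  define \<alpha> where "\<alpha> = exp (- t) * sqrt (1 - exp (- 2 * h)) / c"
  define \<beta> where "\<beta> = sqrt (1 - exp (- 2 * t)) / c"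
  define a where "a = exp (- (t + h))"
  have c0: "0 < c" unfolding c_def using t by (intro ou_noise_pos) simp
  have \<beta>0: "0 < \<beta>" unfolding \<beta>_def using c0 t by (simp add: ou_noise_pos)
  have "(exp (- t) * sqrt (1 - exp (- 2 * h)))\<^sup>2 + (sqrt (1 - exp (- 2 * t)))\<^sup>2 = c\<^sup>2"
    using t by (simp add: c_def power_mult_distrib exp_double[symmetric] right_diff_distrib exp_add[symmetric])
  then have ab: "\<alpha>\<^sup>2 + \<beta>\<^sup>2 = 1"
    using c0 by (simp add: \<alpha>_def \<beta>_def power_divide add_divide_distrib[symmetric])
  have e: "exp (- t) *\<^sub>R (exp (- h) *\<^sub>R x + sqrt (1 - exp (- 2 * h)) *\<^sub>R z) + sqrt (1 - exp (- 2 * t)) *\<^sub>R z'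
     = a *\<^sub>R x + c *\<^sub>R (\<alpha> *\<^sub>R z + \<beta> *\<^sub>R z')" for z z'
  proof -
    have "a = exp (- t) * exp (- h)" by (simp add: a_def exp_add[symmetric])
    moreover have "c * \<alpha> = exp (- t) * sqrt (1 - exp (- 2 * h))" "c * \<beta> = sqrt (1 - exp (- 2 * t))"
      using c0 by (simp_all add: \<alpha>_def \<beta>_def)
    moreover have "a *\<^sub>R x + c *\<^sub>R (\<alpha> *\<^sub>R z + \<beta> *\<^sub>R z') = a *\<^sub>R x + ((c * \<alpha>) *\<^sub>R z + (c * \<beta>) *\<^sub>R z')"
      by (simp add: scaleR_add_right)
    ultimately show ?thesis by (simp add: scaleR_add_right)
  qed
  have "ou_op h (ou_op t f) x = (\<E> z. \<E> z'. f (a *\<^sub>R x + c *\<^sub>R (\<alpha> *\<^sub>R z + \<beta> *\<^sub>R z')))"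
    by (simp only: ou_op_def e)
  also have "\<dots> = (\<E> z. \<integral>z'. f (a *\<^sub>R x + c *\<^sub>R z) \<partial>(std_gaussian :: 'a measure))"
    \<comment> \<open>Applied to a function of the second coordinate only, the exchange says that
      \<open>\<alpha> *\<^sub>R z + \<beta> *\<^sub>R z'\<close> is again standard Gaussian.\<close>
    using integral_ou_exchange[of "\<lambda>p. f (a *\<^sub>R x + c *\<^sub>R snd p)" B \<beta> \<alpha>] fB \<beta>0 ab by simp
  also have "\<dots> = ou_op (t + h) f x"
    by (simp add: ou_op_def a_def c_def)
  finally show "ou_op h (ou_op t f) x = ou_op (t + h) f x" .
qed

text \<open>Along the line through \<open>x\<close> in direction \<open>u\<close>, the symmetrised
  logarithm \<open>\<psi> s\<close> rises above \<open>\<psi> 0\<close> by at least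
  \<open>\<alpha> * s\<^sup>2\<close> up to a cubic error, since \<open>\<psi>\<close> has slope at
  least \<open>2 * \<alpha> * s\<close> up to a quadratic one. The hypothesis caps the rise by
  \<open>\<kappa> * (norm u)\<^sup>2 * s\<^sup>2\<close>; divide by \<open>s\<^sup>2\<close> and let
  \<open>s\<close> tend to 0.\<close>

lemma ln_second_difference_imp_hessian_le:
  fixes q :: "'a::euclidean_space \<Rightarrow> real"
  assumes q: "has_quadratic_remainder q G L M" and q0: "\<And>x. 0 < q x"
    and v: "smooth_velocity (\<lambda>x. (1 / q x) *\<^sub>R G x) A C"
    and sd: "\<And>x u. q (x + u) * q (x - u) \<le> exp (\<kappa> * (norm u)\<^sup>2) * (q x)\<^sup>2"
  shows "A x u \<bullet> u \<le> \<kappa> * (norm u)\<^sup>2"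
proof -
  let ?v = "\<lambda>x. (1 / q x) *\<^sub>R G x"
  define \<alpha> where "\<alpha> = A x u \<bullet> u"
  interpret A: linear "A x" by (rule smooth_velocityD[OF v])
  define D where "D = 2 * C * norm u ^ 3"
  define \<psi> where "\<psi> s = ln (q (x + s *\<^sub>R u)) + ln (q (x - s *\<^sub>R u))" for s :: real
  have dl: "((\<lambda>s. ln (q (x + (r * s) *\<^sub>R u))) has_real_derivative r * (?v (x + (r * s) *\<^sub>R u) \<bullet> u)) (at s)" for r s
  proof -
    have "((\<lambda>s. q (x + (r * s) *\<^sub>R u)) has_derivative (\<lambda>d. G (x + (r * s) *\<^sub>R u) \<bullet> ((r * d) *\<^sub>R u))) (at s)"
      by (rule has_derivative_compose[OF _ has_quadratic_remainder_has_derivative[OF q]])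
        (auto intro!: derivative_eq_intros)
    then have "((\<lambda>s. q (x + (r * s) *\<^sub>R u)) has_real_derivative r * (G (x + (r * s) *\<^sub>R u) \<bullet> u)) (at s)"
      unfolding has_field_derivative_def by (rule has_derivative_eq_rhs) (simp add: fun_eq_iff)
    from DERIV_chain2[of ln "1 / q (x + (r * s) *\<^sub>R u)" "\<lambda>s. q (x + (r * s) *\<^sub>R u)" s, OF DERIV_ln_divide[OF q0] this]
    show ?thesis by simp
  qed
  have d\<psi>: "(\<psi> has_real_derivative ?v (x + s *\<^sub>R u) \<bullet> u - ?v (x - s *\<^sub>R u) \<bullet> u) (at s)" for s
    using DERIV_add[OF dl[of 1 s] dl[of "-1" s]] by (simp add: \<psi>_def[abs_def])
  have vs: "s * \<alpha> - C * s\<^sup>2 * norm u ^ 3 \<le> \<tau> * ((?v (x + (\<tau> * s) *\<^sub>R u) - ?v x) \<bullet> u)" if "\<tau> = 1 \<or> \<tau> = -1" "0 \<le> s" for s \<tau> :: real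
  proof -
    have t2: "\<tau> * \<tau> = 1" "\<bar>\<tau>\<bar> = 1" using that by auto
    have "\<tau> * ((?v (x + (\<tau> * s) *\<^sub>R u) - ?v x) \<bullet> u) - s * \<alpha> = \<tau> * ((?v (x + (\<tau> * s) *\<^sub>R u) - ?v x - A x ((\<tau> * s) *\<^sub>R u)) \<bullet> u)"
      using t2 by (simp add: A.scale \<alpha>_def inner_diff_left right_diff_distrib mult.assoc[symmetric])
    also have "\<bar>\<dots>\<bar> \<le> norm (?v (x + (\<tau> * s) *\<^sub>R u) - ?v x - A x ((\<tau> * s) *\<^sub>R u)) * norm u"
      using t2 Cauchy_Schwarz_ineq2 by (simp add: abs_mult)
    also have "\<dots> \<le> (C * (norm ((\<tau> * s) *\<^sub>R u))\<^sup>2) * norm u"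
      using smooth_velocityD(7)[OF v, of "x + (\<tau> * s) *\<^sub>R u" x] by (intro mult_right_mono) auto
    also have "\<dots> = C * s\<^sup>2 * norm u ^ 3" using t2 that by (simp add: abs_mult power_mult_distrib power3_eq_cube power2_eq_square)
    finally show ?thesis by linarith
  qed
  have mono: "\<psi> 0 \<le> \<psi> s - \<alpha> * s\<^sup>2 + D * s^3" if s: "0 \<le> s" for s
  proof -
    have "(\<lambda>s. \<psi> s - \<alpha> * s\<^sup>2 + D * s^3) 0 \<le> (\<lambda>s. \<psi> s - \<alpha> * s\<^sup>2 + D * s^3) s"
    proof (rule DERIV_nonneg_imp_nondecreasing[OF s])
      fix r assume r: "0 \<le> r" "r \<le> s"
      let ?d = "?v (x + r *\<^sub>R u) \<bullet> u - ?v (x - r *\<^sub>R u) \<bullet> u - \<alpha> * (2 * r) + D * (3 * r\<^sup>2)"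
      have "((\<lambda>s. \<psi> s - \<alpha> * s\<^sup>2 + D * s^3) has_real_derivative ?d) (at r)"
        by (rule derivative_eq_intros d\<psi> refl | simp)+
      moreover have "0 \<le> ?d"
      proof -
        have "2 * (r * \<alpha>) - 2 * (C * r\<^sup>2 * norm u ^ 3) \<le> (?v (x + r *\<^sub>R u) - ?v (x - r *\<^sub>R u)) \<bullet> u"
          using vs[of 1 r] vs[of "-1" r] r by (simp add: inner_diff_left)
        moreover have "2 * (C * r\<^sup>2 * norm u ^ 3) \<le> D * (3 * r\<^sup>2)"
          using smooth_velocityD(5)[OF v] by (simp add: D_def mult_ac mult_left_mono)
        ultimately show ?thesis by (simp add: inner_diff_left mult_ac)
      qed
      ultimately show "\<exists>y. ((\<lambda>s. \<psi> s - \<alpha> * s\<^sup>2 + D * s^3) has_real_derivative y) (at r) \<and> 0 \<le> y" by blast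
    qed
    then show ?thesis by simp
  qed
  have le: "\<psi> s \<le> \<psi> 0 + \<kappa> * (norm u)\<^sup>2 * s\<^sup>2" for s
  proof -
    have "\<psi> s = ln (q (x + s *\<^sub>R u) * q (x - s *\<^sub>R u))" using q0[of "x + s *\<^sub>R u"] q0[of "x - s *\<^sub>R u"] by (simp add: \<psi>_def ln_mult)
    also have "\<dots> \<le> ln (exp (\<kappa> * (norm (s *\<^sub>R u))\<^sup>2) * (q x)\<^sup>2)"
      using sd[of x "s *\<^sub>R u"] q0[of x] q0[of "x + s *\<^sub>R u"] q0[of "x - s *\<^sub>R u"]
      by (subst ln_le_cancel_iff) auto
    also have "\<dots> = \<psi> 0 + \<kappa> * (norm u)\<^sup>2 * s\<^sup>2"
      using q0[of x] by (simp add: \<psi>_def ln_mult power2_eq_square mult_ac)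
    finally show ?thesis .
  qed
  have "\<alpha> - \<kappa> * (norm u)\<^sup>2 \<le> D * s" if s: "0 < s" for s
  proof -
    have "\<alpha> * s\<^sup>2 \<le> \<kappa> * (norm u)\<^sup>2 * s\<^sup>2 + D * s^3" using mono[of s] le[of s] s by simp
    then have "s\<^sup>2 * (\<alpha> - \<kappa> * (norm u)\<^sup>2) \<le> s\<^sup>2 * (D * s)" by (simp add: algebra_simps power2_eq_square power3_eq_cube)
    then show ?thesis using s by (simp add: mult_le_cancel_left_pos)
  qed
  then have "\<alpha> - \<kappa> * (norm u)\<^sup>2 \<le> 0" by (rule nonpos_if_le_mult_pos)
  then show ?thesis by (simp add: \<alpha>_def)
qed

text \<open>In the direction of the log-gradient \<open>u\<close> itself, \<open>ln q\<close>
  increases at rate \<open>u \<bullet> u\<close>, whereas the hypothesis allows at most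
  \<open>\<eta> * norm u\<close>.\<close>

lemma norm_log_gradient_le:
  fixes q :: "'a::euclidean_space \<Rightarrow> real"
  assumes q: "has_quadratic_remainder q G L M" and q0: "\<And>x. 0 < q x" and \<eta>: "0 \<le> \<eta>"
    and lip: "\<And>x y. q y \<le> exp (\<eta> * norm (y - x)) * q x"
  shows "norm ((1 / q x) *\<^sub>R G x) \<le> \<eta>"
proof -
  define u where "u = (1 / q x) *\<^sub>R G x"
  have "((\<lambda>s::real. q (x + s *\<^sub>R u)) has_derivative (\<lambda>d. G (x + 0 *\<^sub>R u) \<bullet> (d *\<^sub>R u))) (at 0)"
    by (rule has_derivative_compose[OF _ has_quadratic_remainder_has_derivative[OF q]])
      (auto intro!: derivative_eq_intros)
  then have "((\<lambda>s. q (x + s *\<^sub>R u)) has_real_derivative G x \<bullet> u) (at 0)"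
    unfolding has_field_derivative_def by (rule has_derivative_eq_rhs) (simp add: fun_eq_iff)
  from DERIV_chain2[of ln "1 / q (x + 0 *\<^sub>R u)" "\<lambda>s. q (x + s *\<^sub>R u)" 0, OF DERIV_ln_divide[OF q0] this]
  have "((\<lambda>s. ln (q (x + s *\<^sub>R u))) has_real_derivative u \<bullet> u) (at 0)"
    by (simp add: u_def)
  then have l: "((\<lambda>s. (ln (q (x + s *\<^sub>R u)) - ln (q x)) / s) \<longlongrightarrow> u \<bullet> u) (at_right 0)"
    by (simp add: has_field_derivative_iff filterlim_at_split)
  have "u \<bullet> u \<le> \<eta> * norm u"
  proof (rule tendsto_upperbound[OF l])
    show "\<forall>\<^sub>F s in at_right 0. (ln (q (x + s *\<^sub>R u)) - ln (q x)) / s \<le> \<eta> * norm u"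
      unfolding eventually_at_right_field
    proof (intro exI[of _ 1] conjI allI impI)
      fix s :: real assume s: "0 < s" "s < 1"
      have "ln (q (x + s *\<^sub>R u)) \<le> ln (exp (\<eta> * norm (s *\<^sub>R u)) * q x)"
        using lip[of "x + s *\<^sub>R u" x] q0 by (subst ln_le_cancel_iff) auto
      also have "\<dots> = s * (\<eta> * norm u) + ln (q x)" using q0[of x] s by (simp add: ln_mult mult_ac)
      finally show "(ln (q (x + s *\<^sub>R u)) - ln (q x)) / s \<le> \<eta> * norm u" using s by (simp add: field_simps)
    qed simp
  qed simp
  then have "norm u * norm u \<le> \<eta> * norm u" by (simp add: power2_norm_eq_inner[symmetric] power2_eq_square)
  then have "norm u \<le> \<eta>" using \<eta> by (cases "norm u = 0") (auto simp: mult_le_cancel_right)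
  then show ?thesis by (simp add: u_def)
qed

text \<open>Integrate the inequality between \<open>tanh y\<close> and \<open>y\<close> to compare
  \<open>ln (cosh x)\<close> with \<open>x\<^sup>2 / 2\<close>.\<close>

lemma exp_add_exp_minus_le: "exp x + exp (- x) \<le> 2 * exp (x\<^sup>2 / 2)" for x :: real
proof -
  have pos: "cosh x \<le> exp (x\<^sup>2 / 2)" if x: "0 \<le> x" for x :: real
  proof -
    have sc: "sinh y \<le> y * cosh y" if y: "0 \<le> y" for y :: real
    proof -
      have "(\<lambda>y. y * cosh y - sinh y) 0 \<le> (\<lambda>y. y * cosh y - sinh y) (y::real)"
      proof (rule DERIV_nonneg_imp_nondecreasing[OF y])
        fix r :: real assume "0 \<le> r" "r \<le> y"
        then have "((\<lambda>y. y * cosh y - sinh y) has_real_derivative r * sinh r) (at r) \<and> 0 \<le> r * sinh r"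
          by (auto intro!: derivative_eq_intros)
        then show "\<exists>z. ((\<lambda>y. y * cosh y - sinh y) has_real_derivative z) (at r) \<and> 0 \<le> z" by blast
      qed
      then show ?thesis by simp
    qed
    have "(\<lambda>y. y\<^sup>2 / 2 - ln (cosh y)) 0 \<le> (\<lambda>y. y\<^sup>2 / 2 - ln (cosh y)) (x::real)"
    proof (rule DERIV_nonneg_imp_nondecreasing[OF x])
      fix r :: real assume r: "0 \<le> r" "r \<le> x"
      have "((\<lambda>y. y\<^sup>2 / 2 - ln (cosh y)) has_real_derivative r - sinh r / cosh r) (at r)"
        by (auto intro!: derivative_eq_intros)
      moreover have "0 \<le> r - sinh r / cosh r" using sc[OF r(1)] by (simp add: divide_simps)
      ultimately show "\<exists>z. ((\<lambda>y. y\<^sup>2 / 2 - ln (cosh y)) has_real_derivative z) (at r) \<and> 0 \<le> z" by blast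
    qed
    then have "ln (cosh x) \<le> x\<^sup>2 / 2" by simp
    then show ?thesis by (metis cosh_real_pos exp_le_cancel_iff exp_ln)
  qed
  have "cosh \<bar>x\<bar> \<le> exp (\<bar>x\<bar>\<^sup>2 / 2)" by (rule pos) simp
  then have "cosh x \<le> exp (x\<^sup>2 / 2)" by simp
  then show ?thesis by (simp add: cosh_def)
qed

lemma exp_minus_diff_ge:
  fixes r s :: real
  shows "2 * (s - r) * exp (- 2 * s) \<le> exp (- 2 * r) - exp (- 2 * s)"
proof -
  have "(2 * (s - r)) * exp (- 2 * s) \<le> (exp (2 * (s - r)) - 1) * exp (- 2 * s)"
  proof (rule mult_right_mono)
    show "2 * (s - r) \<le> exp (2 * (s - r)) - 1" using exp_ge_add_one_self[of "2 * (s - r)"] by linarith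
  qed simp
  also have "\<dots> = exp (- 2 * r) - exp (- 2 * s)"
    by (simp add: left_diff_distrib exp_add[symmetric])
  finally show ?thesis .
qed

text \<open>The step at the smallest time is applied last, so that step \<open>k\<close> carries the density at time \<open>\<delta> + (k + 1) h\<close>
  to the one at time \<open>\<delta> + k h\<close>, approximately.\<close>

primrec euler_map :: "('a::euclidean_space \<Rightarrow> real) \<Rightarrow> real \<Rightarrow> real \<Rightarrow> nat \<Rightarrow> 'a \<Rightarrow> 'a" where
  "euler_map F \<delta> h 0 = (\<lambda>x. x)"
| "euler_map F \<delta> h (Suc k) = (\<lambda>x. euler_map F \<delta> h k (x + h *\<^sub>R ou_velocity (\<delta> + k * h) F x))"

text \<open>The Arzela--Ascoli argument: bounded displacement gives convergence on a countable dense
  set along a diagonal subsequence, and the common Lipschitz constant carries the Cauchy property to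
  all points.\<close>

lemma lipschitz_seq_convergent_subseq:
  fixes T :: "nat \<Rightarrow> 'a::euclidean_space \<Rightarrow> 'a"
  assumes lip: "\<And>n x y. norm (T n y - T n x) \<le> K * norm (y - x)" and K: "0 \<le> K"
    and disp: "\<And>n x. norm (T n x - x) \<le> R"
  obtains r S where "strict_mono (r :: nat \<Rightarrow> nat)" "\<And>x. (\<lambda>n. T (r n) x) \<longlonglongrightarrow> S x"
proof -
  obtain D :: "'a set" where D: "countable D" "\<And>X. open X \<Longrightarrow> X \<noteq> {} \<Longrightarrow> \<exists>d\<in>D. d \<in> X"
    using countable_dense_setE by metis
  have D0: "D \<noteq> {}" using D(2)[of UNIV] by auto
  define d where "d = from_nat_into D"
  interpret subseqs "\<lambda>n s. convergent (\<lambda>i. T (s i) (d n))"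
  proof
    fix n and s :: "nat \<Rightarrow> nat"
    have "bounded (range (\<lambda>i. T (s i) (d n)))"
      unfolding bounded_iff
    proof (intro exI ballI)
      fix y assume "y \<in> range (\<lambda>i. T (s i) (d n))"
      then obtain i where "y = T (s i) (d n)" by auto
      then show "norm y \<le> R + norm (d n)"
        using disp[of "s i" "d n"] norm_triangle_sub[of "T (s i) (d n)" "d n"] by simp
    qed
    then obtain l r where "strict_mono (r :: nat \<Rightarrow> nat)" "((\<lambda>i. T (s i) (d n)) \<circ> r) \<longlonglongrightarrow> l"
      using bounded_imp_convergent_subsequence by blast
    then show "\<exists>r'. strict_mono r' \<and> convergent (\<lambda>i. T ((s \<circ> r') i) (d n))"
      by (auto simp: comp_def convergent_def)
  qed
  define r where "r = diagseq"
  have conv: "convergent (\<lambda>i. T (r i) (d n))" for n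
  proof -
    have "convergent (\<lambda>i. T ((diagseq \<circ> (+) (Suc n)) i) (d n))"
    proof (rule diagseq_holds)
      fix r s :: "nat \<Rightarrow> nat" and n
      assume "strict_mono r" "convergent (\<lambda>i. T (s i) (d n))"
      then show "convergent (\<lambda>i. T ((s \<circ> r) i) (d n))"
        using convergent_subseq_convergent[of "\<lambda>i. T (s i) (d n)" r] by (simp add: comp_def)
    qed
    then have "convergent (\<lambda>i. T (diagseq (i + Suc n)) (d n))" by (simp add: comp_def add.commute)
    then show ?thesis
      unfolding r_def using convergent_ignore_initial_segment[of "\<lambda>i. T (diagseq i) (d n)" "Suc n"] by simp
  qed
  have "convergent (\<lambda>i. T (r i) x)" for x
  proof -
    have "Cauchy (\<lambda>i. T (r i) x)"
    proof (rule metric_CauchyI)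
      fix e :: real assume e: "0 < e"
      define \<rho> where "\<rho> = e / (3 * (K + 1))"
      have \<rho>: "0 < \<rho>" using e K by (simp add: \<rho>_def)
      obtain y where y: "y \<in> D" "y \<in> ball x \<rho>" using D(2)[of "ball x \<rho>"] \<rho> by auto
      obtain n where n: "y = d n" using y(1) D(1) D0 unfolding d_def by (metis from_nat_into_surj)
      have "K * norm (y - x) \<le> (K + 1) * \<rho>"
        using y(2) K \<rho> by (intro mult_mono) (auto simp: dist_norm norm_minus_commute)
      also have "\<dots> = e / 3" using K by (simp add: \<rho>_def field_simps)
      finally have Ky: "norm (T i y - T i x) \<le> e / 3" for i using lip[of i y x] by linarith
      have "Cauchy (\<lambda>i. T (r i) y)" using conv[of n] n by (simp add: Cauchy_convergent_iff)
      then obtain N where N: "\<And>i j. N \<le> i \<Longrightarrow> N \<le> j \<Longrightarrow> dist (T (r i) y) (T (r j) y) < e / 3"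
        using e by (metis metric_CauchyD zero_less_divide_iff zero_less_numeral)
      have "dist (T (r i) x) (T (r j) x) < e" if "N \<le> i" "N \<le> j" for i j
      proof -
        have "dist (T (r i) x) (T (r j) x) \<le> dist (T (r i) x) (T (r i) y) + dist (T (r i) y) (T (r j) y) + dist (T (r j) y) (T (r j) x)"
          using dist_triangle[of "T (r i) x" "T (r j) x" "T (r i) y"] dist_triangle[of "T (r i) y" "T (r j) x" "T (r j) y"] by linarith
        then show ?thesis using N[OF that] Ky[of "r i"] Ky[of "r j"] by (simp add: dist_norm norm_minus_commute)
      qed
      then show "\<exists>M. \<forall>m\<ge>M. \<forall>n\<ge>M. dist (T (r m) x) (T (r n) x) < e" by blast
    qed
    then show ?thesis by (simp add: Cauchy_convergent_iff)
  qed
  then have lim: "(\<lambda>n. T (r n) x) \<longlonglongrightarrow> lim (\<lambda>n. T (r n) x)" for x by (simp add: convergent_LIMSEQ_iff)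
  have "strict_mono r" unfolding r_def by (rule subseq_diagseq)
  then show thesis by (rule that[OF _ lim])
qed

text \<open>Average \<psi> over Gaussian noise of size \<open>s\<close>. Rescaling by
  \<open>s\<close> expresses this through \<open>gsmooth\<close>; the constants \<open>L\<close> and
  \<open>M\<close> may blow up as \<open>s\<close> tends to 0, but they do not enter the distance to
  \<psi>.\<close>

lemma gaussian_mollification:
  fixes \<psi> :: "'a::euclidean_space \<Rightarrow> real"
  assumes [measurable]: "\<psi> \<in> borel_measurable borel" and bd: "\<And>x. \<bar>\<psi> x\<bar> \<le> 1"
    and lip: "\<And>x y. \<bar>\<psi> y - \<psi> x\<bar> \<le> K * norm (y - x)" and K: "0 \<le> K" and s: "0 < s"
  obtains \<phi> g L M where "has_quadratic_remainder \<phi> g L M" "\<And>x. \<bar>\<phi> x\<bar> \<le> 1"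
    "\<And>x. \<bar>\<phi> x - \<psi> x\<bar> \<le> K * gauss_dom_int TYPE('a) * s"
proof -
  define F where "F w = \<psi> (s *\<^sub>R w)" for w
  have [measurable]: "F \<in> borel_measurable borel" unfolding F_def[abs_def] by measurable
  have Fb: "\<bar>F w\<bar> \<le> 1" for w by (simp add: F_def bd)
  show thesis
  proof (rule that)
    show "has_quadratic_remainder (\<lambda>x. gsmooth F ((1 / s) *\<^sub>R x)) (\<lambda>x. (1 / s) *\<^sub>R gsmooth_grad F ((1 / s) *\<^sub>R x))
        ((1 / s) * 1 * gauss_dom_int TYPE('a)) (3 * (1 / s)\<^sup>2 * 1 * gauss_dom_int TYPE('a))"
      by (rule has_quadratic_remainder_gsmooth) (use Fb s in auto)
    show "\<bar>gsmooth F ((1 / s) *\<^sub>R x)\<bar> \<le> 1" for x by (rule gsmooth_bounds(1)) (use Fb in auto)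
    fix x
    have e: "F ((1 / s) *\<^sub>R x + z) = \<psi> (x + s *\<^sub>R z)" for z using s by (simp add: F_def scaleR_add_right)
    have i: "integrable std_gaussian (\<lambda>z. \<psi> (x + s *\<^sub>R z))"
      by (rule std_gaussian.integrable_const_bound[where B=1]) (use bd in auto)
    have "gsmooth F ((1 / s) *\<^sub>R x) - \<psi> x = (\<E> z. \<psi> (x + s *\<^sub>R z) - \<psi> x)"
      unfolding gsmooth_def e using i by simp
    also have "\<bar>\<dots>\<bar> \<le> (K * s) * gauss_dom_int TYPE('a) + 0"
    proof (rule abs_integral_bound_gauss(2))
      fix z
      have "\<bar>\<psi> (x + s *\<^sub>R z) - \<psi> x\<bar> \<le> K * norm (x + s *\<^sub>R z - x)" by (rule lip)
      also have "\<dots> = (K * s) * norm z" using s by simp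
      also have "\<dots> \<le> (K * s) * gauss_dom z" using K s by (intro mult_left_mono gauss_dom_bounds) auto
      finally show "\<bar>\<psi> (x + s *\<^sub>R z) - \<psi> x\<bar> \<le> (K * s) * gauss_dom z + 0" by simp
    qed simp
    finally show "\<bar>gsmooth F ((1 / s) *\<^sub>R x) - \<psi> x\<bar> \<le> K * gauss_dom_int TYPE('a) * s" by (simp add: mult_ac)
  qed
qed

section \<open>Semiconvex perturbations of bounded oscillation\<close>

locale semiconvex_perturbation =
  fixes V :: "'a::euclidean_space \<Rightarrow> real" and lam c :: real
  assumes lam: "1 \<le> lam" and c0: "0 \<le> c"
    and V_measurable [measurable]: "V \<in> borel_measurable borel"
    and semiconvex: "convex_on UNIV (\<lambda>x. V x + lam * (norm x)\<^sup>2 / 2)"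
    and osc: "V x - V y \<le> c"
    and prob: "prob_space (density std_gaussian (\<lambda>x. ennreal (exp (- V x))))"
begin

section \<open>Elementary bounds on the density and the potential\<close>

definition f :: "'a \<Rightarrow> real" where "f x = exp (- V x)"

lemma f_measurable [measurable]: "f \<in> borel_measurable borel"
  unfolding f_def[abs_def] by measurable

lemma f_pos: "0 < f x" by (simp add: f_def)

lemma f_ratio: "f x \<le> exp c * f y"
  using osc[of y x] by (simp add: f_def exp_add[symmetric])

lemma integrable_f: "integrable std_gaussian f"
  by (rule std_gaussian.integrable_const_bound[where B="exp c * f 0"])
    (use f_ratio f_pos in \<open>auto simp: less_imp_le\<close>)

lemma integral_f: "(\<E> x. f x) = 1"
proof -
  have "(\<integral>\<^sup>+x. ennreal (f x) \<partial>std_gaussian) = 1"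
    using prob_space.emeasure_space_1[OF prob] by (simp add: emeasure_density f_def)
  then show ?thesis using nn_integral_eq_integral[OF integrable_f] f_pos
    by (simp add: less_imp_le)
qed

text \<open>The density has mean one, and \<open>f_ratio\<close> compares each of its values with
  this mean.\<close>

lemma f_bounds: "exp (- c) \<le> f x" "f x \<le> exp c"
proof -
  have "integral\<^sup>L (std_gaussian :: 'a measure) (\<lambda>_. f x) \<le> (\<E> y. exp c * f y)"
    using integrable_f f_ratio by (intro integral_mono) auto
  then show "f x \<le> exp c" by (simp add: integral_f)
  have "(\<E> y. f y) \<le> integral\<^sup>L (std_gaussian :: 'a measure) (\<lambda>_. exp c * f x)"
    using integrable_f f_ratio by (intro integral_mono) auto
  then show "exp (- c) \<le> f x" by (simp add: integral_f exp_minus field_simps)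
qed

text \<open>Convexity at the midpoint of \<open>x + k\<close> and \<open>x - k\<close>; the
  parallelogram law removes \<open>x\<close> from the quadratic part. This replaces the lower bound
  on the Hessian of \<open>V\<close>.\<close>

lemma V_second_difference: "- lam * (norm k)\<^sup>2 \<le> V (x + k) + V (x - k) - 2 * V x"
proof -
  have "V x + lam * (norm x)\<^sup>2 / 2 = V ((1/2) *\<^sub>R (x + k) + (1/2) *\<^sub>R (x - k)) + lam * (norm ((1/2) *\<^sub>R (x + k) + (1/2) *\<^sub>R (x - k)))\<^sup>2 / 2"
    by (simp add: scaleR_add_right scaleR_diff_right flip: scaleR_add_left)
  also have "\<dots> \<le> (1/2) * (V (x + k) + lam * (norm (x + k))\<^sup>2 / 2) + (1/2) * (V (x - k) + lam * (norm (x - k))\<^sup>2 / 2)"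
    using semiconvex by (rule convex_onD[where t="1/2", of UNIV, simplified, rotated -1, THEN order_trans]) auto
  finally have "2 * V x + lam * (norm x)\<^sup>2 \<le> V (x + k) + V (x - k) + lam / 2 * ((norm (x + k))\<^sup>2 + (norm (x - k))\<^sup>2)"
    by (simp add: algebra_simps)
  also have "(norm (x + k))\<^sup>2 + (norm (x - k))\<^sup>2 = 2 * (norm x)\<^sup>2 + 2 * (norm k)\<^sup>2"
    by (simp add: power2_norm_eq_inner inner_add inner_diff inner_commute)
  finally show ?thesis by (simp add: algebra_simps)
qed

definition lip_const :: real where "lip_const = sqrt (2 * lam * c)"

lemma lip_const_nonneg: "0 \<le> lip_const"
  using lam c0 by (simp add: lip_const_def)

text \<open>Going past \<open>y\<close> along the ray from \<open>x\<close>, semiconvexity would make \<open>V\<close> grow by more than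
  its oscillation if it were steeper than this.\<close>

lemma V_lipschitz: "\<bar>V y - V x\<bar> \<le> lip_const * norm (y - x)"
proof -
  have one: "V y - V x \<le> lip_const * norm (y - x)" for x y
  proof (cases "V y - V x \<le> 0")
    case True
    then show ?thesis using lip_const_nonneg by (simp add: order_trans[OF _ mult_nonneg_nonneg])
  next
    case False
    define \<Delta> where "\<Delta> = V y - V x"
    define h where "h = y - x"
    have D: "0 < \<Delta>" "\<Delta> \<le> c" using False osc[of y x] by (auto simp: \<Delta>_def)
    \<comment> \<open>The final inequality bounds \<open>lam / 2 * (norm h)\<^sup>2\<close> below by
      \<open>(s * \<Delta> - c) / s\<^sup>2\<close>, and this \<open>s\<close> maximises that
      expression.\<close>
    define s where "s = 2 * c / \<Delta>"
    have s: "1 \<le> s" "0 < s" using D by (auto simp: s_def field_simps)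
    let ?W = "\<lambda>x. V x + lam * (norm x)\<^sup>2 / 2"
    have "y = (1 - 1/s) *\<^sub>R x + (1/s) *\<^sub>R (x + s *\<^sub>R h)"
      using s by (simp add: h_def algebra_simps)
    moreover have "?W ((1 - 1/s) *\<^sub>R x + (1/s) *\<^sub>R (x + s *\<^sub>R h)) \<le> (1 - 1/s) * ?W x + (1/s) * ?W (x + s *\<^sub>R h)"
      using s by (intro convex_onD[OF semiconvex]) auto
    ultimately have "?W y \<le> (1 - 1/s) * ?W x + (1/s) * ?W (x + s *\<^sub>R h)" by simp
    then have "s * ?W y \<le> s * ((1 - 1/s) * ?W x + (1/s) * ?W (x + s *\<^sub>R h))" using s by simp
    also have "\<dots> = (s - 1) * ?W x + ?W (x + s *\<^sub>R h)"
      using s by (simp add: field_simps)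
    finally have "s * ?W y \<le> (s - 1) * ?W x + ?W (x + s *\<^sub>R h)" .
    moreover have "s * (A - B) \<le> D - B" if "s * A \<le> (s - 1) * B + D" for A B D
      using that by (simp add: algebra_simps)
    ultimately have 1: "s * (?W y - ?W x) \<le> ?W (x + s *\<^sub>R h) - ?W x" by blast
    have y: "y = x + h" by (simp add: h_def)
    have n: "(norm (x + r *\<^sub>R h))\<^sup>2 = (norm x)\<^sup>2 + 2 * r * (x \<bullet> h) + r\<^sup>2 * (norm h)\<^sup>2" for r
      by (simp only: power2_norm_eq_inner) (simp add: inner_add inner_commute power2_eq_square algebra_simps)
    have "s * \<Delta> \<le> (V (x + s *\<^sub>R h) - V x) + lam / 2 * (s\<^sup>2 - s) * (norm h)\<^sup>2"
      using 1 n[of s] n[of 1]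
      by (simp add: \<Delta>_def y algebra_simps power2_eq_square add_divide_distrib diff_divide_distrib)
    also have "\<dots> \<le> c + lam / 2 * s\<^sup>2 * (norm h)\<^sup>2"
      using osc[of "x + s *\<^sub>R h" x] lam s by (intro add_mono mult_right_mono mult_left_mono) auto
    finally have "s * \<Delta> \<le> c + lam / 2 * s\<^sup>2 * (norm h)\<^sup>2" .
    moreover have "s * \<Delta> = 2 * c" using D by (simp add: s_def)
    ultimately have "c \<le> lam / 2 * s\<^sup>2 * (norm h)\<^sup>2" by simp
    also have "\<dots> = c * (2 * lam * c * (norm h)\<^sup>2 / \<Delta>\<^sup>2)"
      by (simp add: s_def power2_eq_square)
    finally have "c * 1 \<le> c * (2 * lam * c * (norm h)\<^sup>2 / \<Delta>\<^sup>2)" by (simp only: mult_1_right)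
    then have "1 \<le> 2 * lam * c * (norm h)\<^sup>2 / \<Delta>\<^sup>2"
      using D by (subst (asm) mult_le_cancel_left_pos) auto
    then have "\<Delta>\<^sup>2 \<le> (lip_const * norm h)\<^sup>2"
      using D lam by (simp add: lip_const_def power_mult_distrib field_simps)
    then have "\<Delta> \<le> lip_const * norm h" by (rule power2_le_imp_le) (simp add: lip_const_nonneg)
    then show ?thesis by (simp add: \<Delta>_def h_def)
  qed
  show ?thesis using one[of x y] one[of y x] by (simp add: abs_le_iff norm_minus_commute)
qed

lemma f_log_lipschitz: "f y \<le> exp (lip_const * norm (y - x)) * f x"
  using V_lipschitz[of y x] by (simp add: f_def exp_add[symmetric] abs_le_iff)

lemma f_lipschitz: "\<bar>f y - f x\<bar> \<le> exp c * lip_const * norm (y - x)"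
proof -
  have one: "f y - f x \<le> exp c * lip_const * norm (y - x)" for x y
  proof -
    have "f y * (1 - exp (V y - V x)) \<le> f y * (V x - V y)"
    proof (rule mult_left_mono)
      show "1 - exp (V y - V x) \<le> V x - V y" using exp_ge_add_one_self[of "V y - V x"] by linarith
    qed (simp add: less_imp_le[OF f_pos])
    moreover have "f y * exp (V y - V x) = f x" by (simp add: f_def exp_add[symmetric])
    ultimately have "f y - f x \<le> f y * (V x - V y)" by (simp add: right_diff_distrib)
    also have "\<dots> \<le> f y * (lip_const * norm (y - x))"
      using V_lipschitz[of y x] f_pos[of y] by (intro mult_left_mono) auto
    also have "\<dots> \<le> exp c * (lip_const * norm (y - x))"
      using f_bounds lip_const_nonneg by (intro mult_right_mono) auto
    finally show ?thesis by simp
  qed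
  show ?thesis using one[of x y] one[of y x] by (simp add: abs_le_iff norm_minus_commute)
qed

section \<open>The semigroup applied to the density\<close>

lemma ou_f_bounds: "exp (- c) \<le> ou_op t f x" "ou_op t f x \<le> exp c"
  by (rule ou_op_bounds[where m="exp (- c)" and B="exp c"]; simp add: f_bounds)+

lemma ou_f_pos: "0 < ou_op t f x"
  using ou_f_bounds(1)[of t x] by (rule less_le_trans[rotated]) simp

lemma integrable_f_affine: "integrable std_gaussian (\<lambda>z. f (w + s *\<^sub>R z))"
  by (rule std_gaussian.integrable_const_bound[where B="exp c"])
    (use f_bounds f_pos in \<open>auto simp: less_imp_le\<close>)

text \<open>With the same noise \<open>z\<close>, the two arguments of \<open>f\<close> are only
  \<open>exp (- t) * norm (y - x)\<close> apart. This decay in \<open>t\<close> is what keeps the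
  total displacement of the transport bounded.\<close>

lemma ou_f_log_lipschitz: "ou_op t f y \<le> exp (exp (- t) * lip_const * norm (y - x)) * ou_op t f x"
proof -
  have "ou_op t f y \<le> (\<E> z. exp (exp (- t) * lip_const * norm (y - x)) * f (exp (- t) *\<^sub>R x + sqrt (1 - exp (- 2 * t)) *\<^sub>R z))"
    unfolding ou_op_def
  proof (intro integral_mono integrable_mult_right integrable_f_affine)
    fix z
    have "norm ((exp (- t) *\<^sub>R y + sqrt (1 - exp (- 2 * t)) *\<^sub>R z) - (exp (- t) *\<^sub>R x + sqrt (1 - exp (- 2 * t)) *\<^sub>R z)) = exp (- t) * norm (y - x)"
      by (simp flip: scaleR_diff_right)
    then show "f (exp (- t) *\<^sub>R y + sqrt (1 - exp (- 2 * t)) *\<^sub>R z) \<le>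
      exp (exp (- t) * lip_const * norm (y - x)) * f (exp (- t) *\<^sub>R x + sqrt (1 - exp (- 2 * t)) *\<^sub>R z)"
      using f_log_lipschitz[of "exp (- t) *\<^sub>R y + sqrt (1 - exp (- 2 * t)) *\<^sub>R z" "exp (- t) *\<^sub>R x + sqrt (1 - exp (- 2 * t)) *\<^sub>R z"]
      by (simp add: mult_ac)
  qed
  then show ?thesis by (simp add: ou_op_def)
qed

text \<open>Symmetrising in \<open>y\<close> and \<open>y'\<close> leaves only the hyperbolic cosine of a difference of increments of \<open>V\<close>,
  which the Lipschitz bound controls to second order.\<close>

lemma f_second_difference:
  "f (y + k) * f (y' - k) + f (y - k) * f (y' + k)
    \<le> 2 * exp ((lam + 4 * lam * c) * (norm k)\<^sup>2) * (f y * f y')"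
proof -
  define g where "g y = (V (y + k) - V (y - k)) / 2" for y
  have g: "\<bar>g y\<bar> \<le> lip_const * norm k" for y
  proof -
    have "norm ((y + k) - (y - k)) = norm (2 *\<^sub>R k)" by (simp add: scaleR_2)
    then show ?thesis using V_lipschitz[of "y + k" "y - k"] by (simp add: g_def)
  qed
  \<comment> \<open>\<open>V (y + k)\<close> and \<open>V (y - k)\<close> are their half sum plus
    and minus \<open>g y\<close>, and semiconvexity bounds the half sum from below.\<close>
  have fp: "f (y + k) \<le> f y * exp (lam * (norm k)\<^sup>2 / 2 - g y)" 
    and fm: "f (y - k) \<le> f y * exp (lam * (norm k)\<^sup>2 / 2 + g y)" for y
    using V_second_difference[of k y] by (auto simp: f_def g_def exp_add[symmetric] field_simps)
  define d where "d = g y - g y'"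
  have "\<bar>d\<bar> \<le> 2 * lip_const * norm k" using g[of y] g[of y'] by (simp add: d_def)
  then have "d\<^sup>2 \<le> (2 * lip_const * norm k)\<^sup>2" using power_mono[OF _ abs_ge_zero, of d _ 2] by simp
  \<comment> \<open>Half of this is the origin of \<open>4 * lam * c\<close> in
    \<open>\<theta>1\<close>.\<close>
  also have "\<dots> = 8 * lam * c * (norm k)\<^sup>2" using lam c0 by (simp add: lip_const_def power_mult_distrib)
  finally have d2: "d\<^sup>2 / 2 \<le> 4 * lam * c * (norm k)\<^sup>2" by simp
  have "f (y + k) * f (y' - k) + f (y - k) * f (y' + k)
     \<le> (f y * exp (lam * (norm k)\<^sup>2 / 2 - g y)) * (f y' * exp (lam * (norm k)\<^sup>2 / 2 + g y'))
      + (f y * exp (lam * (norm k)\<^sup>2 / 2 + g y)) * (f y' * exp (lam * (norm k)\<^sup>2 / 2 - g y'))"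
    by (intro add_mono mult_mono fp fm) (auto simp: less_imp_le[OF f_pos])
  also have "\<dots> = f y * f y' * exp (lam * (norm k)\<^sup>2) * (exp d + exp (- d))"
  proof -
    have e: "exp (r / 2 - g y) * exp (r / 2 + g y') = exp r * exp (- d)"
      "exp (r / 2 + g y) * exp (r / 2 - g y') = exp r * exp d" for r
      by (simp_all add: exp_add[symmetric] d_def)
    show ?thesis using e[of "lam * (norm k)\<^sup>2"] by (simp add: algebra_simps)
  qed
  also have "\<dots> \<le> f y * f y' * exp (lam * (norm k)\<^sup>2) * (2 * exp (4 * lam * c * (norm k)\<^sup>2))"
    using d2 exp_add_exp_minus_le[of d] f_pos[of y] f_pos[of y']
    by (intro mult_left_mono) (auto intro: order_trans)
  also have "\<dots> = 2 * exp ((lam + 4 * lam * c) * (norm k)\<^sup>2) * (f y * f y')"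
    by (simp add: exp_add distrib_right)
  finally show ?thesis .
qed

text \<open>Twice the product of the two averages is a double average over independent
  \<open>z\<close> and \<open>z'\<close> of an expression symmetric in the signs of the shift, to
  which \<open>f_second_difference\<close> applies pointwise. The shift is
  \<open>exp (- t) *\<^sub>R u\<close>, whence the factor \<open>exp (- 2 * t)\<close>.\<close>

lemma ou_f_second_difference:
  "ou_op t f (x + u) * ou_op t f (x - u)
    \<le> exp (exp (- 2 * t) * (lam + 4 * lam * c) * (norm u)\<^sup>2) * (ou_op t f x)\<^sup>2"
proof -
  define k where "k = exp (- t) *\<^sub>R u"
  define y where "y z = exp (- t) *\<^sub>R x + sqrt (1 - exp (- 2 * t)) *\<^sub>R z" for z :: 'a
  define E where "E = 2 * exp ((lam + 4 * lam * c) * (norm k)\<^sup>2)"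
  have [measurable]: "y \<in> borel_measurable borel" unfolding y_def[abs_def] by measurable
  have i: "integrable std_gaussian (\<lambda>z. f (y z + w))" for w
    using integrable_f_affine[of "exp (- t) *\<^sub>R x + w" "sqrt (1 - exp (- 2 * t))"] by (simp add: y_def ac_simps)
  have i': "integrable std_gaussian (\<lambda>z. f (y z))" "integrable std_gaussian (\<lambda>z. f (y z - k))"
    using i[of 0] i[of "- k"] by auto
  define P where "P w = (\<E> z. f (y z + w))" for w
  have P: "ou_op t f x = P 0" "ou_op t f (x + u) = P k" "ou_op t f (x - u) = P (- k)"
    by (simp_all add: ou_op_def P_def y_def k_def scaleR_add_right scaleR_diff_right algebra_simps)
  have in1: "f (y z + k) * P (- k) + f (y z - k) * P k \<le> E * (f (y z) * P 0)" for z
  proof -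
    have "f (y z + k) * P (- k) + f (y z - k) * P k
      = (\<E> z'. f (y z + k) * f (y z' - k) + f (y z - k) * f (y z' + k))"
      using i[of k] i' by (simp add: P_def)
    also have "\<dots> \<le> (\<E> z'. E * (f (y z) * f (y z')))"
      unfolding E_def using i[of k] i' f_second_difference by (intro integral_mono) auto
    also have "\<dots> = E * (f (y z) * P 0)" by (simp add: P_def)
    finally show ?thesis .
  qed
  have "2 * (P k * P (- k)) = (\<E> z. f (y z + k) * P (- k) + f (y z - k) * P k)"
    using i[of k] i' by (simp add: P_def)
  also have "\<dots> \<le> (\<E> z. E * (f (y z) * P 0))"
    using i[of k] i' in1 by (intro integral_mono) auto
  also have "\<dots> = E * (P 0)\<^sup>2" by (simp add: P_def power2_eq_square)
  finally have "P k * P (- k) \<le> exp ((lam + 4 * lam * c) * (norm k)\<^sup>2) * (P 0)\<^sup>2" by (simp add: E_def)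
  moreover have "(lam + 4 * lam * c) * (norm k)\<^sup>2 = exp (- 2 * t) * (lam + 4 * lam * c) * (norm u)\<^sup>2"
    by (simp add: k_def power_mult_distrib exp_double[symmetric] mult_ac)
  ultimately show ?thesis by (simp only: P)
qed

section \<open>Two bounds on the log-Hessian, and the limits of small and large time\<close>

definition \<theta>1 :: "real \<Rightarrow> real" where "\<theta>1 t = exp (- 2 * t) * (lam + 4 * lam * c)"

definition \<theta>2 :: "real \<Rightarrow> real" where "\<theta>2 t = (exp c - 1) * (exp (- 2 * t) / (1 - exp (- 2 * t)))"

lemma velocity_deriv_le1:
  assumes t: "0 < t"
  shows "ou_velocity_deriv t f x u \<bullet> u \<le> \<theta>1 t * (norm u)\<^sup>2"
proof -
  obtain L M C where q: "has_quadratic_remainder (ou_op t f) (ou_grad t f) L M"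
    and v: "smooth_velocity (ou_velocity t f) (ou_velocity_deriv t f) C"
    using ou_regularity[of f "exp (- c)" "exp c" t] t f_bounds by auto
  show ?thesis
    unfolding \<theta>1_def
    by (rule ln_second_difference_imp_hessian_le[OF q ou_f_pos])
      (use v ou_f_second_difference in \<open>auto simp: ou_velocity_def[abs_def]\<close>)
qed

lemma velocity_deriv_le2:
  assumes t: "0 < t"
  shows "ou_velocity_deriv t f x u \<bullet> u \<le> \<theta>2 t * (norm u)\<^sup>2"
proof -
  let ?p = "ou_op t f x" and ?F = "ou_dilate t f" and ?\<rho> = "ou_ratio t"
  have Fm [measurable]: "?F \<in> borel_measurable borel" by measurable
  have F0: "0 \<le> ?F w" and FB: "?F w \<le> exp c" for w
    using f_pos f_bounds by (auto simp: ou_dilate_def less_imp_le)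
  have Fabs: "\<bar>?F w\<bar> \<le> exp c" for w using F0 FB by simp
  have p: "0 < ?p" by (rule ou_f_pos)
  have pF: "?p = gsmooth ?F (?\<rho> *\<^sub>R x)" by (rule ou_op_eq_gsmooth[OF t])
  have iF: "integrable std_gaussian (\<lambda>z. ?F (?\<rho> *\<^sub>R x + z))"
    by (rule std_gaussian.integrable_const_bound[where B="exp c"]) (use Fabs in auto)
  \<comment> \<open>By bounded oscillation \<open>f\<close> exceeds any average of itself at most by
    the factor \<open>exp c\<close>.\<close>
  have Fp: "?F w \<le> exp c * ?p" for w
  proof -
    have "integral\<^sup>L (std_gaussian :: 'a measure) (\<lambda>_. ?F w) \<le> (\<E> z. exp c * ?F (?\<rho> *\<^sub>R x + z))"
      using iF f_ratio by (intro integral_mono) (auto simp: ou_dilate_def)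
    then show ?thesis by (simp add: pF gsmooth_def)
  qed
  have iq: "integrable std_gaussian (\<lambda>z. (z \<bullet> u) * (z \<bullet> u))"
  proof (rule integral_dominated_gauss(1)[where c="(norm u)\<^sup>2"])
    fix z :: 'a
    have "\<bar>z \<bullet> u\<bar> * \<bar>z \<bullet> u\<bar> \<le> (norm z * norm u) * (norm z * norm u)"
      by (intro mult_mono Cauchy_Schwarz_ineq2) auto
    also have "\<dots> = (norm u)\<^sup>2 * (norm z)\<^sup>2" by (simp add: power2_eq_square)
    also have "\<dots> \<le> (norm u)\<^sup>2 * gauss_dom z" by (intro mult_left_mono gauss_dom_bounds) auto
    finally show "norm ((z \<bullet> u) * (z \<bullet> u)) \<le> (norm u)\<^sup>2 * gauss_dom z" by (simp add: abs_mult)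
  qed simp
  have iFq: "integrable std_gaussian (\<lambda>z. ?F (?\<rho> *\<^sub>R x + z) * ((z \<bullet> u) * (z \<bullet> u)))"
    by (rule Bochner_Integration.integrable_bound[OF integrable_mult_right[OF iq, of "exp c"]])
      (use Fabs in \<open>auto simp: abs_mult intro!: mult_right_mono\<close>)
  have "gsmooth_hess ?F (?\<rho> *\<^sub>R x) u \<bullet> u = (\<E> z. ?F (?\<rho> *\<^sub>R x + z) * ((z \<bullet> u) * (z \<bullet> u)) - ?F (?\<rho> *\<^sub>R x + z) * (u \<bullet> u))"
    unfolding gsmooth_hess_inner[OF Fm Fabs] by (simp add: right_diff_distrib)
  also have "\<dots> = (\<E> z. ?F (?\<rho> *\<^sub>R x + z) * ((z \<bullet> u) * (z \<bullet> u))) - ?p * (u \<bullet> u)"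
    using iF iFq by (simp add: pF gsmooth_def)
  also have "(\<E> z. ?F (?\<rho> *\<^sub>R x + z) * ((z \<bullet> u) * (z \<bullet> u)))
    \<le> (\<E> z. (exp c * ?p) * ((z \<bullet> u) * (z \<bullet> u)))"
    using iFq iq Fp by (intro integral_mono integrable_mult_right mult_right_mono) auto
  also have "\<dots> = (exp c * ?p) * (u \<bullet> u)"
    by (simp only: integral_mult_right_zero std_gaussian_second_moment)
  finally have H: "gsmooth_hess ?F (?\<rho> *\<^sub>R x) u \<bullet> u \<le> (exp c - 1) * ?p * (u \<bullet> u)" by (simp add: algebra_simps)
  have \<rho>2: "?\<rho>\<^sup>2 = exp (- 2 * t) / (1 - exp (- 2 * t))"
    using t by (simp add: ou_ratio_def power_divide exp_double[symmetric])
  have "ou_velocity_deriv t f x u \<bullet> u = (1 / ?p) * (?\<rho>\<^sup>2 * (gsmooth_hess ?F (?\<rho> *\<^sub>R x) u \<bullet> u)) - (1 / ?p)\<^sup>2 * (ou_grad t f x \<bullet> u)\<^sup>2"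
    by (simp add: ou_velocity_deriv_def ou_hess_def ou_velocity_def inner_diff_left right_diff_distrib power2_eq_square)
  \<comment> \<open>The rank-one part of the Hessian of a logarithm is a negative square and is
    dropped.\<close>
  also have "\<dots> \<le> (1 / ?p) * (?\<rho>\<^sup>2 * (gsmooth_hess ?F (?\<rho> *\<^sub>R x) u \<bullet> u))" by simp
  also have "\<dots> \<le> (1 / ?p) * (?\<rho>\<^sup>2 * ((exp c - 1) * ?p * (u \<bullet> u)))"
    using H p by (intro mult_left_mono) auto
  also have "\<dots> = \<theta>2 t * (norm u)\<^sup>2"
    using p by (simp add: \<theta>2_def \<rho>2 power2_norm_eq_inner)
  finally show ?thesis .
qed

lemma norm_velocity_le:
  assumes t: "0 < t"
  shows "norm (ou_velocity t f x) \<le> exp (- t) * lip_const"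
proof -
  obtain L M C where q: "has_quadratic_remainder (ou_op t f) (ou_grad t f) L M"
    using ou_regularity[of f "exp (- c)" "exp c" t] t f_bounds by auto
  show ?thesis unfolding ou_velocity_def
    by (rule norm_log_gradient_le[OF q ou_f_pos]) (use lip_const_nonneg ou_f_log_lipschitz in auto)
qed

lemma ou_f_close_f:
  assumes t: "0 < t"
  shows "\<bar>ou_op t f x - f x\<bar> \<le> exp c * lip_const * sqrt (1 - exp (- 2 * t)) * (gauss_dom x + gauss_dom_int TYPE('a))"
proof (rule abs_ou_op_diff_le[OF f_measurable f_lipschitz _ _ t])
  show "\<bar>f x\<bar> \<le> exp c" for x using f_bounds(2)[of x] f_pos[of x] by simp
  show "0 \<le> exp c * lip_const" using lip_const_nonneg by simp
qed

text \<open>Since \<open>f\<close> has mean one, compare both averages under the same noise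
  \<open>z\<close>: the arguments of \<open>f\<close> differ by an amount proportional to
  \<open>exp (- t)\<close>.\<close>

lemma ou_f_close_one:
  assumes t: "0 < t"
  shows "\<bar>ou_op t f x - 1\<bar> \<le> exp c * lip_const * exp (- t) * (gauss_dom x + gauss_dom_int TYPE('a))"
proof -
  define a where "a = exp (- t)"
  define b where "b = sqrt (1 - exp (- 2 * t))"
  let ?K = "exp c * lip_const"
  have K: "0 \<le> ?K" using lip_const_nonneg by simp
  note ab = ou_coefficients[OF t, folded a_def b_def]
  have "b\<^sup>2 + a\<^sup>2 = 1" using ab(5) by simp
  \<comment> \<open>The roles of \<open>a\<close> and \<open>b\<close> are exchanged: here it is the
    coefficient of the noise that is close to 1.\<close>
  note ab_facts = norm_affine_diff_le[OF less_imp_le[OF ab(3)] ab(4,1) this]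
  have "ou_op t f x - 1 = (\<E> z. f (a *\<^sub>R x + b *\<^sub>R z) - f z)"
    using integrable_f_affine[of "a *\<^sub>R x" b] integrable_f by (simp add: ou_op_def a_def b_def integral_f)
  also have "\<bar>\<dots>\<bar> \<le> (?K * a) * gauss_dom_int TYPE('a) + ?K * a * gauss_dom x"
  proof (rule abs_integral_bound_gauss)
    fix z
    have "\<bar>f (a *\<^sub>R x + b *\<^sub>R z) - f z\<bar> \<le> ?K * norm (a *\<^sub>R x + b *\<^sub>R z - z)" by (rule f_lipschitz)
    also have "a *\<^sub>R x + b *\<^sub>R z - z = b *\<^sub>R z + a *\<^sub>R x - z" by simp
    also have "?K * norm \<dots> \<le> ?K * (a * (norm z + norm x))" using K by (intro mult_left_mono ab_facts(1))
    also have "\<dots> \<le> ?K * (a * (gauss_dom z + gauss_dom x))" using ab(1) K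
      by (intro mult_left_mono add_mono gauss_dom_bounds) auto
    finally show "\<bar>f (a *\<^sub>R x + b *\<^sub>R z) - f z\<bar> \<le> (?K * a) * gauss_dom z + ?K * a * gauss_dom x" by (simp add: algebra_simps)
  qed simp
  finally show ?thesis by (simp add: algebra_simps a_def)
qed

section \<open>Integrated rates and the final constant\<close>

lemma \<theta>1_nonneg: "0 \<le> \<theta>1 t"
  unfolding \<theta>1_def using lam c0 by simp

lemma \<theta>1_antimono: "s \<le> t \<Longrightarrow> \<theta>1 t \<le> \<theta>1 s"
  unfolding \<theta>1_def using lam c0 by (intro mult_right_mono) auto

lemma \<theta>2_nonneg: "0 < t \<Longrightarrow> 0 \<le> \<theta>2 t"
  unfolding \<theta>2_def using c0 by (intro mult_nonneg_nonneg divide_nonneg_pos) auto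

text \<open>\<open>\<Theta>1\<close> and \<open>\<Theta>2\<close> are antiderivatives of \<open>\<theta>1\<close> and \<open>\<theta>2\<close>.\<close>

definition \<Theta>1 :: "real \<Rightarrow> real" where "\<Theta>1 t = - (exp (- 2 * t) * (lam + 4 * lam * c)) / 2"

definition \<Theta>2 :: "real \<Rightarrow> real" where "\<Theta>2 t = (exp c - 1) / 2 * ln (1 - exp (- 2 * t))"

lemma \<Theta>1_diff: "(s - r) * \<theta>1 s \<le> \<Theta>1 s - \<Theta>1 r"
proof -
  have "(2 * (s - r) * exp (- 2 * s)) * ((lam + 4 * lam * c) / 2)
      \<le> (exp (- 2 * r) - exp (- 2 * s)) * ((lam + 4 * lam * c) / 2)"
    using lam c0 by (intro mult_right_mono exp_minus_diff_ge) auto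
  then show ?thesis by (simp add: \<theta>1_def \<Theta>1_def field_simps)
qed

text \<open>The right-endpoint value of a decreasing rate is below its integral; here this amounts
  to \<open>ln x \<le> x - 1\<close> at \<open>x = B / A\<close>.\<close>

lemma \<Theta>2_diff:
  assumes "0 < r" "r \<le> s"
  shows "(s - r) * \<theta>2 s \<le> \<Theta>2 s - \<Theta>2 r"
proof -
  define A where "A = 1 - exp (- 2 * s)"
  define B where "B = 1 - exp (- 2 * r)"
  have AB: "0 < A" "0 < B" using assms by (auto simp: A_def B_def)
  have "2 * (s - r) * exp (- 2 * s) \<le> A - B"
    using exp_minus_diff_ge[of s r] by (simp add: A_def B_def)
  then have "2 * (s - r) * exp (- 2 * s) / A \<le> (A - B) / A" using AB by (intro divide_right_mono) auto
  also have "\<dots> = 1 - B / A" using AB by (simp add: diff_divide_distrib)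
  also have "\<dots> \<le> - ln (B / A)" using ln_le_minus_one[of "B / A"] AB by simp
  also have "\<dots> = ln A - ln B" using AB by (simp add: ln_div)
  finally have "(exp c - 1) / 2 * (2 * (s - r) * exp (- 2 * s) / A) \<le> (exp c - 1) / 2 * (ln A - ln B)"
    using c0 by (intro mult_left_mono) auto
  moreover have "(s - r) * \<theta>2 s = (exp c - 1) / 2 * (2 * (s - r) * exp (- 2 * s) / A)"
    unfolding \<theta>2_def A_def[symmetric] using AB by (simp add: field_simps)
  moreover have "\<Theta>2 s - \<Theta>2 r = (exp c - 1) / 2 * (ln A - ln B)"
    by (simp add: \<Theta>2_def A_def B_def right_diff_distrib)
  ultimately show ?thesis by (simp only:)
qed

definition switch_time :: real where "switch_time = - ln (1 - 1 / (2 * lam)) / 2"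

lemma switch_time: "0 < switch_time" "1 - exp (- 2 * switch_time) = 1 / (2 * lam)"
proof -
  have "1 / (2 * lam) \<le> 1 / 2" using lam by (simp add: field_simps)
  then have l: "0 < 1 - 1 / (2 * lam)" "1 - 1 / (2 * lam) < 1" using lam by auto
  then show "0 < switch_time" by (simp add: switch_time_def)
  show "1 - exp (- 2 * switch_time) = 1 / (2 * lam)" using l by (simp add: switch_time_def)
qed

text \<open>An antiderivative of the rate that switches from \<open>\<theta>1\<close> to
  \<open>\<theta>2\<close> at \<open>switch_time\<close>: clamping keeps each summand constant
  outside its own range.\<close>

definition \<Theta> :: "real \<Rightarrow> real" where
  "\<Theta> t = \<Theta>1 (min t switch_time) + \<Theta>2 (max t switch_time)"

text \<open>Split the interval from \<open>t - h\<close> to \<open>t\<close> at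
  \<open>switch_time\<close>. The minimum of the rates at the right endpoint is below the active
  rate on either piece, so summing over steps loses nothing against the exact integral.\<close>

lemma \<Theta>_diff:
  assumes "0 \<le> h" "0 < t"
  shows "h * min (\<theta>1 t) (\<theta>2 t) \<le> \<Theta> t - \<Theta> (t - h)"
proof -
  let ?m = "min (\<theta>1 t) (\<theta>2 t)" and ?s = switch_time
  have "(min t ?s - min (t - h) ?s) * ?m \<le> (min t ?s - min (t - h) ?s) * \<theta>1 (min t ?s)"
    using assms \<theta>1_antimono[of "min t ?s" t] by (intro mult_left_mono) auto
  also have "\<dots> \<le> \<Theta>1 (min t ?s) - \<Theta>1 (min (t - h) ?s)" by (rule \<Theta>1_diff)
  finally have 1: "(min t ?s - min (t - h) ?s) * ?m \<le> \<Theta>1 (min t ?s) - \<Theta>1 (min (t - h) ?s)" .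
  have 2: "(max t ?s - max (t - h) ?s) * ?m \<le> \<Theta>2 (max t ?s) - \<Theta>2 (max (t - h) ?s)"
  proof (cases "t \<le> ?s")
    case True
    then show ?thesis using assms by (simp add: max_def)
  next
    case False
    then have "(max t ?s - max (t - h) ?s) * ?m \<le> (max t ?s - max (t - h) ?s) * \<theta>2 (max t ?s)"
      using assms by (intro mult_left_mono) auto
    also have "\<dots> \<le> \<Theta>2 (max t ?s) - \<Theta>2 (max (t - h) ?s)"
      using assms switch_time(1) by (intro \<Theta>2_diff) auto
    finally show ?thesis .
  qed
  have "h = (min t ?s - min (t - h) ?s) + (max t ?s - max (t - h) ?s)" by (simp add: min_def max_def)
  then have "h * ?m = (min t ?s - min (t - h) ?s) * ?m + (max t ?s - max (t - h) ?s) * ?m"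
    by (metis distrib_right)
  then show ?thesis using 1 2 by (simp add: \<Theta>_def)
qed

definition transport_lip :: real where "transport_lip = 2 * (2 * lam) powr exp c"

lemma exp_\<Theta>_diff_le:
  assumes "0 \<le> r" "0 < t"
  shows "exp (\<Theta> t - \<Theta> r) \<le> transport_lip"
proof -
  let ?s = switch_time
  have l2: "ln 2 \<le> ln (2 * lam)" using lam by simp
  have "\<Theta>1 (min t ?s) \<le> - ((1 - 1 / (2 * lam)) * (lam + 4 * lam * c)) / 2"
  proof -
    have "1 - 1 / (2 * lam) = exp (- 2 * ?s)" using switch_time(2) by linarith
    also have "\<dots> \<le> exp (- 2 * min t ?s)" by simp
    finally have "(1 - 1 / (2 * lam)) * (lam + 4 * lam * c) \<le> exp (- 2 * min t ?s) * (lam + 4 * lam * c)"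
      using lam c0 by (intro mult_right_mono) auto
    then show ?thesis by (simp add: \<Theta>1_def)
  qed
  moreover have "- ((1 - 1 / (2 * lam)) * (lam + 4 * lam * c)) / 2 = (1 + 4 * c) / 4 - (lam + 4 * lam * c) / 2"
    using lam by (simp add: field_simps)
  moreover have "- ((lam + 4 * lam * c) / 2) \<le> \<Theta>1 (min r ?s)"
  proof -
    have "exp (- 2 * min r ?s) * (lam + 4 * lam * c) \<le> 1 * (lam + 4 * lam * c)"
      using assms switch_time(1) lam c0 by (intro mult_right_mono) auto
    then show ?thesis by (simp add: \<Theta>1_def)
  qed
  moreover have "\<Theta>2 (max t ?s) \<le> 0"
    unfolding \<Theta>2_def using c0 switch_time(1) by (intro mult_nonneg_nonpos) auto
  moreover have "- ((exp c - 1) / 2 * ln (2 * lam)) \<le> \<Theta>2 (max r ?s)"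
  proof -
    have "ln (1 - exp (- 2 * ?s)) \<le> ln (1 - exp (- 2 * max r ?s))"
      using switch_time(1) by (subst ln_le_cancel_iff) auto
    moreover have "ln (1 - exp (- 2 * ?s)) = - ln (2 * lam)"
      unfolding switch_time(2) using lam by (simp add: ln_div)
    ultimately have "(exp c - 1) / 2 * (- ln (2 * lam)) \<le> (exp c - 1) / 2 * ln (1 - exp (- 2 * max r ?s))"
      using c0 by (intro mult_left_mono) auto
    then show ?thesis by (simp add: \<Theta>2_def)
  qed
  ultimately have "\<Theta> t - \<Theta> r \<le> (1 + 4 * c) / 4 + (exp c - 1) / 2 * ln (2 * lam)"
    by (simp add: \<Theta>_def)
  also have "\<dots> \<le> ln 2 + exp c * ln (2 * lam)"
  proof -
    have ln23: "2/3 \<le> ln (2::real)"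
      using ln2_ge_two_thirds by simp
    have e: "1 + c + c\<^sup>2 / 2 \<le> exp c" using exp_lower_Taylor_quadratic[OF c0] .
    \<comment> \<open>Once the share of \<open>\<theta>2\<close> is subtracted, the target still
      contains \<open>(exp c + 1) / 2\<close> times \<open>ln (2 * lam)\<close>. With
      \<open>ln 2 \<ge> 2/3\<close> and the quadratic lower bound for \<open>exp c\<close>, the two
      sides differ by (c - 2)^2 / 6 + 5/12.\<close>
    have "(1 + 4 * c) / 4 \<le> 2/3 + (2 + c + c\<^sup>2 / 2) / 2 * (2/3)"
      using zero_le_power2[of "c - 2"] zero_le_power2[of c] by (simp add: power2_eq_square field_simps)
    also have "\<dots> \<le> ln 2 + (exp c + 1) / 2 * ln (2 * lam)"
      using ln23 l2 e c0 by (intro add_mono mult_mono) auto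
    finally show ?thesis by (simp add: field_simps)
  qed
  also have "\<dots> = ln transport_lip"
    using lam by (simp add: transport_lip_def ln_mult ln_powr)
  finally have "exp (\<Theta> t - \<Theta> r) \<le> exp (ln transport_lip)" by simp
  then show ?thesis using lam by (simp add: transport_lip_def)
qed

text \<open>The exponents telescope. The first interval charged starts at
  \<open>\<delta> - h\<close>, which is nonnegative for \<open>h \<le> \<delta>\<close>, as
  \<open>exp_\<Theta>_diff_le\<close> will require.\<close>

lemma euler_map_lipschitz:
  assumes v: "\<And>t. \<delta> \<le> t \<Longrightarrow> smooth_velocity (ou_velocity t f) (ou_velocity_deriv t f) C"
    and h: "0 < h" "h \<le> \<delta>" "h * C \<le> 1"
  shows "norm (euler_map f \<delta> h k y - euler_map f \<delta> h k x)
    \<le> exp (\<Theta> (\<delta> + k * h - h) - \<Theta> (\<delta> - h)) * norm (y - x)"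
proof (induction k arbitrary: x y)
  case (Suc k)
  define t where "t = \<delta> + k * h"
  have t: "\<delta> \<le> t" "0 < t" using h by (auto simp: t_def add_pos_nonneg)
  let ?S = "\<lambda>x. x + h *\<^sub>R ou_velocity t f x"
  have "norm (?S y - ?S x) \<le> (1 + h * min (\<theta>1 t) (\<theta>2 t)) * norm (y - x)"
  proof (rule euler_step_lipschitz[OF v[OF t(1)]])
    show "0 \<le> min (\<theta>1 t) (\<theta>2 t)" using \<theta>1_nonneg \<theta>2_nonneg t by simp
    show "ou_velocity_deriv t f x u \<bullet> u \<le> min (\<theta>1 t) (\<theta>2 t) * (norm u)\<^sup>2" for x u
      using velocity_deriv_le1[OF t(2), of x u] velocity_deriv_le2[OF t(2), of x u] by (simp add: min_def)
  qed (use h in auto)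
  also have "\<dots> \<le> exp (\<Theta> t - \<Theta> (t - h)) * norm (y - x)"
  proof (rule mult_right_mono)
    have "1 + h * min (\<theta>1 t) (\<theta>2 t) \<le> exp (h * min (\<theta>1 t) (\<theta>2 t))" by (rule exp_ge_add_one_self)
    also have "\<dots> \<le> exp (\<Theta> t - \<Theta> (t - h))" using \<Theta>_diff[of h t] h t by simp
    finally show "1 + h * min (\<theta>1 t) (\<theta>2 t) \<le> exp (\<Theta> t - \<Theta> (t - h))" .
  qed simp
  finally have 1: "norm (?S y - ?S x) \<le> exp (\<Theta> t - \<Theta> (t - h)) * norm (y - x)" .
  have "norm (euler_map f \<delta> h (Suc k) y - euler_map f \<delta> h (Suc k) x)
    \<le> exp (\<Theta> (t - h) - \<Theta> (\<delta> - h)) * norm (?S y - ?S x)"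
    using Suc.IH[of "?S y" "?S x"] by (simp add: t_def)
  also have "\<dots> \<le> exp (\<Theta> (t - h) - \<Theta> (\<delta> - h)) * (exp (\<Theta> t - \<Theta> (t - h)) * norm (y - x))"
    using 1 by (intro mult_left_mono) auto
  also have "\<dots> = exp (\<Theta> t - \<Theta> (\<delta> - h)) * norm (y - x)" by (simp add: exp_add[symmetric] mult.assoc[symmetric])
  finally show ?case by (simp add: t_def algebra_simps)
qed simp

text \<open>The step at time \<open>t\<close> has length at most
  \<open>h * exp (- t) * lip_const\<close>, which is below the integral of the speed bound from
  \<open>t - h\<close> to \<open>t\<close>; these integrals telescope. The result is uniform in the
  number of steps.\<close>

lemma euler_map_displacement:
  assumes h: "0 < h" "h \<le> \<delta>"
  shows "norm (euler_map f \<delta> h k x - x) \<le> lip_const * (exp (- (\<delta> - h)) - exp (- (\<delta> + k * h - h)))"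
proof (induction k arbitrary: x)
  case (Suc k)
  define t where "t = \<delta> + k * h"
  have t: "0 < t" using h by (auto simp: t_def add_pos_nonneg)
  let ?y = "x + h *\<^sub>R ou_velocity t f x"
  have "norm (?y - x) \<le> h * (exp (- t) * lip_const)" using norm_velocity_le[OF t, of x] h by simp
  also have "\<dots> \<le> lip_const * (exp (- (t - h)) - exp (- t))"
  proof -
    have "h * exp (- t) \<le> (exp h - 1) * exp (- t)" 
    proof (rule mult_right_mono)
      show "h \<le> exp h - 1" using exp_ge_add_one_self[of h] by linarith
    qed simp
    also have "\<dots> = exp (- (t - h)) - exp (- t)" by (simp add: left_diff_distrib exp_add[symmetric])
    finally have "h * exp (- t) \<le> exp (- (t - h)) - exp (- t)" .
    from mult_left_mono[OF this lip_const_nonneg] show ?thesis by (simp add: mult_ac)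
  qed
  finally have "norm (?y - x) \<le> lip_const * (exp (- (t - h)) - exp (- t))" .
  moreover have "norm (euler_map f \<delta> h (Suc k) x - x) \<le> norm (euler_map f \<delta> h k ?y - ?y) + norm (?y - x)"
    using norm_triangle_ineq[of "euler_map f \<delta> h k ?y - ?y" "?y - x"] by (simp add: t_def)
  ultimately have "norm (euler_map f \<delta> h (Suc k) x - x)
    \<le> lip_const * (exp (- (\<delta> - h)) - exp (- (t - h))) + lip_const * (exp (- (t - h)) - exp (- t))"
    using Suc.IH[of ?y] by (simp add: t_def)
  also have "\<dots> = lip_const * (exp (- (\<delta> - h)) - exp (- t))" by (simp add: algebra_simps)
  finally show ?case by (simp add: t_def algebra_simps)
qed simp

text \<open>Two inductions run together. The composition of \<phi> with the first \<open>k\<close>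
  maps is again an admissible test function, its constants growing by at most
  \<open>exp (3 * C * h)\<close> per step; \<open>euler_step_estimate\<close> applied to it at time
  \<open>\<delta> + k * h\<close> supplies the next error, while the semigroup law advances the
  density by \<open>h\<close>.\<close>

lemma euler_map_test_function:
  assumes q: "\<And>t. \<delta> \<le> t \<Longrightarrow> has_quadratic_remainder (ou_op t f) (ou_grad t f) L' M'"
    and v: "\<And>t. \<delta> \<le> t \<Longrightarrow> smooth_velocity (ou_velocity t f) (ou_velocity_deriv t f) C"
    and h: "0 < h" "h \<le> 1" "h * C \<le> 1" and \<delta>: "0 < \<delta>"
    and \<phi>: "has_quadratic_remainder \<phi> g L M" and \<phi>1: "\<And>x. \<bar>\<phi> x\<bar> \<le> 1"
  defines "St \<equiv> step_const (gauss_dom_int TYPE('a)) (exp (- c)) (exp c) L' M'"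
  shows "(\<exists>g' L1 M1. has_quadratic_remainder (\<lambda>x. \<phi> (euler_map f \<delta> h k x)) g' L1 M1 \<and>
      L1 + M1 \<le> (L + M) * exp (3 * C * h) ^ k) \<and>
    \<bar>(\<E> x. \<phi> (euler_map f \<delta> h k x) * ou_op (\<delta> + k * h) f x) - (\<E> x. \<phi> x * ou_op \<delta> f x)\<bar>
      \<le> k * (St * ((L + M) * exp (3 * C * h) ^ k) * (h * sqrt h))"
proof (induction k)
  case 0
  show ?case using \<phi> by auto
next
  case (Suc k)
  define t where "t = \<delta> + k * h"
  have t: "\<delta> \<le> t" "0 < t" using h \<delta> by (auto simp: t_def add_pos_nonneg)
  let ?S = "\<lambda>x. x + h *\<^sub>R ou_velocity t f x"
  let ?T = "euler_map f \<delta> h k" and ?e = "exp (3 * C * h)"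
  have C0: "0 \<le> C" using smooth_velocityD(5)[OF v[OF t(1)]] .
  have St0: "0 \<le> St"
    unfolding St_def step_const_def using gauss_dom_int_ge1[where 'a='a] has_quadratic_remainderD(3,4)[OF q[OF t(1)]]
    by (intro add_nonneg_nonneg mult_nonneg_nonneg divide_nonneg_nonneg) auto
  obtain g' L1 M1 where T: "has_quadratic_remainder (\<lambda>x. \<phi> (?T x)) g' L1 M1" and LM: "L1 + M1 \<le> (L + M) * ?e ^ k"
    and est: "\<bar>(\<E> x. \<phi> (?T x) * ou_op t f x) - (\<E> x. \<phi> x * ou_op \<delta> f x)\<bar>
      \<le> k * (St * ((L + M) * ?e ^ k) * (h * sqrt h))"
    using Suc.IH by (auto simp: t_def)
  have LM1: "0 \<le> L1" "0 \<le> M1" using has_quadratic_remainderD(3,4)[OF T] by auto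
  have LM0: "0 \<le> L + M" using has_quadratic_remainderD(3,4)[OF \<phi>] by simp
  have e1: "1 \<le> ?e" using C0 h by simp
  have E: "has_quadratic_remainder (\<lambda>x. \<phi> (euler_map f \<delta> h (Suc k) x))
      (\<lambda>x. g' (?S x) + h *\<^sub>R ou_velocity_deriv t f x (g' (?S x))) (L1 * (1 + h * C)) (M1 * (1 + h * C)\<^sup>2 + L1 * (h * C))"
    using has_quadratic_remainder_euler_step[OF T v[OF t(1)] less_imp_le[OF h(1)] h(3)] by (simp add: t_def)
  \<comment> \<open>Altogether \<open>L1\<close> is multiplied by \<open>1 + 2 * (h * C)\<close> and
    \<open>M1\<close> by \<open>(1 + h * C)\<^sup>2\<close>; both are at most the cube.\<close>
  have "L1 * (1 + h * C) + (M1 * (1 + h * C)\<^sup>2 + L1 * (h * C)) \<le> (L1 + M1) * (1 + h * C) ^ 3"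
  proof -
    have hC: "0 \<le> h * C" using h C0 by simp
    have "1 + 2 * (h * C) \<le> (1 + h * C)\<^sup>2"
      using zero_le_power2[of "h * C"] by (simp add: power2_eq_square algebra_simps)
    also have s: "(1 + h * C)\<^sup>2 \<le> (1 + h * C)^3" using hC by (intro power_increasing) auto
    finally have "L1 * (1 + 2 * (h * C)) + M1 * (1 + h * C)\<^sup>2 \<le> L1 * (1 + h * C)^3 + M1 * (1 + h * C)^3"
      using LM1 s by (intro add_mono mult_left_mono)
    then show ?thesis by (simp add: algebra_simps)
  qed
  also have "\<dots> \<le> (L1 + M1) * ?e"
  proof (rule mult_left_mono)
    have "(1 + h * C)^3 \<le> exp (h * C)^3" using h C0 by (intro power_mono) auto
    also have "\<dots> = ?e" by (simp add: exp_of_nat_mult[symmetric] mult_ac)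
    finally show "(1 + h * C)^3 \<le> ?e" .
  qed (use LM1 in simp)
  also have "\<dots> \<le> ((L + M) * ?e ^ k) * ?e" using LM by (intro mult_right_mono) auto
  finally have LM2: "L1 * (1 + h * C) + (M1 * (1 + h * C)\<^sup>2 + L1 * (h * C)) \<le> (L + M) * ?e ^ Suc k"
    by (simp add: mult_ac)
  have "\<bar>(\<E> x. \<phi> (?T (x + h *\<^sub>R ((1 / ou_op t f x) *\<^sub>R ou_grad t f x))) * ou_op h (ou_op t f) x)
     - (\<E> x. \<phi> (?T x) * ou_op t f x)\<bar> \<le> St * (L1 + M1) * (h * sqrt h)"
    unfolding St_def
    by (rule euler_step_estimate[OF T q[OF t(1)]]) (use \<phi>1 ou_f_bounds h in auto)
  moreover have "ou_op h (ou_op t f) = ou_op (\<delta> + Suc k * h) f"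
  proof -
    have "\<bar>f w\<bar> \<le> exp c" for w using f_pos[of w] f_bounds(2)[of w] by simp
    then have "ou_op h (ou_op t f) = ou_op (t + h) f" by (intro ou_op_semigroup) (use t h in auto)
    then show ?thesis by (simp add: t_def algebra_simps)
  qed
  ultimately have s: "\<bar>(\<E> x. \<phi> (euler_map f \<delta> h (Suc k) x) * ou_op (\<delta> + Suc k * h) f x)
     - (\<E> x. \<phi> (?T x) * ou_op t f x)\<bar> \<le> St * (L1 + M1) * (h * sqrt h)"
    by (simp add: t_def ou_velocity_def)
  have m1: "(L + M) * ?e ^ k \<le> (L + M) * ?e ^ Suc k"
    using LM0 e1 by (intro mult_left_mono power_increasing) auto
  have "St * (L1 + M1) * (h * sqrt h) \<le> St * ((L + M) * ?e ^ Suc k) * (h * sqrt h)"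
    using LM m1 St0 h C0 LM0 by (intro mult_right_mono mult_left_mono) auto
  moreover have "k * (St * ((L + M) * ?e ^ k) * (h * sqrt h)) \<le> k * (St * ((L + M) * ?e ^ Suc k) * (h * sqrt h))"
    using m1 St0 h C0 LM0 by (intro mult_right_mono mult_left_mono) auto
  ultimately have "\<bar>(\<E> x. \<phi> (euler_map f \<delta> h (Suc k) x) * ou_op (\<delta> + Suc k * h) f x) - (\<E> x. \<phi> x * ou_op \<delta> f x)\<bar>
      \<le> St * ((L + M) * ?e ^ Suc k) * (h * sqrt h) + k * (St * ((L + M) * ?e ^ Suc k) * (h * sqrt h))"
    using s est by linarith
  also have "\<dots> = Suc k * (St * ((L + M) * ?e ^ Suc k) * (h * sqrt h))" by (simp only: of_nat_Suc distrib_right mult_1_left)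
  finally show ?case using E LM2 by blast
qed

lemma euler_map_measurable:
  assumes v: "\<And>t. \<delta> \<le> t \<Longrightarrow> smooth_velocity (ou_velocity t f) (ou_velocity_deriv t f) C" and h: "0 \<le> h"
  shows "euler_map f \<delta> h k \<in> borel_measurable borel"
proof (induction k)
  case (Suc k)
  note [measurable] = Suc.IH smooth_velocityD(1)[OF v]
  have "\<delta> \<le> \<delta> + k * h" using h by simp
  from smooth_velocityD(1)[OF v[OF this]] have [measurable]: "ou_velocity (\<delta> + k * h) f \<in> borel_measurable borel" .
  show ?case by simp
qed simp

text \<open>Three errors add up: \<epsilon> times \<open>L + M\<close> from the Euler steps,
  \<epsilon> from replacing the density at time \<open>\<delta> + X\<close> by 1, and \<epsilon>
  from replacing the one at time \<delta> by \<open>f\<close>.\<close>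

lemma approx_transport:
  assumes \<epsilon>: "0 < \<epsilon>"
  obtains T :: "'a \<Rightarrow> 'a" where "T \<in> borel_measurable borel"
    "\<And>x y. norm (T y - T x) \<le> transport_lip * norm (y - x)"
    "\<And>x. norm (T x - x) \<le> lip_const"
    "\<And>\<phi> g L M. has_quadratic_remainder \<phi> g L M \<Longrightarrow> (\<And>x. \<bar>\<phi> x\<bar> \<le> 1) \<Longrightarrow>
      \<bar>(\<E> x. \<phi> (T x)) - (\<E> x. \<phi> x * f x)\<bar> \<le> \<epsilon> * (L + M + 2)"
proof -
  let ?K = "gauss_dom_int TYPE('a)"
  define Q where "Q = exp c * lip_const"
  define W where "W = 2 * ?K * Q"
  have K: "1 \<le> ?K" by (rule gauss_dom_int_ge1)
  have Q0: "0 \<le> Q" using lip_const_nonneg by (simp add: Q_def)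
  then have W0: "0 \<le> W" using K by (simp add: W_def)
  \<comment> \<open>Makes \<open>sqrt (2 * \<delta>)\<close> equal to
    \<open>\<epsilon> / (W + 1)\<close>; the added 1 covers \<open>W = 0\<close>.\<close>
  define \<delta> where "\<delta> = (\<epsilon> / (W + 1))\<^sup>2 / 2"
  have \<delta>: "0 < \<delta>" using \<epsilon> W0 by (simp add: \<delta>_def)
  have W\<delta>: "W * sqrt (1 - exp (- 2 * \<delta>)) \<le> \<epsilon>"
  proof -
    have "sqrt (1 - exp (- 2 * \<delta>)) \<le> sqrt (2 * \<delta>)" using exp_ge_add_one_self[of "- 2 * \<delta>"] by simp
    also have "\<dots> = \<epsilon> / (W + 1)" using \<epsilon> W0 by (simp add: \<delta>_def)
    finally have "W * sqrt (1 - exp (- 2 * \<delta>)) \<le> W * (\<epsilon> / (W + 1))" using W0 by (intro mult_left_mono)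
    also have "\<dots> \<le> (W + 1) * (\<epsilon> / (W + 1))" using W0 \<epsilon> by (intro mult_right_mono) auto
    also have "\<dots> = \<epsilon>" using W0 by simp
    finally show ?thesis .
  qed
  define X where "X = W / \<epsilon> + 1"
  have X: "1 \<le> X" using W0 \<epsilon> by (simp add: X_def)
  have WX: "W * exp (- t) \<le> \<epsilon>" if "X \<le> t" for t
  proof -
    have "W \<le> \<epsilon> * t" using that \<epsilon> by (simp add: X_def field_simps)
    also have "\<dots> \<le> \<epsilon> * exp t" using exp_ge_add_one_self[of t] \<epsilon> by (intro mult_left_mono) linarith+
    finally show ?thesis by (simp add: exp_minus field_simps)
  qed
  obtain L' M' C where reg: "\<forall>t\<ge>\<delta>. has_quadratic_remainder (ou_op t f) (ou_grad t f) L' M' \<and>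
      smooth_velocity (ou_velocity t f) (ou_velocity_deriv t f) C"
    using ou_regularity[of f "exp (- c)" "exp c" \<delta>] \<delta> f_bounds by auto
  then have q: "has_quadratic_remainder (ou_op t f) (ou_grad t f) L' M'"
    and v: "smooth_velocity (ou_velocity t f) (ou_velocity_deriv t f) C" if "\<delta> \<le> t" for t using that by auto
  have C0: "0 \<le> C" using smooth_velocityD(5)[OF v[OF order_refl]] .
  define St where "St = step_const ?K (exp (- c)) (exp c) L' M'"
  have St0: "0 \<le> St"
    unfolding St_def step_const_def using K has_quadratic_remainderD(3,4)[OF q[OF order_refl]]
    by (intro add_nonneg_nonneg mult_nonneg_nonneg divide_nonneg_nonneg) auto
  \<comment> \<open>As \<open>N * h = X\<close>, the growth factor is
    \<open>exp (3 * C * h) ^ N = exp (3 * C * X)\<close> and the summed step errors are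
    \<open>(L + M) * (Y * sqrt h)\<close>.\<close>
  define Y where "Y = X * St * exp (3 * C * X)"
  have Y0: "0 \<le> Y" using X St0 by (simp add: Y_def)
  \<comment> \<open>The bounds ensure, in turn, \<open>h \<le> 1\<close>,
    \<open>h \<le> \<delta>\<close>, \<open>h * C \<le> 1\<close> and
    \<open>Y * sqrt h \<le> \<epsilon>\<close>.\<close>
  define \<eta> where "\<eta> = min (min 1 \<delta>) (min (1 / (C + 1)) ((\<epsilon> / (Y + 1))\<^sup>2))"
  have \<eta>0: "0 < \<eta>" using \<delta> C0 \<epsilon> Y0 by (simp add: \<eta>_def)
  obtain N :: nat where N: "X / \<eta> < N" using reals_Archimedean2 by blast
  have N0: "0 < real N" using N X \<eta>0 by (smt (verit) divide_pos_pos)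
  define h where "h = X / N"
  have h0: "0 < h" using N0 X by (simp add: h_def)
  have h\<eta>: "h \<le> \<eta>" using N N0 \<eta>0 X by (simp add: h_def field_simps)
  have h1: "h \<le> 1" "h \<le> \<delta>" using h\<eta> by (auto simp: \<eta>_def)
  have hC: "h * C \<le> 1"
  proof -
    have "h * C \<le> 1 / (C + 1) * (C + 1)" using h\<eta> C0 h0 by (intro mult_mono) (auto simp: \<eta>_def)
    then show ?thesis using C0 by simp
  qed
  have Yh: "Y * sqrt h \<le> \<epsilon>"
  proof -
    have "sqrt h \<le> sqrt ((\<epsilon> / (Y + 1))\<^sup>2)"
      using h\<eta> by (intro real_sqrt_le_mono) (simp add: \<eta>_def)
    also have "\<dots> = \<epsilon> / (Y + 1)" using \<epsilon> Y0 by simp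
    finally have "Y * sqrt h \<le> Y * (\<epsilon> / (Y + 1))" using Y0 by (intro mult_left_mono)
    also have "\<dots> \<le> (Y + 1) * (\<epsilon> / (Y + 1))" using Y0 \<epsilon> by (intro mult_right_mono) auto
    also have "\<dots> = \<epsilon>" using Y0 by simp
    finally show ?thesis .
  qed
  define T where "T = euler_map f \<delta> h N"
  have Nh: "N * h = X" using N0 by (simp add: h_def)
  have [measurable]: "T \<in> borel_measurable borel"
    unfolding T_def using euler_map_measurable[OF v] h0 by simp
  show thesis
  proof (rule that)
    show "T \<in> borel_measurable borel" by measurable
    show "norm (T y - T x) \<le> transport_lip * norm (y - x)" for x y
    proof -
      have "norm (T y - T x) \<le> exp (\<Theta> (\<delta> + N * h - h) - \<Theta> (\<delta> - h)) * norm (y - x)"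
        unfolding T_def by (rule euler_map_lipschitz[OF v h0 h1(2) hC])
      also have "\<dots> \<le> transport_lip * norm (y - x)"
        using h1 h0 \<delta> X Nh by (intro mult_right_mono exp_\<Theta>_diff_le) auto
      finally show ?thesis .
    qed
    show "norm (T x - x) \<le> lip_const" for x
    proof -
      have "norm (T x - x) \<le> lip_const * (exp (- (\<delta> - h)) - exp (- (\<delta> + N * h - h)))"
        unfolding T_def by (rule euler_map_displacement[OF h0 h1(2)])
      also have "\<dots> \<le> lip_const * 1"
      proof (rule mult_left_mono[OF _ lip_const_nonneg])
        have "exp (- (\<delta> - h)) \<le> 1" using h1 by simp
        then show "exp (- (\<delta> - h)) - exp (- (\<delta> + N * h - h)) \<le> 1"
          using exp_ge_zero[of "- (\<delta> + N * h - h)"] by linarith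
      qed
      finally show ?thesis by simp
    qed
    fix \<phi> :: "'a \<Rightarrow> real" and g L M
    assume \<phi>: "has_quadratic_remainder \<phi> g L M" and \<phi>1: "\<And>x. \<bar>\<phi> x\<bar> \<le> 1"
    note [measurable] = has_quadratic_remainderD(1)[OF \<phi>]
    have LM: "0 \<le> L + M" using has_quadratic_remainderD(3,4)[OF \<phi>] by simp
    let ?p = "\<lambda>t. ou_op t f"
    have pabs: "\<bar>?p t x\<bar> \<le> exp c" for t x using ou_f_bounds(2)[of t x] ou_f_pos[of t x] by simp
    have fabs: "\<bar>f x\<bar> \<le> exp c" for x using f_bounds(2)[of x] f_pos[of x] by simp
    have i1: "integrable std_gaussian (\<lambda>x. \<phi> (T x) * ?p t x)" for t
      by (rule std_gaussian.integrable_const_bound[where B="exp c"])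
        (use abs_mult_le_of_le_one[OF \<phi>1 pabs] in auto)
    have i2: "integrable std_gaussian (\<lambda>x. \<phi> x * ?p t x)" for t
      by (rule std_gaussian.integrable_const_bound[where B="exp c"])
        (use abs_mult_le_of_le_one[OF \<phi>1 pabs] in auto)
    have i3: "integrable std_gaussian (\<lambda>x. \<phi> x * f x)"
      by (rule std_gaussian.integrable_const_bound[where B="exp c"])
        (use abs_mult_le_of_le_one[OF \<phi>1 fabs] in auto)
    have i4: "integrable std_gaussian (\<lambda>x. \<phi> (T x))"
      by (rule std_gaussian.integrable_const_bound[where B=1]) (use \<phi>1 in auto)
    have "\<bar>(\<E> x. \<phi> (T x) * ?p (\<delta> + X) x) - (\<E> x. \<phi> x * ?p \<delta> x)\<bar>
      \<le> N * (St * ((L + M) * exp (3 * C * h) ^ N) * (h * sqrt h))"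
      using euler_map_test_function[OF q v h0 h1(1) hC \<delta> \<phi> \<phi>1, of N] unfolding T_def St_def Nh by blast
    also have "\<dots> = (L + M) * (Y * sqrt h)"
    proof -
      have "exp (3 * C * h) ^ N = exp (3 * C * X)" by (simp add: exp_of_nat_mult[symmetric] Nh[symmetric] mult_ac)
      then show ?thesis by (simp add: Y_def Nh[symmetric] mult_ac)
    qed
    also have "\<dots> \<le> (L + M) * \<epsilon>" using LM Yh by (intro mult_left_mono)
    finally have e1: "\<bar>(\<E> x. \<phi> (T x) * ?p (\<delta> + X) x) - (\<E> x. \<phi> x * ?p \<delta> x)\<bar> \<le> (L + M) * \<epsilon>" .
    have "(\<E> x. \<phi> (T x) * ?p (\<delta> + X) x) - (\<E> x. \<phi> (T x))
      = (\<E> x. \<phi> (T x) * (?p (\<delta> + X) x - 1))"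
      using i1 i4 by (simp add: right_diff_distrib)
    also have "\<bar>\<dots>\<bar> \<le> (Q * exp (- (\<delta> + X))) * ?K + Q * exp (- (\<delta> + X)) * ?K"
    proof (rule abs_integral_bound_gauss(2))
      show "\<bar>\<phi> (T x) * (?p (\<delta> + X) x - 1)\<bar> \<le> (Q * exp (- (\<delta> + X))) * gauss_dom x + Q * exp (- (\<delta> + X)) * ?K" for x
        using \<delta> X by (intro abs_mult_le_of_le_one[OF \<phi>1] order_trans[OF ou_f_close_one])
          (auto simp: Q_def algebra_simps)
    qed simp
    also have "\<dots> = W * exp (- (\<delta> + X))" by (simp add: W_def)
    also have "\<dots> \<le> \<epsilon>" using \<delta> by (intro WX) simp
    finally have e2: "\<bar>(\<E> x. \<phi> (T x) * ?p (\<delta> + X) x) - (\<E> x. \<phi> (T x))\<bar> \<le> \<epsilon>" .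
    let ?s = "sqrt (1 - exp (- 2 * \<delta>))"
    have "(\<E> x. \<phi> x * ?p \<delta> x) - (\<E> x. \<phi> x * f x)
      = (\<E> x. \<phi> x * (?p \<delta> x - f x))"
      using i2 i3 by (simp add: right_diff_distrib)
    also have "\<bar>\<dots>\<bar> \<le> (Q * ?s) * ?K + Q * ?s * ?K"
    proof (rule abs_integral_bound_gauss(2))
      show "\<bar>\<phi> x * (?p \<delta> x - f x)\<bar> \<le> (Q * ?s) * gauss_dom x + Q * ?s * ?K" for x
        using \<delta> by (intro abs_mult_le_of_le_one[OF \<phi>1] order_trans[OF ou_f_close_f])
          (auto simp: Q_def algebra_simps)
    qed simp
    also have "\<dots> = W * ?s" by (simp add: W_def)
    finally have e3: "\<bar>(\<E> x. \<phi> x * ?p \<delta> x) - (\<E> x. \<phi> x * f x)\<bar> \<le> \<epsilon>"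
      using W\<delta> by linarith
    show "\<bar>(\<E> x. \<phi> (T x)) - (\<E> x. \<phi> x * f x)\<bar> \<le> \<epsilon> * (L + M + 2)"
      using e1 e2 e3 by (simp add: algebra_simps)
  qed
qed

section \<open>Passage to the limit\<close>

text \<open>The Lipschitz and displacement bounds of \<open>approx_transport\<close> do not depend
  on \<epsilon>, so a subsequence converges pointwise; dominated convergence passes to the limit for
  each continuous bounded test function.\<close>

lemma limit_transport:
  obtains T :: "'a \<Rightarrow> 'a" where "T \<in> borel_measurable borel"
    "\<And>x y. norm (T y - T x) \<le> transport_lip * norm (y - x)"
    "\<And>\<phi> g L M. has_quadratic_remainder \<phi> g L M \<Longrightarrow> (\<And>x. \<bar>\<phi> x\<bar> \<le> 1) \<Longrightarrow>
      (\<E> x. \<phi> (T x)) = (\<E> x. \<phi> x * f x)"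
proof -
  define P where "P n T \<longleftrightarrow> T \<in> borel_measurable borel \<and>
    (\<forall>x y. norm (T y - T x) \<le> transport_lip * norm (y - x)) \<and>
    (\<forall>x. norm (T x - x) \<le> lip_const) \<and>
    (\<forall>\<phi> g L M. has_quadratic_remainder \<phi> g L M \<longrightarrow> (\<forall>x. \<bar>\<phi> x\<bar> \<le> 1) \<longrightarrow>
      \<bar>(\<E> x. \<phi> (T x)) - (\<E> x. \<phi> x * f x)\<bar> \<le> 1 / Suc n * (L + M + 2))"
    for n :: nat and T :: "'a \<Rightarrow> 'a"
  have "\<forall>n. \<exists>T. P n T"
  proof
    fix n
    show "\<exists>T. P n T"
      by (rule approx_transport[of "1 / Suc n"]) (simp, unfold P_def, blast)
  qed
  then obtain T where "\<forall>n. P n (T n)" using choice[of P] by blast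
  then have Tm: "T n \<in> borel_measurable borel"
    and Tl: "norm (T n y - T n x) \<le> transport_lip * norm (y - x)"
    and Td: "norm (T n x - x) \<le> lip_const"
    and Ta: "has_quadratic_remainder \<phi> g L M \<Longrightarrow> \<forall>x. \<bar>\<phi> x\<bar> \<le> 1 \<Longrightarrow>
      \<bar>(\<E> x. \<phi> (T n x)) - (\<E> x. \<phi> x * f x)\<bar> \<le> 1 / Suc n * (L + M + 2)"
    for n x y \<phi> g L M unfolding P_def by blast+
  have L0: "0 \<le> transport_lip" by (simp add: transport_lip_def)
  obtain r S where r: "strict_mono (r :: nat \<Rightarrow> nat)" and S: "\<And>x. (\<lambda>n. T (r n) x) \<longlonglongrightarrow> S x"
    by (rule lipschitz_seq_convergent_subseq[where T=T, OF Tl L0 Td]) (rule that, auto)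
  show thesis
  proof (rule that)
    show Sm: "S \<in> borel_measurable borel"
      by (rule borel_measurable_LIMSEQ_metric[where f="\<lambda>n. T (r n)"]) (use Tm S in auto)
    show "norm (S y - S x) \<le> transport_lip * norm (y - x)" for x y
      by (rule tendsto_upperbound[OF tendsto_norm[OF tendsto_diff[OF S S]]]) (use Tl in auto)
    fix \<phi> :: "'a \<Rightarrow> real" and g L M
    assume \<phi>: "has_quadratic_remainder \<phi> g L M" and \<phi>1: "\<And>x. \<bar>\<phi> x\<bar> \<le> 1"
    note [measurable] = has_quadratic_remainderD(1)[OF \<phi>] Tm Sm
    have c: "isCont \<phi> x" for x
      using has_derivative_continuous[OF has_quadratic_remainder_has_derivative[OF \<phi>]] .
    have l1: "(\<lambda>n. \<E> x. \<phi> (T (r n) x)) \<longlonglongrightarrow> (\<E> x. \<phi> (S x))"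
    proof (rule integral_dominated_convergence[where w="\<lambda>_. 1"])
      show "AE x in std_gaussian. (\<lambda>n. \<phi> (T (r n) x)) \<longlonglongrightarrow> \<phi> (S x)"
        using isCont_tendsto_compose[OF c S] by simp
    qed (use \<phi>1 in auto)
    have "(\<lambda>n. (\<E> x. \<phi> (T (r n) x)) - (\<E> x. \<phi> x * f x)) \<longlonglongrightarrow> 0"
    proof (rule Lim_null_comparison)
      show "\<forall>\<^sub>F n in sequentially. norm ((\<E> x. \<phi> (T (r n) x)) - (\<E> x. \<phi> x * f x))
        \<le> 1 / Suc (r n) * (L + M + 2)"
        using Ta[OF \<phi>] \<phi>1 by (intro always_eventually) auto
      have "(\<lambda>n. 1 / real (Suc n)) \<longlonglongrightarrow> 0" by (rule LIMSEQ_Suc[OF lim_1_over_n])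
      from LIMSEQ_subseq_LIMSEQ[OF this r] show "(\<lambda>n. 1 / Suc (r n) * (L + M + 2)) \<longlonglongrightarrow> 0"
        by (intro tendsto_mult_left_zero) (simp add: comp_def)
    qed
    then have "(\<lambda>n. \<E> x. \<phi> (T (r n) x)) \<longlonglongrightarrow> (\<E> x. \<phi> x * f x)"
      by (simp add: LIM_zero_iff)
    with l1 show "(\<E> x. \<phi> (S x)) = (\<E> x. \<phi> x * f x)" by (rule LIMSEQ_unique)
  qed
qed

text \<open>The equality spreads from smooth test functions to bounded Lipschitz ones by
  mollification, then to indicators of closed sets by Lipschitz cutoffs, and finally to all Borel
  sets since closed sets form an intersection-stable generator.\<close>

lemma pushforward_eqI:
  fixes T :: "'a \<Rightarrow> 'a"
  assumes [measurable]: "T \<in> borel_measurable borel"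
    and eq: "\<And>\<phi> g L M. has_quadratic_remainder \<phi> g L M \<Longrightarrow> (\<And>x. \<bar>\<phi> x\<bar> \<le> 1) \<Longrightarrow>
      (\<E> x. \<phi> (T x)) = (\<E> x. \<phi> x * f x)"
  shows "distr std_gaussian borel T = density std_gaussian (\<lambda>x. ennreal (f x))"
proof -
  let ?\<nu> = "distr std_gaussian borel T" and ?\<mu> = "density std_gaussian (\<lambda>x. ennreal (f x))"
  have Tm: "T \<in> measurable std_gaussian borel"
    using assms(1) by (simp only: measurable_cong_sets[OF sets_std_gaussian refl])
  have \<nu>: "prob_space ?\<nu>" by (rule std_gaussian.prob_space_distr[OF Tm])
  have \<mu>: "prob_space ?\<mu>" using prob by (simp only: f_def)
  note fin = \<nu>[THEN prob_space.axioms(1)] \<mu>[THEN prob_space.axioms(1)]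
  let ?K = "gauss_dom_int TYPE('a)"
  have fabs: "\<bar>f x\<bar> \<le> exp c" for x using f_bounds(2)[of x] f_pos[of x] by simp
  have lip: "(\<integral>x. \<psi> x \<partial>?\<nu>) = (\<integral>x. \<psi> x \<partial>?\<mu>)"
    if \<psi> [measurable]: "\<psi> \<in> borel_measurable borel" and bd: "\<And>x. \<bar>\<psi> x\<bar> \<le> 1"
      and lip: "\<And>x y. \<bar>\<psi> y - \<psi> x\<bar> \<le> K * norm (y - x)" and K: "0 \<le> K" for \<psi> :: "'a \<Rightarrow> real" and K
  proof -
    have "(\<integral>x. \<psi> x \<partial>?\<nu>) = (\<E> x. \<psi> (T x))" by (simp add: integral_distr)
    moreover have "(\<integral>x. \<psi> x \<partial>?\<mu>) = (\<E> x. \<psi> x * f x)"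
      by (subst integral_density) (auto simp: less_imp_le[OF f_pos] mult.commute)
    moreover have "\<bar>(\<E> x. \<psi> (T x)) - (\<E> x. \<psi> x * f x)\<bar> \<le> (K * ?K * (1 + exp c)) * s" if s: "0 < s" for s
    proof -
      obtain \<phi> g L M where \<phi>: "has_quadratic_remainder \<phi> g L M" and \<phi>1: "\<And>x. \<bar>\<phi> x\<bar> \<le> 1"
        and cl: "\<And>x. \<bar>\<phi> x - \<psi> x\<bar> \<le> K * ?K * s"
        by (rule gaussian_mollification[OF \<psi> bd lip K s]) (rule that, auto)
      note [measurable] = has_quadratic_remainderD(1)[OF \<phi>]
      have i: "integrable std_gaussian (\<lambda>x. u (T x))" "integrable std_gaussian (\<lambda>x. u x * f x)"
        if [measurable]: "u \<in> borel_measurable borel" and "\<And>x. \<bar>u x\<bar> \<le> 1" for u :: "'a \<Rightarrow> real"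
      proof -
        show "integrable std_gaussian (\<lambda>x. u (T x))"
          by (rule std_gaussian.integrable_const_bound[where B=1]) (use that in auto)
        show "integrable std_gaussian (\<lambda>x. u x * f x)"
          by (rule std_gaussian.integrable_const_bound[where B="exp c"])
            (use abs_mult_le_of_le_one[OF that(2) fabs] in auto)
      qed
      note ip = i[OF has_quadratic_remainderD(1)[OF \<phi>] \<phi>1] and ips = i[OF \<psi> bd]
      have "\<bar>(\<E> x. \<psi> (T x) - \<phi> (T x))\<bar> \<le> 0 * ?K + K * ?K * s"
        by (rule abs_integral_bound_gauss(2)) (use cl in \<open>auto simp: abs_minus_commute\<close>)
      moreover have "\<bar>(\<E> x. \<phi> x * f x - \<psi> x * f x)\<bar> \<le> 0 * ?K + (K * ?K * s) * exp c"
      proof (rule abs_integral_bound_gauss(2))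
        fix x
        have "\<bar>\<phi> x - \<psi> x\<bar> * \<bar>f x\<bar> \<le> (K * ?K * s) * exp c"
          using cl[of x] fabs[of x] by (intro mult_mono) (auto intro: order_trans[OF abs_ge_zero])
        then show "\<bar>\<phi> x * f x - \<psi> x * f x\<bar> \<le> 0 * gauss_dom x + (K * ?K * s) * exp c"
          by (simp add: left_diff_distrib[symmetric] abs_mult)
      qed simp
      moreover have "(\<E> x. \<psi> (T x)) - (\<E> x. \<psi> x * f x)
        = (\<E> x. \<psi> (T x) - \<phi> (T x)) + (\<E> x. \<phi> x * f x - \<psi> x * f x)"
        using ip ips eq[OF \<phi> \<phi>1] by simp
      ultimately show ?thesis by (simp add: algebra_simps)
    qed
    then have "\<bar>(\<E> x. \<psi> (T x)) - (\<E> x. \<psi> x * f x)\<bar> \<le> 0"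
      by (rule nonpos_if_le_mult_pos)
    ultimately show ?thesis by simp
  qed
  show ?thesis
  proof (rule measure_eqI_generator_eq[where E="Collect closed" and \<Omega>=UNIV and A="\<lambda>_. UNIV"])
    show "Int_stable (Collect closed :: 'a set set)" by (auto simp: Int_stable_def)
    show "sets ?\<nu> = sigma_sets UNIV (Collect closed)" "sets ?\<mu> = sigma_sets UNIV (Collect closed)"
      by (simp_all add: borel_eq_closed)
    show "emeasure ?\<nu> UNIV \<noteq> \<infinity>" using finite_measure.emeasure_finite[OF fin(1)] by simp
    fix A :: "'a set" assume "A \<in> Collect closed"
    then have A: "closed A" by simp
    show "emeasure ?\<nu> A = emeasure ?\<mu> A"
    \<comment> \<open>The distance \<open>infdist\<close> to the empty set is 0 by convention, which
      would make every cutoff below identically 1.\<close>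
    proof (cases "A = {}")
      case False
      define \<psi> where "\<psi> n x = max 0 (1 - real n * infdist x A)" for n x
      have [measurable]: "A \<in> sets borel" using A by simp
      have [measurable]: "(\<lambda>x. infdist x A) \<in> borel_measurable borel"
        by (intro borel_measurable_continuous_onI continuous_intros)
      have \<psi>m [measurable]: "\<psi> n \<in> borel_measurable borel" for n unfolding \<psi>_def[abs_def] by measurable
      have \<psi>b: "\<bar>\<psi> n x\<bar> \<le> 1" for n x by (auto simp: \<psi>_def infdist_nonneg)
      have \<psi>l: "\<bar>\<psi> n y - \<psi> n x\<bar> \<le> real n * norm (y - x)" for n x y
      proof -
        have "\<bar>infdist y A - infdist x A\<bar> \<le> norm (y - x)"
          using infdist_triangle_abs[of y A x] by (simp add: dist_norm)
        then have "real n * \<bar>infdist y A - infdist x A\<bar> \<le> real n * norm (y - x)" by (intro mult_left_mono) auto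
        moreover have "\<bar>\<psi> n y - \<psi> n x\<bar> \<le> \<bar>real n * (infdist y A - infdist x A)\<bar>"
          unfolding \<psi>_def right_diff_distrib by linarith
        ultimately show ?thesis by (simp add: abs_mult)
      qed
      have \<psi>lim: "(\<lambda>n. \<psi> n x) \<longlonglongrightarrow> indicator A x" for x
      proof (cases "x \<in> A")
        case True
        then show ?thesis by (simp add: \<psi>_def)
      next
        case x: False
        then have i: "0 < infdist x A" using A False by (metis in_closed_iff_infdist_zero infdist_nonneg less_eq_real_def)
        obtain N where N: "1 / infdist x A < real N" using reals_Archimedean2 by blast
        have "\<psi> n x = 0" if "N \<le> n" for n
        proof -
          have "1 < real N * infdist x A" using N i by (simp add: field_simps)
          also have "\<dots> \<le> real n * infdist x A" using that i by (intro mult_right_mono) auto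
          finally show ?thesis by (simp add: \<psi>_def)
        qed
        then have "\<forall>\<^sub>F n in sequentially. \<psi> n x = indicator A x"
          using x by (auto simp: eventually_sequentially)
        then show ?thesis by (rule tendsto_eventually)
      qed
      have lim: "(\<lambda>n. \<integral>x. \<psi> n x \<partial>P) \<longlonglongrightarrow> (\<integral>x. indicator A x \<partial>P)"
        if "prob_space P" and [measurable_cong, simp]: "sets P = sets borel" for P :: "'a measure"
      proof (rule integral_dominated_convergence[where w="\<lambda>_. 1"])
        show "integrable P (\<lambda>x. 1::real)"
          by (rule finite_measure.integrable_const[OF prob_space.axioms(1)[OF that(1)]])
      qed (use \<psi>b \<psi>lim in auto)
      have "(\<lambda>n. \<integral>x. \<psi> n x \<partial>?\<nu>) \<longlonglongrightarrow> (\<integral>x. indicator A x \<partial>?\<mu>)"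
        using lim[OF \<mu>] lip[OF \<psi>m \<psi>b \<psi>l] by simp
      with lim[OF \<nu>] have "(\<integral>x. indicator A x \<partial>?\<nu>) = (\<integral>x. indicator A x \<partial>?\<mu> :: real)"
        by (intro LIMSEQ_unique[where X="\<lambda>n. \<integral>x. \<psi> n x \<partial>?\<nu>"]) auto
      then have "measure ?\<nu> A = measure ?\<mu> A" by simp
      then show ?thesis by (simp add: finite_measure.emeasure_eq_measure[OF fin(1)] finite_measure.emeasure_eq_measure[OF fin(2)])
    qed simp
  qed auto
qed

end

theorem theorem3:
  fixes V :: "'a::euclidean_space \<Rightarrow> real" and lam c :: real
  assumes "lam \<ge> 1" and "c \<ge> 0"
    and "V \<in> borel_measurable borel"
    and "convex_on UNIV (\<lambda>x. V x + lam * (norm x)\<^sup>2 / 2)"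
    and "\<forall>x y. V x - V y \<le> c"
    and "prob_space (density std_gaussian (\<lambda>x. ennreal (exp (- V x))))"
  shows "\<exists>T :: 'a \<Rightarrow> 'a. T \<in> borel_measurable borel \<and>
           (2 * (2 * lam) powr (exp c))-lipschitz_on UNIV T \<and>
           distr std_gaussian borel T = density std_gaussian (\<lambda>x. ennreal (exp (- V x)))"
proof -
  interpret semiconvex_perturbation V lam c
    by (rule semiconvex_perturbation.intro[OF assms(1-4) _ assms(6)]) (use assms(5) in blast)
  obtain T :: "'a \<Rightarrow> 'a" where T: "T \<in> borel_measurable borel"
    "\<And>x y. norm (T y - T x) \<le> transport_lip * norm (y - x)"
    "\<And>\<phi> g L M. has_quadratic_remainder \<phi> g L M \<Longrightarrow> (\<And>x. \<bar>\<phi> x\<bar> \<le> 1) \<Longrightarrow>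
      (\<E> x. \<phi> (T x)) = (\<E> x. \<phi> x * f x)"
    by (rule limit_transport) (rule that, auto)
  have "distr std_gaussian borel T = density std_gaussian (\<lambda>x. ennreal (f x))"
    by (rule pushforward_eqI[OF T(1) T(3)])
  moreover have "transport_lip-lipschitz_on UNIV T"
    using T(2) by (intro lipschitz_onI) (auto simp: dist_norm transport_lip_def)
  ultimately show ?thesis using T(1) by (auto simp: f_def transport_lip_def)
qed

end
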